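(* Let $\mathbb{F}\in\{\mathbb{C},\mathbb{R},\mathbb{Q}\}$. For any integer $r\ge 3$ and any $0<\varepsilon\le 1$, there is a constant $C=C(r,\varepsilon)$ such that the following holds for every integer $n\ge 2$. Let $f\in\mathbb{F}[x_1,\dots,x_n]$ be a quadratic polynomial all of whose coefficients have absolute value at most $1$. Let $\xi=(\xi_1,\dots,\xi_n)$ be a sequence of independent Rademacher random variables, and suppose that \[\sup_{x\in\mathbb{F}}\Pr\left(f(\xi)=x\right)\ge C\cdot\frac{(\log n)^{r/2}}{n^{1-2/(r+2)}}.\] Then there is a quadratic form $h\in\mathbb{F}[x_1,\dots,x_n]$ of rank strictly less than $r$ such that the sum of the absolute values of the coefficients of $f-h$ is at most $\varepsilon n^2$.
   Context: A Rademacher random variable takes the values $1$ and $-1$ with probability $1/2$ each. The logarithm is natural. The coefficients of a quadratic polynomial in $x_1,\dots,x_n$ are those of the monomials $x_ix_j$ ($i\le j$), $x_i$, and $1$. A quadratic form over $\mathbb{F}$ in $n$ variables is a homogeneous quadratic polynomial $h\in\mathbb{F}[x_1,\dots,x_n]$; it has a unique representation $h(x)=x^TQx$ with $Q\in\mathbb{F}^{n\times n}$ symmetric, and the rank of $h$ is defined to be the rank of $Q$ (so $h=0$ has rank $0$). *)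

theory Defs
  imports
    "HOL-Library.Poly_Mapping"
    "HOL-Probability.Probability"
    "Jordan_Normal_Form.DL_Rank"
begin

text \<open>
  Polynomials in the variables \<open>x\<^sub>0, x\<^sub>1, \<dots>\<close> are finitely supported maps from monomials to
  coefficients, where a monomial is its finitely supported map of exponents.
  Poly_Mapping provides the ring structure.
\<close>

type_synonym 'a mpoly = "(nat \<Rightarrow>\<^sub>0 nat) \<Rightarrow>\<^sub>0 'a"

definition mdeg :: "(nat \<Rightarrow>\<^sub>0 nat) \<Rightarrow> nat" where
  "mdeg m = (\<Sum>i\<in>Poly_Mapping.keys m. Poly_Mapping.lookup m i)"

definition Cst :: "'a::zero \<Rightarrow> 'a mpoly" where
  "Cst c = Poly_Mapping.single 0 c"

definition X :: "nat \<Rightarrow> 'a::zero_neq_one mpoly" where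
  "X i = Poly_Mapping.single (Poly_Mapping.single i 1) 1"

definition peval :: "'a::comm_semiring_1 mpoly \<Rightarrow> (nat \<Rightarrow> 'a) \<Rightarrow> 'a" where
  "peval p a = (\<Sum>m\<in>Poly_Mapping.keys p. Poly_Mapping.lookup p m * (\<Prod>i\<in>Poly_Mapping.keys m. a i ^ Poly_Mapping.lookup m i))"

text \<open>
  The variables of a polynomial in \<open>n\<close> variables are \<open>x\<^sub>0, \<dots>, x\<^sub>n\<^sub>-\<^sub>1\<close>.
  A quadratic polynomial is one of degree at most 2; its possible monomials are thus
  \<open>x\<^sub>i x\<^sub>j\<close>, \<open>x\<^sub>i\<close> and \<open>1\<close>.
\<close>

definition quadratic_poly :: "nat \<Rightarrow> 'a::zero mpoly \<Rightarrow> bool" where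
  "quadratic_poly n f \<longleftrightarrow> (\<forall>m\<in>Poly_Mapping.keys f. Poly_Mapping.keys m \<subseteq> {..<n} \<and> mdeg m \<le> 2)"

definition quadratic_form :: "nat \<Rightarrow> 'a::zero mpoly \<Rightarrow> bool" where
  "quadratic_form n h \<longleftrightarrow> (\<forall>m\<in>Poly_Mapping.keys h. Poly_Mapping.keys m \<subseteq> {..<n} \<and> mdeg m = 2)"

definition represents :: "nat \<Rightarrow> 'a::comm_ring_1 mat \<Rightarrow> 'a mpoly \<Rightarrow> bool" where
  "represents n Q h \<longleftrightarrow> Q \<in> carrier_mat n n \<and> transpose_mat Q = Q \<and>
     h = scalar_prod (vec n X) (map_mat Cst Q *\<^sub>v vec n X)"

definition form_rank :: "nat \<Rightarrow> 'a::field mpoly \<Rightarrow> nat" where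
  "form_rank n h = vec_space.rank n (THE Q. represents n Q h)"

definition rademacher :: "'a::ring_1 pmf" where
  "rademacher = pmf_of_set {1, -1}"

text \<open>
  The joint law of \<open>n\<close> independent Rademacher variables with values in the ring \<open>'a\<close>
  (coordinates outside \<open>{..<n}\<close> are set to 0).
\<close>

definition rademacher_seq :: "nat \<Rightarrow> (nat \<Rightarrow> 'a::ring_1) pmf" where
  "rademacher_seq n = Pi_pmf {..<n} 0 (\<lambda>_. rademacher)"

definition point_prob :: "nat \<Rightarrow> 'a::comm_ring_1 mpoly \<Rightarrow> 'a \<Rightarrow> real" where
  "point_prob n f x = measure_pmf.prob (rademacher_seq n) {\<xi>. peval f \<xi> = x}"

text \<open>
  Evaluating at independent Rademacher variables on any probability space gives the same
  point probabilities as \<open>rademacher_seq\<close>.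
\<close>

lemma (in prob_space) prob_peval_rademacher:
  fixes \<xi> :: "nat \<Rightarrow> 'a \<Rightarrow> 'b::{comm_ring_1,ring_char_0}"
  assumes indep: "indep_vars (\<lambda>_. count_space UNIV) \<xi> {..<n}"
    and vals: "\<And>i \<omega>. i < n \<Longrightarrow> \<omega> \<in> space M \<Longrightarrow> \<xi> i \<omega> \<in> {1, -1}"
    and half: "\<And>i s. i < n \<Longrightarrow> s \<in> {1, -1} \<Longrightarrow> prob {\<omega> \<in> space M. \<xi> i \<omega> = s} = 1 / 2"
    and f: "quadratic_poly n f"
  shows "prob {\<omega> \<in> space M. peval f (\<lambda>i. \<xi> i \<omega>) = x} = point_prob n f x"
proof -
  have ne: "(1::'b) \<noteq> -1"
    using of_nat_eq_iff[of 2 0, where ?'a = 'b] by (auto simp: eq_neg_iff_add_eq_0)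
  define S where "S = PiE_dflt {..<n} (0::'b) (\<lambda>_. {1, -1})"
  define T where "T = {s \<in> S. peval f s = x}"
  have finS: "finite S" unfolding S_def by (intro finite_PiE_dflt) auto
  have cardS: "card S = 2 ^ n" unfolding S_def using ne by (subst card_PiE_dflt) (auto simp: numeral_2_eq_2)
  have neS: "S \<noteq> {}" using cardS by auto
  have "rademacher_seq n = pmf_of_set S"
    unfolding rademacher_seq_def rademacher_def S_def by (rule Pi_pmf_of_set) auto
  then have pp: "point_prob n f x = card T / 2 ^ n"
    unfolding point_prob_def using finS neS cardS
    by (simp add: measure_pmf_of_set T_def Collect_conj_eq Int_commute)
  define A where "A s = {\<omega> \<in> space M. \<forall>i<n. \<xi> i \<omega> = s i}" for s
  have rv: "\<xi> i \<in> measurable M (count_space UNIV)" if "i < n" for i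
    using indep that unfolding indep_vars_def by auto
  have pA: "A s \<in> events \<and> prob (A s) = 1 / 2 ^ n" if s: "s \<in> S" for s
  proof (cases "n = 0")
    case True
    then show ?thesis by (simp add: A_def prob_space)
  next
    case False
    have eq: "A s = (\<Inter>i\<in>{..<n}. \<xi> i -` {s i} \<inter> space M)"
      using False by (auto simp: A_def)
    have "prob (\<Inter>i\<in>{..<n}. \<xi> i -` {s i} \<inter> space M)
        = (\<Prod>i<n. prob (\<xi> i -` {s i} \<inter> space M))"
      using False by (intro indep_varsD[OF indep]) auto
    also have "\<dots> = (\<Prod>i<n. 1 / 2)"
    proof (rule prod.cong)
      fix i assume i: "i \<in> {..<n}"
      have "\<xi> i -` {s i} \<inter> space M = {\<omega> \<in> space M. \<xi> i \<omega> = s i}" by auto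
      then show "prob (\<xi> i -` {s i} \<inter> space M) = 1 / 2"
        using half[of i "s i"] s i by (auto simp: S_def PiE_dflt_def)
    qed simp
    finally have 1: "prob (A s) = 1 / 2 ^ n" by (simp add: eq power_one_over)
    have "A s \<in> events"
      unfolding eq using False by (intro sets.finite_INT) (auto intro!: measurable_sets[OF rv])
    with 1 show ?thesis by simp
  qed
  have pe: "peval f (\<lambda>i. \<xi> i \<omega>) = peval f s" if "\<omega> \<in> A s" for \<omega> s
    unfolding peval_def
  proof (rule sum.cong, simp, rule arg_cong[where f = "(*) _"], rule prod.cong, simp)
    fix m i assume "m \<in> Poly_Mapping.keys f" "i \<in> Poly_Mapping.keys m"
    then have "i < n" using f by (auto simp: quadratic_poly_def)
    then show "\<xi> i \<omega> ^ Poly_Mapping.lookup m i = s i ^ Poly_Mapping.lookup m i"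
      using that by (simp add: A_def)
  qed
  have "{\<omega> \<in> space M. peval f (\<lambda>i. \<xi> i \<omega>) = x} = (\<Union>s\<in>T. A s)" (is "?E = _")
  proof (intro equalityI subsetI)
    fix \<omega> assume w: "\<omega> \<in> ?E"
    define s where "s = (\<lambda>i. if i < n then \<xi> i \<omega> else 0)"
    have "s \<in> S" using vals w by (fastforce simp: S_def PiE_dflt_def s_def)
    moreover have "\<omega> \<in> A s" using w by (simp add: A_def s_def)
    ultimately show "\<omega> \<in> (\<Union>s\<in>T. A s)" using pe[of \<omega> s] w by (auto simp: T_def)
  next
    fix \<omega> assume "\<omega> \<in> (\<Union>s\<in>T. A s)"
    then obtain s where "s \<in> T" "\<omega> \<in> A s" by auto
    then show "\<omega> \<in> ?E" using pe[of \<omega> s] by (simp add: T_def A_def)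
  qed
  moreover have "disjoint_family_on A T"
    unfolding disjoint_family_on_def
  proof (intro ballI impI, rule ccontr)
    fix s t assume st: "s \<in> T" "t \<in> T" "s \<noteq> t" and "A s \<inter> A t \<noteq> {}"
    then have eq: "\<forall>i<n. s i = t i" by (auto simp: A_def)
    have "s i = t i" for i
      using eq st by (cases "i < n") (auto simp: T_def S_def PiE_dflt_def)
    with st show False by auto
  qed
  moreover have "finite T" using finS by (simp add: T_def)
  ultimately have "prob ?E = (\<Sum>s\<in>T. prob (A s))"
    using pA by (simp, intro finite_measure_finite_Union) (auto simp: T_def)
  also have "\<dots> = card T / 2 ^ n" using pA by (simp add: T_def)
  finally show ?thesis using pp by simp
qed

text \<open>Each quadratic form has a unique symmetric matrix, so \<open>form_rank\<close> is well defined.\<close>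

lemma single_add_eq_iff:
  fixes a b c d :: nat
  shows "Poly_Mapping.single a (1::nat) + Poly_Mapping.single b 1
      = Poly_Mapping.single c 1 + Poly_Mapping.single d 1
    \<longleftrightarrow> (a = c \<and> b = d) \<or> (a = d \<and> b = c)" (is "?l = ?r \<longleftrightarrow> _")
proof
  assume "?l = ?r"
  then have "Poly_Mapping.lookup ?l k = Poly_Mapping.lookup ?r k" for k by simp
  from this[of a] this[of b] show "(a = c \<and> b = d) \<or> (a = d \<and> b = c)"
    by (auto simp: lookup_add lookup_single when_def split: if_splits)
qed (auto simp: add.commute)

lemma mdeg_2E:
  assumes "mdeg m = 2"
  obtains a b where "m = Poly_Mapping.single a 1 + Poly_Mapping.single b 1"
    "a \<in> Poly_Mapping.keys m" "b \<in> Poly_Mapping.keys m"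
proof -
  have step: "\<exists>a\<in>Poly_Mapping.keys m. \<exists>m'. m = Poly_Mapping.single a 1 + m' \<and> mdeg m = Suc (mdeg m')"
    if "mdeg m \<noteq> 0" for m
  proof -
    have "Poly_Mapping.keys m \<noteq> {}"
      using that by (auto simp: mdeg_def simp del: keys_eq_empty)
    then obtain a where a: "a \<in> Poly_Mapping.keys m" by blast
    define m' where "m' = m - Poly_Mapping.single a 1"
    have pos: "Poly_Mapping.lookup m a > 0" using a by (simp add: in_keys_iff)
    have m: "m = Poly_Mapping.single a 1 + m'"
      using pos by (intro poly_mapping_eqI) (auto simp: m'_def lookup_add lookup_minus lookup_single when_def)
    have sub: "Poly_Mapping.keys m' \<subseteq> Poly_Mapping.keys m"
      by (auto simp: m'_def in_keys_iff lookup_minus)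
    have "mdeg m' = (\<Sum>i\<in>Poly_Mapping.keys m. Poly_Mapping.lookup m' i)"
      unfolding mdeg_def using sub by (intro sum.mono_neutral_left) (auto simp: in_keys_iff)
    moreover have "mdeg m = (\<Sum>i\<in>Poly_Mapping.keys m. (1 when a = i) + Poly_Mapping.lookup m' i)"
      unfolding mdeg_def
      by (rule sum.cong[OF refl], subst m) (simp only: lookup_add lookup_single)
    ultimately have "mdeg m = Suc (mdeg m')"
      using a by (simp add: sum.distrib when_def)
    with a m show ?thesis by blast
  qed
  obtain a m' where 1: "a \<in> Poly_Mapping.keys m" "m = Poly_Mapping.single a 1 + m'" "mdeg m' = 1"
    using step[of m] assms by auto
  obtain b m'' where 2: "m' = Poly_Mapping.single b 1 + m''" "mdeg m'' = 0"
    using step[of m'] 1 by auto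
  have "m'' = 0"
    using 2(2) by (intro poly_mapping_eqI) (auto simp: mdeg_def in_keys_iff)
  then have m: "m = Poly_Mapping.single a 1 + Poly_Mapping.single b 1" using 1 2 by simp
  then have "b \<in> Poly_Mapping.keys m" by (simp add: in_keys_iff lookup_add lookup_single)
  with that m 1 show ?thesis by blast
qed

lemma matrix_form_eq:
  fixes Q :: "'a::comm_ring_1 mat"
  assumes "Q \<in> carrier_mat n n"
  shows "scalar_prod (vec n X) (map_mat Cst Q *\<^sub>v vec n X)
    = (\<Sum>i<n. \<Sum>j<n. Poly_Mapping.single (Poly_Mapping.single i 1 + Poly_Mapping.single j 1) (Q $$ (i, j)))"
  using assms
  by (auto simp: scalar_prod_def sum_distrib_left X_def Cst_def mult_single atLeast0LessThan
      intro!: sum.cong)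

lemma lookup_matrix_form:
  fixes Q :: "'a::comm_ring_1 mat"
  assumes "Q \<in> carrier_mat n n" "a < n" "b < n"
  shows "Poly_Mapping.lookup (scalar_prod (vec n X) (map_mat Cst Q *\<^sub>v vec n X))
      (Poly_Mapping.single a 1 + Poly_Mapping.single b 1)
    = (if a = b then Q $$ (a, a) else Q $$ (a, b) + Q $$ (b, a))"
proof -
  have "Poly_Mapping.lookup (scalar_prod (vec n X) (map_mat Cst Q *\<^sub>v vec n X))
      (Poly_Mapping.single a 1 + Poly_Mapping.single b 1)
    = (\<Sum>i<n. \<Sum>j<n. if (i = a \<and> j = b) \<or> (i = b \<and> j = a) then Q $$ (i, j) else 0)"
    unfolding matrix_form_eq[OF assms(1)] lookup_sum lookup_single single_add_eq_iff when_def ..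
  also have "\<dots> = (\<Sum>p\<in>{..<n} \<times> {..<n}. if p \<in> {(a, b), (b, a)} then Q $$ p else 0)"
    by (auto simp: sum.cartesian_product intro!: sum.cong)
  also have "\<dots> = (\<Sum>p\<in>{(a, b), (b, a)}. Q $$ p)"
    using assms by (subst sum.inter_restrict[symmetric]) (auto intro!: sum.cong)
  also have "\<dots> = (if a = b then Q $$ (a, a) else Q $$ (a, b) + Q $$ (b, a))" by auto
  finally show ?thesis .
qed

lemma represents_ex1:
  fixes h :: "'a::field_char_0 mpoly"
  assumes h: "quadratic_form n h"
  shows "\<exists>!Q. represents n Q h"
proof (rule ex_ex1I)
  let ?m = "\<lambda>a b. Poly_Mapping.single a (1::nat) + Poly_Mapping.single b 1"
  define Q where "Q = mat n n (\<lambda>(i, j). Poly_Mapping.lookup h (?m i j) / (if i = j then 1 else 2))"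
  have Q: "Q \<in> carrier_mat n n" by (simp add: Q_def)
  have "h = scalar_prod (vec n X) (map_mat Cst Q *\<^sub>v vec n X)"
  proof (rule poly_mapping_eqI)
    fix m
    show "Poly_Mapping.lookup h m = Poly_Mapping.lookup (scalar_prod (vec n X) (map_mat Cst Q *\<^sub>v vec n X)) m"
    proof (cases "\<exists>a<n. \<exists>b<n. m = ?m a b")
      case True
      then obtain a b where ab: "a < n" "b < n" and m: "m = ?m a b" by blast
      show ?thesis
        unfolding m lookup_matrix_form[OF Q ab] using ab
        by (auto simp: Q_def add.commute)
    next
      case False
      have "m \<notin> Poly_Mapping.keys h"
      proof
        assume "m \<in> Poly_Mapping.keys h"
        then have "mdeg m = 2" "Poly_Mapping.keys m \<subseteq> {..<n}"
          using h by (auto simp: quadratic_form_def)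
        with False show False by (elim mdeg_2E) blast
      qed
      moreover have "Poly_Mapping.lookup (scalar_prod (vec n X) (map_mat Cst Q *\<^sub>v vec n X)) m = 0"
        unfolding matrix_form_eq[OF Q] lookup_sum lookup_single
      proof (intro sum.neutral ballI)
        fix a b assume "a \<in> {..<n}" "b \<in> {..<n}"
        with False have "?m a b \<noteq> m" by blast
        then show "(Q $$ (a, b) when ?m a b = m) = 0" unfolding when_def by (rule if_not_P)
      qed
      ultimately show ?thesis by (simp add: in_keys_iff)
    qed
  qed
  then have "represents n Q h"
    by (auto simp: represents_def Q_def add.commute)
  then show "\<exists>Q. represents n Q h" ..
next
  fix Q R assume QR: "represents n Q h" "represents n R h"
  have "S $$ (i, j) * (if i = j then 1 else 2)
      = Poly_Mapping.lookup h (Poly_Mapping.single i 1 + Poly_Mapping.single j 1)"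
    if S: "represents n S h" and ij: "i < n" "j < n" for S i j
  proof -
    from S have c: "S \<in> carrier_mat n n" and t: "transpose_mat S = S"
      and hS: "h = scalar_prod (vec n X) (map_mat Cst S *\<^sub>v vec n X)"
      by (auto simp: represents_def)
    have "S $$ (j, i) = S $$ (i, j)"
      using index_transpose_mat(1)[of i S j] t c ij by simp
    then show ?thesis
      by (subst hS, subst lookup_matrix_form[OF c ij]) auto
  qed
  note entry = this
  have dims: "Q \<in> carrier_mat n n" "R \<in> carrier_mat n n"
    using QR by (auto simp: represents_def)
  have "Q $$ (i, j) = R $$ (i, j)" if "i < n" "j < n" for i j
    using trans[OF entry[OF QR(1) that] entry[OF QR(2) that, symmetric]]
    by (simp split: if_splits)
  with dims show "Q = R" by (intro eq_matI) auto
qed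

end

theory Submission
  imports Defs
begin

text \<open>
  The proof is a dichotomy for the symmetric coefficient matrix \<open>Q\<close> of the quadratic part of \<open>f\<close>.

  Structured case.  Eliminate greedily.  A minor of size \<open>k\<close> whose determinant is bounded away from 0
  predicts the whole matrix from \<open>k\<close> of its rows and \<open>k\<close> of its columns, and the prediction error at
  an entry is the determinant of the bordered minor divided by the determinant of the minor
  (\<open>det_bordered\<close>).  Either the errors are large for a positive proportion of all choices, and then a
  positive proportion of the minors of size \<open>k + 1\<close> is bounded away from 0, or the errors are small on
  average.  In the second case two different predictions that share their columns combine, by the
  symmetry of \<open>Q\<close>, into a symmetric matrix of rank at most \<open>k\<close> over the same field which is close to
  \<open>Q\<close> in the entrywise 1-norm (\<open>near_low_rank_if_two_crosses\<close>).  Iterating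
  (\<open>near_low_rank_or_large_minors\<close>), either \<open>Q\<close> is close to a symmetric matrix of rank less than \<open>r\<close>,
  which gives the form \<open>h\<close>, or a positive proportion of the \<open>r \<times> r\<close> minors of \<open>Q\<close> is bounded away from 0.
  The linear and constant terms of \<open>f\<close> are negligible because there are only \<open>n + 1\<close> of them.

  Unstructured case.  Replacing \<open>Q\<close> by the real matrix \<open>Re (\<omega> Q)\<close> for a suitable complex number \<open>\<omega>\<close>
  keeps a positive proportion of large minors, because a determinant is a polynomial of bounded degree
  in the direction \<open>\<omega>\<close> (\<open>large_real_minor\<close>).  So \<open>f\<close> may be taken real.  A greedy choice then yields
  linearly many disjoint \<open>r\<close>-sets of rows, each with linearly many disjoint \<open>r\<close>-sets of columns, such that
  all these minors are quantitatively invertible (\<open>many_nondegenerate\<close>).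

  What remains is an upper bound for the point probabilities of such an \<open>f\<close> by Fourier analysis.
  Let \<open>\<phi>(\<theta>)\<close> be the modulus of the expectation of \<open>exp(i \<theta> f(\<xi>))\<close>.  Decoupling the coordinates in the chosen
  row sets from the remaining ones bounds \<open>\<phi>(\<theta>)\<^sup>2\<close> by the expectation of a product of
  \<open>\<bar>cos(2 \<theta> V\<^sub>j)\<bar>\<close>, where the \<open>V\<^sub>j\<close> are linear forms in the remaining signs.  Convexity replaces the
  product over all rows by one \<open>r\<close>-set of rows with each factor raised to a power proportional to \<open>n\<close>.
  Such a power lives on the points where \<open>2 \<theta> V\<^sub>j\<close> is within \<open>d \<approx> sqrt(log n / n)\<close> of a multiple of \<open>\<pi>\<close>,
  where it is dominated by a Fejer kernel.  Expanding the kernels turns the expectation over the signs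
  into an average over integer vectors \<open>s\<close> of length about \<open>1 / d\<close> of products of cosines of linear forms in \<open>s\<close>.
  Convexity again isolates a single invertible \<open>r \<times> r\<close> block, and the invertibility bounds the number of
  integer vectors for which all \<open>r\<close> forms are close to multiples of \<open>\<pi>\<close> (\<open>count_small_sines\<close>).
  The outcome, with constants suppressed, is
  \<open>\<phi>(\<theta>)\<^sup>2 \<le> (\<theta> + d\<^sup>2 / \<theta>)\<^sup>r + n\<^sup>-\<^sup>2\<close> (\<open>characteristic_function_decay\<close>).

  A point probability is at most an average of \<open>\<phi>\<close> over multiples \<open>k / n\<close> with \<open>k < N\<close>
  (\<open>point_probability_le\<close>).  Inserting the decay bound gives three terms, of order \<open>1 / N\<close>,
  \<open>(log n)^(r/2) / N\<close> and \<open>(N / n)^(r/2)\<close>; the second one uses that the sum of \<open>k^(-r/2)\<close> converges for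
  \<open>r \<ge> 3\<close>.  They balance at \<open>N = n^(r/(r+2))\<close>, which is the exponent of the theorem (\<open>anticoncentration\<close>).
\<close>

section \<open>Sign vectors and decoupling\<close>

definition signs :: "nat set \<Rightarrow> (nat \<Rightarrow> real) set" where
  "signs A = A \<rightarrow>\<^sub>E {1, -1}"

text \<open>
  The value \<open>undefined\<close> outside \<open>A \<union> B\<close> makes the result extensional, as the members of \<open>signs (A \<union> B)\<close> are.
\<close>

definition merge_signs :: "nat set \<Rightarrow> nat set \<Rightarrow> (nat \<Rightarrow> real) \<Rightarrow> (nat \<Rightarrow> real) \<Rightarrow> nat \<Rightarrow> real" where
  "merge_signs A B y z = (\<lambda>i. if i \<in> A then y i else if i \<in> B then z i else undefined)"

lemma finite_signs [simp]: "finite A \<Longrightarrow> finite (signs A)"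
  unfolding signs_def by (intro finite_PiE) auto

lemma card_signs: "finite A \<Longrightarrow> card (signs A) = 2 ^ card A"
  unfolding signs_def by (simp add: card_PiE numeral_2_eq_2)

lemma sum_signs_Un:
  fixes F :: "(nat \<Rightarrow> real) \<Rightarrow> 'b::comm_monoid_add"
  assumes "A \<inter> B = {}"
  shows "(\<Sum>x\<in>signs (A \<union> B). F x) = (\<Sum>y\<in>signs A. \<Sum>z\<in>signs B. F (merge_signs A B y z))"
proof -
  have restr: "merge_signs A B (restrict x A) (restrict x B) = x" if "x \<in> signs (A \<union> B)" for x
    using that by (auto simp: merge_signs_def fun_eq_iff signs_def PiE_iff extensional_def)
  have "(\<Sum>x\<in>signs (A \<union> B). F x)
      = (\<Sum>(y, z)\<in>signs A \<times> signs B. F (merge_signs A B y z))"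
    by (rule sum.reindex_bij_witness[where j = "\<lambda>x. (restrict x A, restrict x B)"
          and i = "\<lambda>(y, z). merge_signs A B y z"])
      (use assms in \<open>auto simp: restr,
         auto simp: signs_def merge_signs_def PiE_iff extensional_def restrict_def
          fun_eq_iff split: if_splits\<close>)
  then show ?thesis by (simp add: sum.cartesian_product)
qed

lemma cis_sum: "cis (\<Sum>i\<in>A. f i) = (\<Prod>i\<in>A. cis (f i))"
  by (induction A rule: infinite_finite_induct) (auto simp: cis_mult[symmetric])

text \<open>
  The characteristic function of a linear form in independent signs factorises into cosines.
\<close>

lemma sum_signs_cis:
  assumes "finite B"
  shows "(\<Sum>z\<in>signs B. cis (\<Sum>j\<in>B. z j * c j)) = of_real (\<Prod>j\<in>B. 2 * cos (c j))"
proof -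
  have "(\<Sum>z\<in>signs B. cis (\<Sum>j\<in>B. z j * c j)) = (\<Prod>j\<in>B. \<Sum>v\<in>{1, -1}. cis (v * c j))"
    unfolding cis_sum signs_def by (rule prod_sum_PiE[symmetric]) (use assms in auto)
  also have "\<dots> = (\<Prod>j\<in>B. of_real (2 * cos (c j)))"
    by (intro prod.cong refl) (simp add: complex_eq_iff)
  finally show ?thesis by simp
qed

text \<open>
  Cauchy--Schwarz over the signs on \<open>B\<close> duplicates the signs on \<open>A\<close>.  The difference of the two copies of
  \<open>F\<close> is linear in the signs on \<open>B\<close>, so these can be averaged out exactly.  Only the square root of a
  characteristic function is lost, not the square root of a probability.
\<close>

lemma decoupling:
  fixes F :: "(nat \<Rightarrow> real) \<Rightarrow> real" and D :: "(nat \<Rightarrow> real) \<Rightarrow> (nat \<Rightarrow> real) \<Rightarrow> nat \<Rightarrow> real"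
  assumes fin: "finite A" "finite B" and disj: "A \<inter> B = {}"
    and D: "\<And>y y' z. y \<in> signs A \<Longrightarrow> y' \<in> signs A \<Longrightarrow> z \<in> signs B \<Longrightarrow>
      F (merge_signs A B y z) - F (merge_signs A B y' z) = c y y' + (\<Sum>j\<in>B. z j * D y y' j)"
  shows "(norm (\<Sum>x\<in>signs (A \<union> B). cis (\<theta> * F x)) / 2 ^ card (A \<union> B))\<^sup>2
    \<le> (\<Sum>y\<in>signs A. \<Sum>y'\<in>signs A. \<Prod>j\<in>B. \<bar>cos (\<theta> * D y y' j)\<bar>) / 4 ^ card A"
proof -
  let ?S = "\<Sum>y\<in>signs A. \<Sum>y'\<in>signs A. \<Prod>j\<in>B. 2 * \<bar>cos (\<theta> * D y y' j)\<bar>"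
  define e where "e y z = cis (\<theta> * F (merge_signs A B y z))" for y z
  have "norm (\<Sum>x\<in>signs (A \<union> B). cis (\<theta> * F x)) = norm (\<Sum>z\<in>signs B. \<Sum>y\<in>signs A. e y z)"
    unfolding sum_signs_Un[OF disj] e_def by (subst sum.swap) simp
  also have "\<dots> \<le> (\<Sum>z\<in>signs B. norm (\<Sum>y\<in>signs A. e y z))" by (rule norm_sum)
  finally have "(norm (\<Sum>x\<in>signs (A \<union> B). cis (\<theta> * F x)))\<^sup>2 \<le> (\<Sum>z\<in>signs B. norm (\<Sum>y\<in>signs A. e y z))\<^sup>2"
    by (intro power_mono) auto
  also have "\<dots> \<le> (\<Sum>z\<in>signs B. (norm (\<Sum>y\<in>signs A. e y z))\<^sup>2) * of_nat (card (signs B))"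
    by (rule sum_squared_le_sum_of_squares)
  also have "(\<Sum>z\<in>signs B. (norm (\<Sum>y\<in>signs A. e y z))\<^sup>2)
      \<le> ?S"
  proof -
    have "complex_of_real (\<Sum>z\<in>signs B. (norm (\<Sum>y\<in>signs A. e y z))\<^sup>2)
        = (\<Sum>z\<in>signs B. (\<Sum>y\<in>signs A. e y z) * cnj (\<Sum>y'\<in>signs A. e y' z))"
      by (simp only: of_real_sum complex_norm_square)
    also have "\<dots> = (\<Sum>z\<in>signs B. \<Sum>y\<in>signs A. \<Sum>y'\<in>signs A. e y z * cnj (e y' z))"
      by (simp add: sum_product)
    also have "\<dots> = (\<Sum>y\<in>signs A. \<Sum>z\<in>signs B. \<Sum>y'\<in>signs A. e y z * cnj (e y' z))"
      by (rule sum.swap)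
    also have "\<dots> = (\<Sum>y\<in>signs A. \<Sum>y'\<in>signs A. \<Sum>z\<in>signs B. e y z * cnj (e y' z))"
      by (rule sum.cong[OF refl], rule sum.swap)
    finally have *: "complex_of_real (\<Sum>z\<in>signs B. (norm (\<Sum>y\<in>signs A. e y z))\<^sup>2)
        = (\<Sum>y\<in>signs A. \<Sum>y'\<in>signs A. \<Sum>z\<in>signs B. e y z * cnj (e y' z))" .
    have "(\<Sum>z\<in>signs B. (norm (\<Sum>y\<in>signs A. e y z))\<^sup>2)
        \<le> norm (complex_of_real (\<Sum>z\<in>signs B. (norm (\<Sum>y\<in>signs A. e y z))\<^sup>2))"
      unfolding norm_of_real by (rule abs_ge_self)
    also have "\<dots> = norm (\<Sum>y\<in>signs A. \<Sum>y'\<in>signs A. \<Sum>z\<in>signs B. e y z * cnj (e y' z))"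
      unfolding * ..
    also have "\<dots> \<le> (\<Sum>y\<in>signs A. \<Sum>y'\<in>signs A. norm (\<Sum>z\<in>signs B. e y z * cnj (e y' z)))"
      by (rule order.trans[OF norm_sum], rule sum_mono, rule norm_sum)
    also have "\<dots> = ?S"
    proof (intro sum.cong refl)
      fix y y' assume y: "y \<in> signs A" "y' \<in> signs A"
      have "(\<Sum>z\<in>signs B. e y z * cnj (e y' z))
          = (\<Sum>z\<in>signs B. cis (\<theta> * c y y') * cis (\<Sum>j\<in>B. z j * (\<theta> * D y y' j)))"
      proof (intro sum.cong refl)
        fix z assume z: "z \<in> signs B"
        have "\<theta> * F (merge_signs A B y z) - \<theta> * F (merge_signs A B y' z)
            = \<theta> * (c y y' + (\<Sum>j\<in>B. z j * D y y' j))"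
          unfolding D[OF y z, symmetric] by (simp add: algebra_simps)
        also have "\<dots> = \<theta> * c y y' + (\<Sum>j\<in>B. z j * (\<theta> * D y y' j))"
          by (simp add: algebra_simps sum_distrib_left)
        finally show "e y z * cnj (e y' z)
          = cis (\<theta> * c y y') * cis (\<Sum>j\<in>B. z j * (\<theta> * D y y' j))"
          unfolding e_def cis_cnj by (simp add: cis_mult)
      qed
      also have "norm \<dots> = (\<Prod>j\<in>B. 2 * \<bar>cos (\<theta> * D y y' j)\<bar>)"
        unfolding sum_distrib_left[symmetric] sum_signs_cis[OF fin(2)] norm_mult norm_cis norm_of_real
        by (simp add: abs_prod abs_mult)
      finally show "norm (\<Sum>z\<in>signs B. e y z * cnj (e y' z))
          = (\<Prod>j\<in>B. 2 * \<bar>cos (\<theta> * D y y' j)\<bar>)" .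
    qed
    finally show ?thesis .
  qed
  also have "?S
     = 2 ^ card B * (\<Sum>y\<in>signs A. \<Sum>y'\<in>signs A. \<Prod>j\<in>B. \<bar>cos (\<theta> * D y y' j)\<bar>)"
    by (simp add: prod.distrib sum_distrib_left)
  finally have *: "(norm (\<Sum>x\<in>signs (A \<union> B). cis (\<theta> * F x)))\<^sup>2
    \<le> 2 ^ card B * (\<Sum>y\<in>signs A. \<Sum>y'\<in>signs A. \<Prod>j\<in>B. \<bar>cos (\<theta> * D y y' j)\<bar>) * 2 ^ card B"
    by (simp add: card_signs[OF fin(2)] mult_right_mono)
  have "(2::real) ^ card (A \<union> B) = 2 ^ card A * 2 ^ card B"
    using fin disj by (simp add: card_Un_disjoint power_add)
  moreover have "(4::real) ^ card A = 2 ^ card A * 2 ^ card A" by (simp add: power_mult_distrib[symmetric])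
  ultimately have "((2::real) ^ card (A \<union> B))\<^sup>2 = 4 ^ card A * (2 ^ card B * 2 ^ card B)"
    by (simp only: power2_eq_square mult_ac)
  then show ?thesis
    using * by (simp add: power_divide field_simps)
qed


section \<open>Concentrating products of cosines on few coordinates\<close>

lemma abs_cos_le_exp_sin: "\<bar>cos (u::real)\<bar> \<le> exp (- (sin u)\<^sup>2 / 2)"
proof (rule power2_le_imp_le)
  have "(cos u)\<^sup>2 = 1 - (sin u)\<^sup>2" by (simp add: cos_squared_eq)
  also have "\<dots> \<le> exp (- (sin u)\<^sup>2)" using exp_ge_add_one_self[of "- (sin u)\<^sup>2"] by simp
  also have "\<dots> = (exp (- (sin u)\<^sup>2 / 2))\<^sup>2" by (simp add: exp_double[symmetric])
  finally show "\<bar>cos u\<bar>\<^sup>2 \<le> (exp (- (sin u)\<^sup>2 / 2))\<^sup>2" by simp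
qed simp

text \<open>
  The inequality of arithmetic and geometric means, in the form in which it is used to pass from all
  coordinates to one block of coordinates at the price of averaging over the blocks.
\<close>

lemma exp_neg_sum_le_mean:
  fixes x :: "nat \<Rightarrow> real"
  assumes "G > 0"
  shows "exp (- (\<Sum>a<G. x a)) \<le> (\<Sum>a<G. exp (- (G * x a))) / G"
proof -
  have "(\<Prod>a<G. exp (- (real G * x a))) powr (1 / card {..<G})
      \<le> (\<Sum>a<G. exp (- (G * x a)) / card {..<G})"
    by (rule arith_geom_mean) (use assms in auto)
  moreover have "(\<Prod>a<G. exp (- (real G * x a))) = exp (- (G * (\<Sum>a<G. x a)))"
    by (simp add: exp_sum[symmetric] sum_negf sum_distrib_left)
  ultimately show ?thesis
    using assms by (simp add: exp_powr_real sum_divide_distrib)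
qed

lemma sin_small_imp_near_multiple_pi:
  assumes "\<bar>sin u\<bar> < d"
  obtains k :: int where "\<bar>u - pi * k\<bar> \<le> 2 * d"
proof -
  define k where "k = round (u / pi)"
  define v where "v = u - pi * k"
  have "\<bar>of_int k - u / pi\<bar> \<le> 1/2" unfolding k_def by (rule of_int_round_abs_le)
  moreover have "\<bar>v\<bar> = pi * \<bar>of_int k - u / pi\<bar>"
  proof -
    have "v = - (pi * (of_int k - u / pi))" unfolding v_def by (simp add: field_simps)
    then show ?thesis by (simp add: abs_mult)
  qed
  ultimately have v: "\<bar>v\<bar> \<le> pi / 2" by simp
  \<comment> \<open>Shifting by a multiple of \<open>\<pi>\<close> changes the sine at most by a sign.\<close>
  have "\<bar>sin u\<bar> = \<bar>sin v\<bar>"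
  proof -
    have "sin v = sin u * cos (pi * k)" by (simp add: v_def sin_diff)
    moreover have "\<bar>cos (pi * k)\<bar> = 1"
      using sin_cos_squared_add[of "pi * k"] by (simp add: power2_eq_1_iff)
    ultimately show ?thesis by (simp add: abs_mult)
  qed
  also have "\<bar>sin v\<bar> = sin \<bar>v\<bar>"
    using v sin_ge_zero[of "\<bar>v\<bar>"] by (cases "v \<ge> 0") auto
  also have "sin \<bar>v\<bar> \<ge> \<bar>v\<bar> / 2"
  proof -
    let ?w = "\<bar>v\<bar>"
    \<comment> \<open>On \<open>[0, \<pi>/2]\<close> the sine is at least half its argument, by its cubic Taylor bound.\<close>
    have "?w \<le> 1.6" using v pi_approx by simp
    have "\<bar>sin ?w - (\<Sum>m<3. sin_coeff m * ?w ^ m)\<bar> \<le> inverse (fact 3) * \<bar>?w\<bar> ^ 3"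
      by (rule Maclaurin_sin_bound)
    then have "\<bar>sin ?w - ?w\<bar> \<le> ?w ^ 3 / 6"
      by (simp add: eval_nat_numeral sin_coeff_def lessThan_Suc)
    moreover have "?w ^ 3 \<le> ?w * 3"
    proof -
      have "?w * (?w * ?w) \<le> ?w * (1.6 * 1.6)"
        using \<open>?w \<le> 1.6\<close> by (intro mult_mono) auto
      then show ?thesis by (simp add: power3_eq_cube)
    qed
    moreover have "?w - sin ?w \<le> \<bar>sin ?w - ?w\<bar>" by linarith
    ultimately show ?thesis by linarith
  qed
  finally have "\<bar>v\<bar> \<le> 2 * d" using assms by simp
  then show ?thesis using that v_def by blast
qed

text \<open>
  Near a multiple of \<open>\<pi>\<close> all \<open>W\<close> summands of the exponential sum point in nearly the same direction:
  each has real part at least 1/2.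
\<close>

lemma fejer_lower_bound:
  assumes "4 * real W * d \<le> 1" and "\<bar>sin u\<bar> < d"
  shows "(real W)\<^sup>2 \<le> 4 * (norm (\<Sum>s<W. cis (2 * real s * u)))\<^sup>2"
proof -
  obtain k :: int where k: "\<bar>u - pi * k\<bar> \<le> 2 * d"
    using sin_small_imp_near_multiple_pi[OF assms(2)] by blast
  have "real W / 2 = (\<Sum>s<W. 1/2)" by simp
  also have "\<dots> \<le> (\<Sum>s<W. cos (2 * real s * u))"
  proof (intro sum_mono)
    fix s assume s: "s \<in> {..<W}"
    let ?v = "u - pi * k"
    have "2 * real s * u = 2 * real s * ?v + 2 * pi * of_int (int s * k)"
      by (simp add: algebra_simps)
    then have "cos (2 * real s * u) = cos (2 * real s * ?v)"
      by (metis cos_int_2pin cos_add mult.right_neutral sin_int_2pin mult_zero_right diff_zero)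
    also have "\<dots> = cos \<bar>2 * real s * ?v\<bar>" by simp
    also have "\<bar>2 * real s * ?v\<bar> \<le> pi / 3"
    proof -
      have "\<bar>2 * real s * ?v\<bar> = 2 * real s * \<bar>?v\<bar>" by (simp add: abs_mult)
      also have "\<dots> \<le> 2 * real W * (2 * d)"
        using s k by (intro mult_mono) auto
      finally show ?thesis using assms(1) pi_gt3 by simp
    qed
    then have "cos \<bar>2 * real s * ?v\<bar> \<ge> cos (pi / 3)"
      by (intro cos_monotone_0_pi_le) (use pi_gt_zero in \<open>auto intro: order.trans\<close>)
    finally show "1/2 \<le> cos (2 * real s * u)" by (simp add: cos_60)
  qed
  also have "\<dots> = Re (\<Sum>s<W. cis (2 * real s * u))" by simp
  also have "\<dots> \<le> norm (\<Sum>s<W. cis (2 * real s * u))" by (rule complex_Re_le_cmod)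
  finally have "(real W / 2)\<^sup>2 \<le> (norm (\<Sum>s<W. cis (2 * real s * u)))\<^sup>2"
    by (intro power_mono) auto
  then show ?thesis by (simp add: power_divide)
qed


text \<open>
  A high power of a product of cosines is negligible unless all sines are below the threshold \<open>d\<close>, and
  there it is dominated by the product of Fejer kernels of order \<open>W\<close>.  The kernels are what makes
  the expectation over the signs computable.
\<close>

lemma exp_sin_le_fejer:
  assumes "finite g" "W > 0" "4 * real W * d \<le> 1" "d > 0"
  shows "exp (- (real G * (\<Sum>j\<in>g. (sin (u j))\<^sup>2 / 2)))
    \<le> 4 ^ card g * (\<Prod>j\<in>g. (norm (\<Sum>s<W. cis (2 * real s * u j)))\<^sup>2) / real W ^ (2 * card g)
      + exp (- (real G * d\<^sup>2 / 2))"
proof (cases "\<forall>j\<in>g. \<bar>sin (u j)\<bar> < d")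
  case True
  have "real W ^ (2 * card g) = (\<Prod>j\<in>g. (real W)\<^sup>2)" by (simp add: power_mult)
  also have "\<dots> \<le> (\<Prod>j\<in>g. 4 * (norm (\<Sum>s<W. cis (2 * real s * u j)))\<^sup>2)"
    using True by (intro prod_mono conjI fejer_lower_bound[OF assms(3)]) auto
  also have "\<dots> = 4 ^ card g * (\<Prod>j\<in>g. (norm (\<Sum>s<W. cis (2 * real s * u j)))\<^sup>2)"
    by (simp add: prod.distrib)
  finally have "1 \<le> 4 ^ card g * (\<Prod>j\<in>g. (norm (\<Sum>s<W. cis (2 * real s * u j)))\<^sup>2) / real W ^ (2 * card g)"
    using \<open>W > 0\<close> by simp
  moreover have "exp (- (real G * (\<Sum>j\<in>g. (sin (u j))\<^sup>2 / 2))) \<le> 1"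
    by (simp add: sum_nonneg)
  ultimately show ?thesis using exp_gt_zero[of "- (real G * d\<^sup>2 / 2)"] by linarith
next
  case False
  then obtain j where j: "j \<in> g" "d \<le> \<bar>sin (u j)\<bar>" by force
  have "d\<^sup>2 \<le> \<bar>sin (u j)\<bar>\<^sup>2" using j \<open>d > 0\<close> by (intro power_mono) auto
  then have "d\<^sup>2 / 2 \<le> (sin (u j))\<^sup>2 / 2" by simp
  also have "\<dots> \<le> (\<Sum>j\<in>g. (sin (u j))\<^sup>2 / 2)"
    by (rule member_le_sum) (use j assms in auto)
  finally have "real G * (d\<^sup>2 / 2) \<le> real G * (\<Sum>j\<in>g. (sin (u j))\<^sup>2 / 2)"
    by (rule mult_left_mono) simp
  then have "exp (- (real G * (\<Sum>j\<in>g. (sin (u j))\<^sup>2 / 2))) \<le> exp (- (real G * d\<^sup>2 / 2))" by simp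
  moreover have "0 \<le> 4 ^ card g * (\<Prod>j\<in>g. (norm (\<Sum>s<W. cis (2 * real s * u j)))\<^sup>2) / real W ^ (2 * card g)"
    by (intro divide_nonneg_nonneg mult_nonneg_nonneg prod_nonneg) auto
  ultimately show ?thesis by linarith
qed

text \<open>
  Each squared exponential sum is a sum over pairs \<open>(s, s')\<close> with frequency \<open>s - s'\<close>.  After
  expanding the product over \<open>g\<close>, a function \<open>\<sigma>\<close> selects one pair for each \<open>j \<in> g\<close>, and the sums over
  \<open>y\<close> and \<open>y'\<close> factorise.  The roles of signs and frequencies are thereby exchanged: the right-hand side
  involves the matrix \<open>R\<close> applied to the integer vector \<open>s - s'\<close>.
\<close>

lemma sum_fejer_eq:
  fixes R :: "nat \<Rightarrow> nat \<Rightarrow> real" and \<theta> :: real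
  assumes fin: "finite A" "finite g"
  defines "c \<equiv> \<lambda>\<sigma> i. 4 * \<theta> * (\<Sum>j\<in>g. (real (fst (\<sigma> j)) - real (snd (\<sigma> j))) * R i j)"
  shows "(\<Sum>y\<in>signs A. \<Sum>y'\<in>signs A.
      \<Prod>j\<in>g. (norm (\<Sum>s<W. cis (2 * real s * (\<theta> * (2 * (\<Sum>i\<in>A. R i j * (y i - y' i)))))))\<^sup>2)
    = 4 ^ card A * (\<Sum>\<sigma>\<in>g \<rightarrow>\<^sub>E ({..<W} \<times> {..<W}). \<Prod>i\<in>A. (cos (c \<sigma> i))\<^sup>2)" (is "?L = ?R")
proof -
  let ?e = "\<lambda>y y' \<sigma>. cis (\<Sum>i\<in>A. y i * c \<sigma> i) * cis (\<Sum>i\<in>A. y' i * (- c \<sigma> i))"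
  let ?P = "g \<rightarrow>\<^sub>E ({..<W} \<times> {..<W})"
  define u where "u y y' j = \<theta> * (2 * (\<Sum>i\<in>A. R i j * (y i - y' i)))" for y y' :: "nat \<Rightarrow> real" and j
  have expand: "complex_of_real (\<Prod>j\<in>g. (norm (\<Sum>s<W. cis (2 * real s * u y y' j)))\<^sup>2)
      = (\<Sum>\<sigma>\<in>?P. ?e y y' \<sigma>)"
    for y y'
  proof -
    have "complex_of_real (\<Prod>j\<in>g. (norm (\<Sum>s<W. cis (2 * real s * u y y' j)))\<^sup>2)
        = (\<Prod>j\<in>g. \<Sum>p\<in>{..<W} \<times> {..<W}. cis (2 * (real (fst p) - real (snd p)) * u y y' j))"
      unfolding of_real_prod complex_norm_square
    proof (intro prod.cong refl)
      fix j
      have "(\<Sum>s<W. cis (2 * real s * u y y' j)) * cnj (\<Sum>s<W. cis (2 * real s * u y y' j))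
          = (\<Sum>s<W. \<Sum>s'<W. cis (2 * real s * u y y' j) * cis (- (2 * real s' * u y y' j)))"
        by (simp only: cnj_sum cis_cnj sum_product)
      also have "\<dots> = (\<Sum>s<W. \<Sum>s'<W. cis (2 * (real s - real s') * u y y' j))"
        by (intro sum.cong refl) (simp only: cis_mult, simp add: algebra_simps)
      also have "\<dots> = (\<Sum>p\<in>{..<W} \<times> {..<W}. cis (2 * (real (fst p) - real (snd p)) * u y y' j))"
        by (simp add: sum.cartesian_product case_prod_unfold)
      finally show "(\<Sum>s<W. cis (2 * real s * u y y' j)) * cnj (\<Sum>s<W. cis (2 * real s * u y y' j)) = \<dots>" .
    qed
    also have "\<dots> = (\<Sum>\<sigma>\<in>?P. \<Prod>j\<in>g. cis (2 * (real (fst (\<sigma> j)) - real (snd (\<sigma> j))) * u y y' j))"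
      by (rule prod_sum_PiE) (use fin in auto)
    also have "\<dots> = (\<Sum>\<sigma>\<in>?P. ?e y y' \<sigma>)"
    proof (intro sum.cong refl)
      fix \<sigma>
      have "(\<Sum>j\<in>g. 2 * (real (fst (\<sigma> j)) - real (snd (\<sigma> j))) * u y y' j)
          = (\<Sum>j\<in>g. \<Sum>i\<in>A. (y i - y' i) * (4 * \<theta> * ((real (fst (\<sigma> j)) - real (snd (\<sigma> j))) * R i j)))"
        unfolding u_def sum_distrib_left
        by (intro sum.cong refl) (simp only: mult_ac numeral_times_numeral)
      also have "\<dots> = (\<Sum>i\<in>A. (y i - y' i) * c \<sigma> i)"
        unfolding c_def by (subst sum.swap) (simp add: sum_distrib_left)
      also have "\<dots> = (\<Sum>i\<in>A. y i * c \<sigma> i) + (\<Sum>i\<in>A. y' i * (- c \<sigma> i))"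
        by (simp add: left_diff_distrib sum_subtractf sum_negf)
      finally show "(\<Prod>j\<in>g. cis (2 * (real (fst (\<sigma> j)) - real (snd (\<sigma> j))) * u y y' j))
          = ?e y y' \<sigma>"
        unfolding cis_sum[symmetric] cis_mult by simp
    qed
    finally show ?thesis .
  qed
  have "complex_of_real ?L = (\<Sum>y\<in>signs A. \<Sum>y'\<in>signs A. \<Sum>\<sigma>\<in>?P.
      ?e y y' \<sigma>)"
    unfolding of_real_sum expand[symmetric] u_def ..
  also have "\<dots> = (\<Sum>y\<in>signs A. \<Sum>\<sigma>\<in>?P. \<Sum>y'\<in>signs A.
      ?e y y' \<sigma>)"
    by (rule sum.cong[OF refl], rule sum.swap)
  also have "\<dots> = (\<Sum>\<sigma>\<in>?P. \<Sum>y\<in>signs A. \<Sum>y'\<in>signs A.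
      ?e y y' \<sigma>)"
    by (rule sum.swap)
  also have "\<dots> = (\<Sum>\<sigma>\<in>?P. complex_of_real (\<Prod>i\<in>A. 4 * (cos (c \<sigma> i))\<^sup>2))"
  proof (intro sum.cong refl)
    fix \<sigma>
    have "(\<Sum>y\<in>signs A. \<Sum>y'\<in>signs A.
        ?e y y' \<sigma>)
      = complex_of_real (\<Prod>i\<in>A. 2 * cos (c \<sigma> i)) * complex_of_real (\<Prod>i\<in>A. 2 * cos (- c \<sigma> i))"
      unfolding sum_product[symmetric] sum_signs_cis[OF fin(1)] ..
    also have "\<dots> = complex_of_real (\<Prod>i\<in>A. (2 * cos (c \<sigma> i)) * (2 * cos (- c \<sigma> i)))"
      by (simp only: prod.distrib of_real_mult)
    also have "(\<Prod>i\<in>A. (2 * cos (c \<sigma> i)) * (2 * cos (- c \<sigma> i))) = (\<Prod>i\<in>A. 4 * (cos (c \<sigma> i))\<^sup>2)"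
      by (intro prod.cong refl) (simp add: power2_eq_square)
    finally show "(\<Sum>y\<in>signs A. \<Sum>y'\<in>signs A.
        ?e y y' \<sigma>)
      = complex_of_real (\<Prod>i\<in>A. 4 * (cos (c \<sigma> i))\<^sup>2)" .
  qed
  also have "\<dots> = complex_of_real ?R"
    by (simp add: prod.distrib sum_distrib_left)
  finally show ?thesis by (simp only: of_real_eq_iff)
qed


section \<open>Counting integer vectors with small sines\<close>

text \<open>
  A quantitative form of invertibility of the block of \<open>R\<close> with rows \<open>h\<close> and columns \<open>g\<close>.  For the
  difference \<open>s\<close> of two integer vectors the conclusion says \<open>s = 0\<close> on \<open>g\<close>, so different integer
  vectors have images at distance at least \<open>\<eta>\<close> in some coordinate.
\<close>

definition nondegenerate :: "real \<Rightarrow> (nat \<Rightarrow> nat \<Rightarrow> real) \<Rightarrow> nat set \<Rightarrow> nat set \<Rightarrow> bool" where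
  "nondegenerate \<eta> R g h \<longleftrightarrow>
    (\<forall>s::nat \<Rightarrow> real. (\<forall>i\<in>h. \<bar>\<Sum>j\<in>g. s j * R i j\<bar> < \<eta>) \<longrightarrow> (\<forall>j\<in>g. \<bar>s j\<bar> < 1))"

lemma card_abs_int_le:
  assumes "x \<ge> 0"
  shows "finite {k::int. \<bar>real_of_int k\<bar> \<le> x}" "real (card {k::int. \<bar>real_of_int k\<bar> \<le> x}) \<le> 2 * x + 1"
proof -
  have eq: "{k::int. \<bar>real_of_int k\<bar> \<le> x} = {- \<lfloor>x\<rfloor>..\<lfloor>x\<rfloor>}"
  unfolding set_eq_iff proof (rule allI)
    fix k :: int
    have "k \<le> \<lfloor>x\<rfloor> \<longleftrightarrow> of_int k \<le> x" "- k \<le> \<lfloor>x\<rfloor> \<longleftrightarrow> - of_int k \<le> x"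
      using le_floor_iff[of k x] le_floor_iff[of "- k" x] by simp_all
    then show "k \<in> {k. \<bar>real_of_int k\<bar> \<le> x} \<longleftrightarrow> k \<in> {- \<lfloor>x\<rfloor>..\<lfloor>x\<rfloor>}" by (auto simp: abs_le_iff)
  qed
  show "finite {k::int. \<bar>real_of_int k\<bar> \<le> x}" unfolding eq by simp
  have "\<lfloor>x\<rfloor> \<ge> 0" using assms by simp
  then have "real (card {- \<lfloor>x\<rfloor>..\<lfloor>x\<rfloor>}) = 2 * of_int \<lfloor>x\<rfloor> + 1" by simp
  also have "\<dots> \<le> 2 * x + 1" by simp
  finally show "real (card {k::int. \<bar>real_of_int k\<bar> \<le> x}) \<le> 2 * x + 1" unfolding eq .
qed

text \<open>
  If \<open>4 \<theta> t\<close> is close to the multiple \<open>\<pi> k\<close>, record \<open>k\<close> and the cell of side \<open>\<eta>\<close> that contains the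
  deviation of \<open>t\<close> from \<open>\<pi> k / (4 \<theta>)\<close>.  By nondegeneracy these data for the \<open>r\<close> coordinates in \<open>h\<close>,
  together with the second components of \<open>\<sigma>\<close>, determine \<open>\<sigma>\<close>.  The three factors of the bound
  count, for one coordinate, the second components, the possible \<open>k\<close> and the cells.
\<close>

lemma count_small_sines:
 fixes R :: "nat \<Rightarrow> nat \<Rightarrow> real" and r W :: nat and \<theta> \<eta> K d :: real
  assumes fin: "finite g" "finite h" and card: "card g = r" "card h = r"
    and R: "\<And>i j. i \<in> h \<Longrightarrow> j \<in> g \<Longrightarrow> \<bar>R i j\<bar> \<le> K"
    and nd: "nondegenerate \<eta> R g h" and pos: "\<eta> > 0" "\<theta> > 0" "K \<ge> 0" and d: "0 < d" "d \<le> 1/8"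
  defines "t \<equiv> \<lambda>\<sigma> i. \<Sum>j\<in>g. (real (fst (\<sigma> j)) - real (snd (\<sigma> j))) * R i j"
  shows "real (card {\<sigma> \<in> g \<rightarrow>\<^sub>E ({..<W} \<times> {..<W}). \<forall>i\<in>h. \<bar>sin (4 * \<theta> * t \<sigma> i)\<bar> < d})
    \<le> (W * ((4 * \<theta> * r * K * W + 3) * (d / (\<theta> * \<eta>) + 3))) ^ r" (is "real (card ?S) \<le> _")
proof -
  define kk where "kk \<sigma> i = (SOME k::int. \<bar>4 * \<theta> * t \<sigma> i - pi * k\<bar> \<le> 2 * d)" for \<sigma> i
  define mm where "mm \<sigma> i = \<lfloor>(t \<sigma> i - pi * kk \<sigma> i / (4 * \<theta>)) / \<eta>\<rfloor>" for \<sigma> i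
  define KK where "KK = {k::int. \<bar>real_of_int k\<bar> \<le> 2 * \<theta> * r * K * W + 1}"
  define MM where "MM = {m::int. \<bar>real_of_int m\<bar> \<le> d / (2 * \<theta> * \<eta>) + 1}"
  define \<Phi> where "\<Phi> \<sigma> = (restrict (\<lambda>j. snd (\<sigma> j)) g, restrict (\<lambda>i. (kk \<sigma> i, mm \<sigma> i)) h)"
    for \<sigma> :: "nat \<Rightarrow> nat \<times> nat"
  have kk: "\<bar>4 * \<theta> * t \<sigma> i - pi * kk \<sigma> i\<bar> \<le> 2 * d" if "\<sigma> \<in> ?S" "i \<in> h" for \<sigma> i
  proof -
    have "\<bar>sin (4 * \<theta> * t \<sigma> i)\<bar> < d" using that by auto
    then obtain k :: int where "\<bar>4 * \<theta> * t \<sigma> i - pi * k\<bar> \<le> 2 * d"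
      by (rule sin_small_imp_near_multiple_pi)
    then show ?thesis unfolding kk_def by (rule someI)
  qed
  have kkK: "kk \<sigma> i \<in> KK" if "\<sigma> \<in> ?S" "i \<in> h" for \<sigma> i
  proof -
    have "\<bar>t \<sigma> i\<bar> \<le> (\<Sum>j\<in>g. real W * K)"
      unfolding t_def
    proof (rule sum_abs[THEN order.trans], rule sum_mono)
      fix j assume j: "j \<in> g"
      with that have "fst (\<sigma> j) < W" "snd (\<sigma> j) < W" by (auto simp: PiE_iff mem_Times_iff)
      then have "\<bar>real (fst (\<sigma> j)) - real (snd (\<sigma> j))\<bar> \<le> real W" by linarith
      then show "\<bar>(real (fst (\<sigma> j)) - real (snd (\<sigma> j))) * R i j\<bar> \<le> real W * K"
        unfolding abs_mult using R[OF that(2) j] by (intro mult_mono) auto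
    qed
    then have t: "\<bar>t \<sigma> i\<bar> \<le> r * W * K" by (simp add: card)
    have "\<bar>4 * \<theta> * t \<sigma> i\<bar> \<le> 4 * \<theta> * (r * W * K)"
      using t pos by (simp add: abs_mult)
    then have "\<bar>pi * kk \<sigma> i\<bar> \<le> 4 * \<theta> * (r * W * K) + 1"
      using kk[OF that] d by linarith
    moreover have "2 * \<bar>real_of_int (kk \<sigma> i)\<bar> \<le> \<bar>pi * kk \<sigma> i\<bar>"
      unfolding abs_mult using pi_gt3 by (intro mult_right_mono) auto
    ultimately have "\<bar>real_of_int (kk \<sigma> i)\<bar> \<le> 2 * (\<theta> * (r * W * K)) + 1" by linarith
    then show ?thesis unfolding KK_def by (simp add: mult_ac)
  qed
  have mmM: "mm \<sigma> i \<in> MM" if "\<sigma> \<in> ?S" "i \<in> h" for \<sigma> i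
  proof -
    let ?x = "(t \<sigma> i - pi * kk \<sigma> i / (4 * \<theta>)) / \<eta>"
    have "?x = (4 * \<theta> * t \<sigma> i - pi * kk \<sigma> i) / (4 * \<theta> * \<eta>)" using pos by (simp add: field_simps)
    then have "\<bar>?x\<bar> = \<bar>4 * \<theta> * t \<sigma> i - pi * kk \<sigma> i\<bar> / (4 * \<theta> * \<eta>)" using pos by simp
    also have "\<dots> \<le> 2 * d / (4 * \<theta> * \<eta>)"
      using kk[OF that] pos by (intro divide_right_mono) auto
    also have "\<dots> = d / (2 * \<theta> * \<eta>)" by simp
    finally have x: "\<bar>?x\<bar> \<le> d / (2 * \<theta> * \<eta>)" .
    have "\<bar>real_of_int (mm \<sigma> i)\<bar> \<le> \<bar>?x\<bar> + 1" unfolding mm_def by linarith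
    then show ?thesis unfolding MM_def using x by simp
  qed
  have "inj_on \<Phi> ?S"
  proof (rule inj_onI)
    fix \<sigma> \<sigma>' assume S: "\<sigma> \<in> ?S" "\<sigma>' \<in> ?S" and eq: "\<Phi> \<sigma> = \<Phi> \<sigma>'"
    have snd: "snd (\<sigma> j) = snd (\<sigma>' j)" if "j \<in> g" for j
      using eq that by (auto simp: \<Phi>_def restrict_def fun_eq_iff split: if_splits)
    have km: "kk \<sigma> i = kk \<sigma>' i" "mm \<sigma> i = mm \<sigma>' i" if "i \<in> h" for i
      using eq that by (auto simp: \<Phi>_def restrict_def fun_eq_iff split: if_splits)
    define s where "s j = real (fst (\<sigma> j)) - real (fst (\<sigma>' j))" for j
    have "\<bar>\<Sum>j\<in>g. s j * R i j\<bar> < \<eta>" if "i \<in> h" for i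
    proof -
      have "(\<Sum>j\<in>g. s j * R i j) = t \<sigma> i - t \<sigma>' i"
        unfolding t_def s_def sum_subtractf[symmetric]
        by (intro sum.cong refl) (simp add: snd algebra_simps)
      also have "\<dots> = \<eta> * ((t \<sigma> i - pi * kk \<sigma> i / (4 * \<theta>)) / \<eta> - (t \<sigma>' i - pi * kk \<sigma>' i / (4 * \<theta>)) / \<eta>)"
        using pos km(1)[OF that] by (simp add: field_simps)
      finally have "\<bar>\<Sum>j\<in>g. s j * R i j\<bar>
        = \<eta> * \<bar>(t \<sigma> i - pi * kk \<sigma> i / (4 * \<theta>)) / \<eta> - (t \<sigma>' i - pi * kk \<sigma>' i / (4 * \<theta>)) / \<eta>\<bar>"
        using pos by (simp add: abs_mult)
      also have "\<bar>(t \<sigma> i - pi * kk \<sigma> i / (4 * \<theta>)) / \<eta> - (t \<sigma>' i - pi * kk \<sigma>' i / (4 * \<theta>)) / \<eta>\<bar> < 1"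
        using km(2)[OF that] unfolding mm_def by linarith
      finally show ?thesis using pos by simp
    qed
    then have "\<forall>j\<in>g. \<bar>s j\<bar> < 1" using nd unfolding nondegenerate_def by blast
    then have fst: "fst (\<sigma> j) = fst (\<sigma>' j)" if "j \<in> g" for j
      using that unfolding s_def by force
    show "\<sigma> = \<sigma>'"
    proof (rule PiE_ext)
      show "\<sigma> \<in> g \<rightarrow>\<^sub>E ({..<W} \<times> {..<W})" "\<sigma>' \<in> g \<rightarrow>\<^sub>E ({..<W} \<times> {..<W})" using S by auto
    qed (use fst snd in \<open>auto intro: prod_eqI\<close>)
  qed
  moreover have "\<Phi> ` ?S \<subseteq> (g \<rightarrow>\<^sub>E {..<W}) \<times> (h \<rightarrow>\<^sub>E (KK \<times> MM))"
    using kkK mmM unfolding \<Phi>_def by (auto simp: PiE_iff mem_Times_iff)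
  moreover have K0: "0 \<le> 2 * \<theta> * r * K * W + 1" and M0: "0 \<le> d / (2 * \<theta> * \<eta>) + 1"
    using pos d by (auto intro!: add_nonneg_nonneg mult_nonneg_nonneg divide_nonneg_nonneg)
  have finKM: "finite KK" "finite MM"
    unfolding KK_def MM_def using card_abs_int_le(1)[OF K0] card_abs_int_le(1)[OF M0] by auto
  ultimately have "card ?S \<le> card ((g \<rightarrow>\<^sub>E {..<W}) \<times> (h \<rightarrow>\<^sub>E (KK \<times> MM)))"
    using fin finKM by (intro card_inj_on_le) (auto intro!: finite_PiE)
  also have "\<dots> = W ^ r * (card KK * card MM) ^ r"
    using fin by (simp add: card_cartesian_product card_PiE card)
  finally have "real (card ?S) \<le> real (W ^ r * (card KK * card MM) ^ r)"
    by (simp only: of_nat_le_iff)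
  then have "real (card ?S) \<le> real W ^ r * (real (card KK) * real (card MM)) ^ r"
    by (simp only: of_nat_mult of_nat_power)
  also have "\<dots> \<le> real W ^ r * ((4 * \<theta> * r * K * W + 3) * (d / (\<theta> * \<eta>) + 3)) ^ r"
  proof (intro mult_left_mono power_mono mult_mono)
    show "real (card KK) \<le> 4 * \<theta> * r * K * W + 3"
      using card_abs_int_le(2)[OF K0] unfolding KK_def by simp
    show "real (card MM) \<le> d / (\<theta> * \<eta>) + 3"
      using card_abs_int_le(2)[OF M0] unfolding MM_def by simp
  qed (use pos in auto)
  finally show ?thesis by (simp add: power_mult_distrib)
qed

lemma sum_disjoint_le:
  fixes f :: "nat \<Rightarrow> real" and G :: nat
  assumes "finite A" "disjoint_family_on h {..<G}" "\<And>b. b < G \<Longrightarrow> h b \<subseteq> A" "\<And>i. f i \<ge> 0"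
  shows "(\<Sum>b<G. \<Sum>i\<in>h b. f i) \<le> (\<Sum>i\<in>A. f i)"
proof -
  have finh: "finite (h b)" if "b < G" for b using assms(3)[OF that] assms(1) by (rule finite_subset)
  have "(\<Sum>b<G. \<Sum>i\<in>h b. f i) = (\<Sum>i\<in>(\<Union>b<G. h b). f i)"
    by (rule sum.UNION_disjoint[symmetric])
      (use assms finh in \<open>auto simp: disjoint_family_on_def\<close>)
  also have "\<dots> \<le> (\<Sum>i\<in>A. f i)"
    by (rule sum_mono2) (use assms in auto)
  finally show ?thesis .
qed

text \<open>
  Convexity over the disjoint blocks \<open>h b\<close> reduces the product over all of \<open>A\<close> to a single block with
  exponent \<open>G\<close>.  There a frequency either has all sines below \<open>d\<close>, and such frequencies are counted, or it
  contributes at most \<open>exp (- G d\<^sup>2)\<close>.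
\<close>

lemma sum_prod_cos_le:
  fixes R :: "nat \<Rightarrow> nat \<Rightarrow> real" and r W G :: nat and \<theta> \<eta> K d :: real
  assumes fin: "finite A" "finite g" and card: "card g = r" and G: "G > 0"
    and h: "\<And>b. b < G \<Longrightarrow> h b \<subseteq> A" "\<And>b. b < G \<Longrightarrow> card (h b) = r" "disjoint_family_on h {..<G}"
    and R: "\<And>i j. i \<in> A \<Longrightarrow> j \<in> g \<Longrightarrow> \<bar>R i j\<bar> \<le> K"
    and nd: "\<And>b. b < G \<Longrightarrow> nondegenerate \<eta> R g (h b)"
    and pos: "\<eta> > 0" "\<theta> > 0" "K \<ge> 0" and d: "0 < d" "d \<le> 1/8"
  defines "t \<equiv> \<lambda>\<sigma> i. \<Sum>j\<in>g. (real (fst (\<sigma> j)) - real (snd (\<sigma> j))) * R i j"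
  shows "(\<Sum>\<sigma>\<in>g \<rightarrow>\<^sub>E ({..<W} \<times> {..<W}). \<Prod>i\<in>A. (cos (4 * \<theta> * t \<sigma> i))\<^sup>2)
    \<le> (W * ((4 * \<theta> * r * K * W + 3) * (d / (\<theta> * \<eta>) + 3))) ^ r + real W ^ (2 * r) * exp (- (G * d\<^sup>2))"
proof -
  let ?P = "g \<rightarrow>\<^sub>E ({..<W} \<times> {..<W})"
  let ?bad = "\<lambda>b \<sigma>. \<forall>i\<in>h b. \<bar>sin (4 * \<theta> * t \<sigma> i)\<bar> < d"
  let ?X = "(W * ((4 * \<theta> * r * K * W + 3) * (d / (\<theta> * \<eta>) + 3))) ^ r"
  have finP: "finite ?P" using fin by (intro finite_PiE) auto
  have finh: "finite (h b)" if "b < G" for b using h(1)[OF that] fin finite_subset by blast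
  have cardP: "card ?P = W ^ (2 * r)"
    using fin by (simp add: card_PiE card_cartesian_product card power_mult_distrib power_mult[symmetric] power_add mult_2)
  have "(\<Prod>i\<in>A. (cos (4 * \<theta> * t \<sigma> i))\<^sup>2) \<le> (\<Sum>b<G. (if ?bad b \<sigma> then 1 else 0) + exp (- (G * d\<^sup>2))) / G"
    for \<sigma>
  proof -
    define S where "S i = (sin (4 * \<theta> * t \<sigma> i))\<^sup>2" for i
    have "(\<Prod>i\<in>A. (cos (4 * \<theta> * t \<sigma> i))\<^sup>2) \<le> (\<Prod>i\<in>A. exp (- S i))"
    proof (intro prod_mono conjI)
      fix i
      have "(cos (4 * \<theta> * t \<sigma> i))\<^sup>2 = 1 - S i" by (simp add: S_def cos_squared_eq)
      then show "(cos (4 * \<theta> * t \<sigma> i))\<^sup>2 \<le> exp (- S i)"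
        using exp_ge_add_one_self[of "- S i"] by simp
    qed auto
    also have "\<dots> = exp (- (\<Sum>i\<in>A. S i))" using fin by (simp add: exp_sum[symmetric] sum_negf)
    also have "\<dots> \<le> exp (- (\<Sum>b<G. \<Sum>i\<in>h b. S i))"
      using sum_disjoint_le[OF fin(1) h(3) h(1), of S] by (simp add: S_def)
    also have "\<dots> \<le> (\<Sum>b<G. exp (- (G * (\<Sum>i\<in>h b. S i)))) / G"
      by (rule exp_neg_sum_le_mean[OF G])
    also have "\<dots> \<le> (\<Sum>b<G. (if ?bad b \<sigma> then 1 else 0) + exp (- (G * d\<^sup>2))) / G"
    proof (intro divide_right_mono sum_mono)
      fix b assume b: "b \<in> {..<G}"
      show "exp (- (G * (\<Sum>i\<in>h b. S i))) \<le> (if ?bad b \<sigma> then 1 else 0) + exp (- (G * d\<^sup>2))"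
      proof (cases "?bad b \<sigma>")
        case True
        have "0 \<le> G * (\<Sum>i\<in>h b. S i)" by (simp add: sum_nonneg S_def)
        then have "exp (- (G * (\<Sum>i\<in>h b. S i))) \<le> 1" by simp
        then show ?thesis using True by (simp add: add_increasing2)
      next
        case False
        then obtain i where i: "i \<in> h b" "d \<le> \<bar>sin (4 * \<theta> * t \<sigma> i)\<bar>" by force
        have "d\<^sup>2 \<le> S i" unfolding S_def using power_mono[OF i(2), of 2] d by simp
        also have "S i \<le> (\<Sum>i\<in>h b. S i)"
          using i b finh by (intro member_le_sum) (auto simp: S_def)
        finally have "G * d\<^sup>2 \<le> G * (\<Sum>i\<in>h b. S i)" by (intro mult_left_mono) auto
        then show ?thesis unfolding if_not_P[OF False] by simp
      qed
    qed simp
    finally show ?thesis .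
  qed
  then have "(\<Sum>\<sigma>\<in>?P. \<Prod>i\<in>A. (cos (4 * \<theta> * t \<sigma> i))\<^sup>2)
      \<le> (\<Sum>\<sigma>\<in>?P. (\<Sum>b<G. (if ?bad b \<sigma> then 1 else 0) + exp (- (G * d\<^sup>2))) / G)"
    by (intro sum_mono)
  also have "\<dots> = (\<Sum>b<G. \<Sum>\<sigma>\<in>?P. (if ?bad b \<sigma> then 1 else 0) + exp (- (G * d\<^sup>2))) / G"
    by (subst sum_divide_distrib[symmetric], subst sum.swap) (rule refl)
  also have "\<dots> \<le> (\<Sum>b<G. ?X + real W ^ (2 * r) * exp (- (G * d\<^sup>2))) / G"
  proof (intro divide_right_mono sum_mono)
    fix b assume "b \<in> {..<G}"
    then have b: "b < G" by simp
    have "(\<Sum>\<sigma>\<in>?P. (if ?bad b \<sigma> then 1 else 0) + exp (- (G * d\<^sup>2)))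
        = real (card {\<sigma>\<in>?P. ?bad b \<sigma>}) + real W ^ (2 * r) * exp (- (G * d\<^sup>2))"
      using finP cardP by (simp add: sum.distrib sum.If_cases Int_def)
    also have "real (card {\<sigma>\<in>?P. ?bad b \<sigma>}) \<le> ?X"
      unfolding t_def
    proof (rule count_small_sines)
      show "\<bar>R i j\<bar> \<le> K" if "i \<in> h b" "j \<in> g" for i j using that R h(1)[OF b] by blast
    qed (use fin finh b h card nd pos d in auto)
    finally show "(\<Sum>\<sigma>\<in>?P. (if ?bad b \<sigma> then 1 else 0) + exp (- (G * d\<^sup>2)))
        \<le> ?X + real W ^ (2 * r) * exp (- (G * d\<^sup>2))" by simp
  qed simp
  also have "\<dots> = ?X + real W ^ (2 * r) * exp (- (G * d\<^sup>2))" using G by simp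
  finally show ?thesis .
qed


section \<open>Decay of the characteristic function\<close>

definition quadratic_value :: "nat \<Rightarrow> (nat \<Rightarrow> nat \<Rightarrow> real) \<Rightarrow> (nat \<Rightarrow> real) \<Rightarrow> real \<Rightarrow> (nat \<Rightarrow> real) \<Rightarrow> real" where
  "quadratic_value n R l c x = (\<Sum>i<n. \<Sum>j<n. R i j * x i * x j) + (\<Sum>i<n. l i * x i) + c"

text \<open>
  Terms that involve only the signs on \<open>B\<close> cancel in the difference.  In particular the quadratic
  part on \<open>B\<close> disappears, and the rest is linear in \<open>z\<close>.
\<close>

lemma quadratic_value_merge_diff:
  assumes AB: "A \<union> B = {..<n}" "A \<inter> B = {}" and sym: "\<And>i j. R i j = R j i"
  shows "quadratic_value n R l c (merge_signs A B y z) - quadratic_value n R l c (merge_signs A B y' z)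
    = ((\<Sum>i\<in>A. \<Sum>j\<in>A. R i j * y i * y j) - (\<Sum>i\<in>A. \<Sum>j\<in>A. R i j * y' i * y' j)
        + (\<Sum>i\<in>A. l i * y i) - (\<Sum>i\<in>A. l i * y' i))
      + (\<Sum>j\<in>B. z j * (2 * (\<Sum>i\<in>A. R i j * (y i - y' i))))"
proof -
  have fin: "finite A" "finite B" using AB(1) by (metis finite_Un finite_lessThan)+
  have split: "(\<Sum>i<n. f i) = (\<Sum>i\<in>A. f i) + (\<Sum>i\<in>B. f i)" for f :: "nat \<Rightarrow> real"
    unfolding AB(1)[symmetric] by (rule sum.union_disjoint) (use fin AB in auto)
  have m: "merge_signs A B y z i = y i" if "i \<in> A" for i y z using that by (simp add: merge_signs_def)
  have m': "merge_signs A B y z i = z i" if "i \<in> B" for i y z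
    using that AB(2) by (auto simp: merge_signs_def)
  have val: "quadratic_value n R l c (merge_signs A B y z)
      = (\<Sum>i\<in>A. \<Sum>j\<in>A. R i j * y i * y j) + 2 * (\<Sum>j\<in>B. \<Sum>i\<in>A. R i j * y i * z j)
        + (\<Sum>i\<in>B. \<Sum>j\<in>B. R i j * z i * z j) + (\<Sum>i\<in>A. l i * y i) + (\<Sum>i\<in>B. l i * z i) + c" for y z
  proof -
    have "(\<Sum>i\<in>A. \<Sum>j\<in>B. R i j * y i * z j) = (\<Sum>j\<in>B. \<Sum>i\<in>A. R i j * y i * z j)" by (rule sum.swap)
    moreover have "(\<Sum>i\<in>B. \<Sum>j\<in>A. R i j * z i * y j) = (\<Sum>j\<in>B. \<Sum>i\<in>A. R i j * y i * z j)"
      by (intro sum.cong refl) (subst sym, simp)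
    ultimately show ?thesis
      unfolding quadratic_value_def split sum.distrib by (simp add: m m')
  qed
  have "(\<Sum>j\<in>B. z j * (2 * (\<Sum>i\<in>A. R i j * (y i - y' i))))
      = 2 * (\<Sum>j\<in>B. \<Sum>i\<in>A. R i j * y i * z j) - 2 * (\<Sum>j\<in>B. \<Sum>i\<in>A. R i j * y' i * z j)"
    unfolding sum_distrib_left sum_subtractf[symmetric]
    by (intro sum.cong refl) (simp add: algebra_simps)
  then show ?thesis unfolding val by linarith
qed

text \<open>
  The union \<open>B\<close> of the row sets \<open>g a\<close> is decoupled from its complement, which contains all the column
  sets \<open>h a b\<close>.  Convexity first selects one row set, then, after the passage to integer frequencies, one
  of its column sets.
\<close>

lemma characteristic_function_bound:
  fixes R :: "nat \<Rightarrow> nat \<Rightarrow> real" and g :: "nat \<Rightarrow> nat set" and h :: "nat \<Rightarrow> nat \<Rightarrow> nat set"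
    and n r W G :: nat and \<theta> \<eta> K d :: real
  assumes sym: "\<And>i j. R i j = R j i" and R: "\<And>i j. i < n \<Longrightarrow> j < n \<Longrightarrow> \<bar>R i j\<bar> \<le> K"
    and G: "G > 0"
    and g: "\<And>a. a < G \<Longrightarrow> g a \<subseteq> {..<n}" "\<And>a. a < G \<Longrightarrow> card (g a) = r" "disjoint_family_on g {..<G}"
    and h: "\<And>a b. a < G \<Longrightarrow> b < G \<Longrightarrow> h a b \<subseteq> {..<n} - (\<Union>a<G. g a)"
      "\<And>a b. a < G \<Longrightarrow> b < G \<Longrightarrow> card (h a b) = r" "\<And>a. a < G \<Longrightarrow> disjoint_family_on (h a) {..<G}"
    and nd: "\<And>a b. a < G \<Longrightarrow> b < G \<Longrightarrow> nondegenerate \<eta> R (g a) (h a b)"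
    and pos: "\<eta> > 0" "\<theta> > 0" "K \<ge> 0" and d: "0 < d" "d \<le> 1/8" and W: "W > 0" "4 * real W * d \<le> 1"
  shows "(norm (\<Sum>x\<in>signs {..<n}. cis (\<theta> * quadratic_value n R l c x)) / 2 ^ n)\<^sup>2
    \<le> 4 ^ r * (((4 * \<theta> * r * K * W + 3) * (d / (\<theta> * \<eta>) + 3) / W) ^ r + exp (- (G * d\<^sup>2)))
      + exp (- (G * d\<^sup>2 / 2))"
proof -
  let ?f = "\<lambda>fej e a y y'. 4 ^ r * fej a y y' / real W ^ (2 * r) + e"
  define B where "B = (\<Union>a<G. g a)"
  define A where "A = {..<n} - B"
  have AB: "A \<union> B = {..<n}" "A \<inter> B = {}" using g(1) by (auto simp: A_def B_def)
  have fin: "finite A" "finite B" using AB(1) by (metis finite_Un finite_lessThan)+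
  have fing: "finite (g a)" if "a < G" for a using g(1)[OF that] finite_subset by blast
  define D where "D y y' j = 2 * (\<Sum>i\<in>A. R i j * (y i - y' i))" for y y' :: "nat \<Rightarrow> real" and j
  define X where "X = (4 * \<theta> * r * K * W + 3) * (d / (\<theta> * \<eta>) + 3)"
  define e where "e = exp (- (G * d\<^sup>2 / 2))"
  define E where "E = exp (- (G * d\<^sup>2))"
  define fej where "fej a y y' = (\<Prod>j\<in>g a. (norm (\<Sum>s<W. cis (2 * real s * (\<theta> * D y y' j))))\<^sup>2)" for a y y'
  have "(norm (\<Sum>x\<in>signs (A \<union> B). cis (\<theta> * quadratic_value n R l c x)) / 2 ^ card (A \<union> B))\<^sup>2
      \<le> (\<Sum>y\<in>signs A. \<Sum>y'\<in>signs A. \<Prod>j\<in>B. \<bar>cos (\<theta> * D y y' j)\<bar>) / 4 ^ card A"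
    unfolding D_def
    by (rule decoupling[OF fin AB(2) quadratic_value_merge_diff[OF AB sym]])
  also have "(\<Sum>y\<in>signs A. \<Sum>y'\<in>signs A. \<Prod>j\<in>B. \<bar>cos (\<theta> * D y y' j)\<bar>)
      \<le> (\<Sum>y\<in>signs A. \<Sum>y'\<in>signs A. (\<Sum>a<G. ?f fej e a y y') / G)"
  proof (intro sum_mono)
    fix y y' :: "nat \<Rightarrow> real"
    define S where "S j = (sin (\<theta> * D y y' j))\<^sup>2 / 2" for j
    have "(\<Prod>j\<in>B. \<bar>cos (\<theta> * D y y' j)\<bar>) \<le> (\<Prod>j\<in>B. exp (- S j))"
      unfolding S_def using abs_cos_le_exp_sin by (intro prod_mono) auto
    also have "\<dots> = exp (- (\<Sum>j\<in>B. S j))" using fin by (simp add: exp_sum[symmetric] sum_negf)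
    also have "\<dots> \<le> exp (- (\<Sum>a<G. \<Sum>j\<in>g a. S j))"
      using sum_disjoint_le[OF fin(2) g(3), of S] by (simp add: S_def B_def UN_upper)
    also have "\<dots> \<le> (\<Sum>a<G. exp (- (G * (\<Sum>j\<in>g a. S j)))) / G"
      by (rule exp_neg_sum_le_mean[OF G])
    also have "\<dots> \<le> (\<Sum>a<G. ?f fej e a y y') / G"
    proof (intro divide_right_mono sum_mono)
      fix a assume "a \<in> {..<G}"
      then show "exp (- (G * (\<Sum>j\<in>g a. S j))) \<le> ?f fej e a y y'"
        using exp_sin_le_fejer[OF fing W d(1), of a G "\<lambda>j. \<theta> * D y y' j"] g(2)[of a]
        unfolding S_def fej_def e_def by simp
    qed simp
    finally show "(\<Prod>j\<in>B. \<bar>cos (\<theta> * D y y' j)\<bar>)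
        \<le> (\<Sum>a<G. ?f fej e a y y') / G" .
  qed
  also have "(\<Sum>y\<in>signs A. \<Sum>y'\<in>signs A. (\<Sum>a<G. ?f fej e a y y') / G)
      = (\<Sum>a<G. \<Sum>y\<in>signs A. \<Sum>y'\<in>signs A. ?f fej e a y y') / G"
  proof -
    have "(\<Sum>y\<in>signs A. \<Sum>y'\<in>signs A. \<Sum>a<G. ?f fej e a y y')
        = (\<Sum>y\<in>signs A. \<Sum>a<G. \<Sum>y'\<in>signs A. ?f fej e a y y')"
      by (rule sum.cong[OF refl], rule sum.swap)
    also have "\<dots> = (\<Sum>a<G. \<Sum>y\<in>signs A. \<Sum>y'\<in>signs A. ?f fej e a y y')"
      by (rule sum.swap)
    finally show ?thesis by (simp only: sum_divide_distrib[symmetric])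
  qed
  also have "\<dots> \<le> (\<Sum>a<G. 4 ^ card A * (4 ^ r * ((X / W) ^ r + E) + e)) / G"
  proof (intro divide_right_mono sum_mono)
    fix a assume "a \<in> {..<G}"
    then have a: "a < G" by simp
    let ?\<Sigma> = "\<Sum>\<sigma>\<in>g a \<rightarrow>\<^sub>E ({..<W} \<times> {..<W}). \<Prod>i\<in>A.
      (cos (4 * \<theta> * (\<Sum>j\<in>g a. (real (fst (\<sigma> j)) - real (snd (\<sigma> j))) * R i j)))\<^sup>2"
    have "(\<Sum>y\<in>signs A. \<Sum>y'\<in>signs A. ?f fej e a y y')
        = 4 ^ r / real W ^ (2 * r) * (\<Sum>y\<in>signs A. \<Sum>y'\<in>signs A. fej a y y')
          + real (card (signs A)) * (real (card (signs A)) * e)"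
      by (simp add: sum.distrib sum_distrib_left sum_divide_distrib)
    also have "real (card (signs A)) * (real (card (signs A)) * e) = 4 ^ card A * e"
      using fin by (simp add: card_signs mult.assoc[symmetric] power_mult_distrib[symmetric])
    also have "(\<Sum>y\<in>signs A. \<Sum>y'\<in>signs A. fej a y y') = 4 ^ card A * ?\<Sigma>"
      unfolding fej_def D_def by (rule sum_fejer_eq[OF fin(1) fing[OF a]])
    also have "4 ^ r / real W ^ (2 * r) * (4 ^ card A * ?\<Sigma>)
        \<le> 4 ^ r / real W ^ (2 * r) * (4 ^ card A * ((W * X) ^ r + real W ^ (2 * r) * E))"
    proof (intro mult_left_mono)
      show "?\<Sigma> \<le> (W * X) ^ r + real W ^ (2 * r) * E"
        unfolding X_def E_def
      proof (rule sum_prod_cos_le[where h = "h a"])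
        show "\<bar>R i j\<bar> \<le> K" if "i \<in> A" "j \<in> g a" for i j
          using that R g(1)[OF a] by (auto simp: A_def)
      qed (use fin fing a g h nd pos d G in \<open>auto simp: A_def B_def\<close>)
    qed auto
    also have "\<dots> = 4 ^ card A * (4 ^ r * ((X / W) ^ r + E))"
    proof -
      have "real W ^ (2 * r) = real W ^ r * real W ^ r" by (simp add: mult_2 power_add)
      then show ?thesis using W(1) by (simp add: power_mult_distrib power_divide field_simps)
    qed
    finally show "(\<Sum>y\<in>signs A. \<Sum>y'\<in>signs A. ?f fej e a y y')
        \<le> 4 ^ card A * (4 ^ r * ((X / W) ^ r + E) + e)" by (simp add: algebra_simps)
  qed simp
  also have "\<dots> = 4 ^ card A * (4 ^ r * ((X / W) ^ r + E) + e)" using G by simp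
  finally have "(norm (\<Sum>x\<in>signs (A \<union> B). cis (\<theta> * quadratic_value n R l c x)) / 2 ^ card (A \<union> B))\<^sup>2
      \<le> 4 ^ card A * (4 ^ r * ((X / W) ^ r + E) + e) / 4 ^ card A"
    by (simp add: divide_right_mono)
  then show ?thesis unfolding AB(1) X_def E_def e_def by simp
qed


section \<open>From characteristic functions to point probabilities\<close>

lemma sum_dist_le:
  fixes \<psi> :: "nat \<Rightarrow> real"
  assumes "l < N" "\<And>d. \<psi> d \<ge> 0"
  shows "(\<Sum>k<N. \<psi> (if k \<le> l then l - k else k - l)) \<le> \<psi> 0 + 2 * (\<Sum>d=1..<N. \<psi> d)"
proof -
  have split: "{..<N} = {..l} \<union> {l<..<N}" "{..l} \<inter> {l<..<N} = {}" using assms(1) by auto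
  have "(\<Sum>k<N. \<psi> (if k \<le> l then l - k else k - l)) = (\<Sum>k\<le>l. \<psi> (l - k)) + (\<Sum>k\<in>{l<..<N}. \<psi> (k - l))"
    unfolding split(1) by (subst sum.union_disjoint) auto
  also have "(\<Sum>k\<le>l. \<psi> (l - k)) = (\<Sum>d\<le>l. \<psi> d)"
    by (rule sum.reindex_bij_witness[where i = "\<lambda>k. l - k" and j = "\<lambda>k. l - k"]) auto
  also have "\<dots> \<le> (\<Sum>d<N. \<psi> d)"
    by (rule sum_mono2) (use assms in auto)
  also have "(\<Sum>d<N. \<psi> d) = \<psi> 0 + (\<Sum>d=1..<N. \<psi> d)"
    using assms(1) by (simp add: lessThan_atLeast0 sum.atLeast_Suc_lessThan)
  also have "(\<Sum>k\<in>{l<..<N}. \<psi> (k - l)) = (\<Sum>d\<in>{1..<N-l}. \<psi> d)"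
    by (rule sum.reindex_bij_witness[where i = "\<lambda>k. k + l" and j = "\<lambda>k. k - l"]) auto
  also have "\<dots> \<le> (\<Sum>d=1..<N. \<psi> d)"
    by (rule sum_mono2) (use assms in auto)
  finally show ?thesis by simp
qed

text \<open>
  The squared exponential sum \<open>\<bar>\<Sum>k<N. exp(i k t (F x - v))\<bar>\<^sup>2\<close> is nonnegative and equals \<open>N\<^sup>2\<close> where
  \<open>F x = v\<close>.  Its average over \<open>S\<close> is therefore an upper bound for \<open>N\<^sup>2\<close> times the point probability, and
  expanding the square leaves only values of \<open>\<phi>\<close> at differences of multiples of \<open>t\<close>.
\<close>

lemma point_probability_le:
  fixes F :: "'x \<Rightarrow> real" and t :: real and N :: nat
  assumes S: "finite S" "S \<noteq> {}" and N: "N > 0"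
  defines "\<phi> \<equiv> \<lambda>\<theta>. norm (\<Sum>x\<in>S. cis (\<theta> * F x)) / card S"
  shows "real (card {x\<in>S. F x = v}) / card S \<le> (1 + 2 * (\<Sum>k=1..<N. \<phi> (k * t))) / N"
proof -
  let ?E = "\<lambda>k l x. cis (- ((real k - real l) * t * v)) * cis ((real k - real l) * t * F x)"
  have c: "real (card S) > 0" using S by (simp add: card_gt_0_iff)
  define e where "e x = (\<Sum>k<N. cis (k * t * (F x - v)))" for x
  have "real (card {x\<in>S. F x = v}) * (real N)\<^sup>2 = (\<Sum>x\<in>{x\<in>S. F x = v}. (norm (e x))\<^sup>2)"
    by (simp add: e_def)
  also have "\<dots> \<le> (\<Sum>x\<in>S. (norm (e x))\<^sup>2)"
    by (rule sum_mono2) (use S in auto)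
  also have "\<dots> = norm (complex_of_real (\<Sum>x\<in>S. (norm (e x))\<^sup>2))"
    unfolding norm_of_real by (simp add: sum_nonneg)
  also have "complex_of_real (\<Sum>x\<in>S. (norm (e x))\<^sup>2)
      = (\<Sum>x\<in>S. \<Sum>k<N. \<Sum>l<N. cis (real k * t * (F x - v)) * cnj (cis (real l * t * (F x - v))))"
    unfolding of_real_sum complex_norm_square e_def cnj_sum sum_product ..
  also have "\<dots> = (\<Sum>x\<in>S. \<Sum>k<N. \<Sum>l<N. ?E k l x)"
    by (intro sum.cong refl) (simp only: cis_cnj cis_mult, simp add: algebra_simps)
  also have "\<dots> = (\<Sum>k<N. \<Sum>x\<in>S. \<Sum>l<N. ?E k l x)"
    by (rule sum.swap)
  also have "\<dots> = (\<Sum>k<N. \<Sum>l<N. \<Sum>x\<in>S. ?E k l x)"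
    by (rule sum.cong[OF refl], rule sum.swap)
  also have "norm \<dots> \<le> (\<Sum>k<N. \<Sum>l<N. norm (\<Sum>x\<in>S. ?E k l x))"
    by (rule order.trans[OF norm_sum], rule sum_mono, rule norm_sum)
  also have "\<dots> = (\<Sum>k<N. \<Sum>l<N. card S * \<phi> ((if l \<le> k then k - l else l - k) * t))"
  proof (intro sum.cong refl)
    fix k l
    have neg: "norm (\<Sum>x\<in>S. cis (- \<theta> * F x)) = norm (\<Sum>x\<in>S. cis (\<theta> * F x))" for \<theta>
    proof -
      have "(\<Sum>x\<in>S. cis (- \<theta> * F x)) = cnj (\<Sum>x\<in>S. cis (\<theta> * F x))"
        by (simp add: cis_cnj)
      then show ?thesis by (simp only: complex_mod_cnj)
    qed
    have "norm (\<Sum>x\<in>S. ?E k l x)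
        = norm (\<Sum>x\<in>S. cis ((real k - real l) * t * F x))"
      unfolding sum_distrib_left[symmetric] norm_mult by simp
    also have "\<dots> = card S * \<phi> ((if l \<le> k then k - l else l - k) * t)"
    proof (cases "l \<le> k")
      case True
      then show ?thesis unfolding \<phi>_def using c by (simp add: of_nat_diff)
    next
      case False
      then have "(real k - real l) * t = - (real (l - k) * t)" by (simp add: of_nat_diff algebra_simps)
      then show ?thesis unfolding \<phi>_def using c False neg[of "real (l - k) * t"] by simp
    qed
    finally show "norm (\<Sum>x\<in>S. ?E k l x) = \<dots>" .
  qed
  also have "\<dots> \<le> (\<Sum>k<N. card S * (1 + 2 * (\<Sum>d=1..<N. \<phi> (d * t))))"
  proof (rule sum_mono)
    fix k assume k: "k \<in> {..<N}"
    have "(\<Sum>l<N. \<phi> ((if l \<le> k then k - l else l - k) * t)) \<le> \<phi> (real 0 * t) + 2 * (\<Sum>d=1..<N. \<phi> (d * t))"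
      using sum_dist_le[of k N "\<lambda>d. \<phi> (real d * t)"] k by (simp add: \<phi>_def)
    also have "\<phi> (real 0 * t) = 1" using c by (simp add: \<phi>_def)
    finally show "(\<Sum>l<N. card S * \<phi> ((if l \<le> k then k - l else l - k) * t))
        \<le> card S * (1 + 2 * (\<Sum>d=1..<N. \<phi> (d * t)))"
      using c unfolding sum_distrib_left[symmetric] by (intro mult_left_mono) auto
  qed
  also have "\<dots> = N * card S * (1 + 2 * (\<Sum>d=1..<N. \<phi> (d * t)))" by simp
  finally have *: "real (card {x\<in>S. F x = v}) * (real N)\<^sup>2 \<le> N * card S * (1 + 2 * (\<Sum>d=1..<N. \<phi> (d * t)))" .
  have "real (card {x\<in>S. F x = v}) / card S
      = real (card {x\<in>S. F x = v}) * (real N)\<^sup>2 / (card S * (real N)\<^sup>2)"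
    using N by simp
  also have "\<dots> \<le> N * card S * (1 + 2 * (\<Sum>d=1..<N. \<phi> (d * t))) / (card S * (real N)\<^sup>2)"
    using * by (intro divide_right_mono) auto
  also have "\<dots> = (1 + 2 * (\<Sum>k=1..<N. \<phi> (k * t))) / N"
    using N c by (simp add: power2_eq_square)
  finally show ?thesis .
qed

text \<open>
  The \<open>G\<close> column sets \<open>h a b\<close> may depend on the row set \<open>g a\<close>, but all of them avoid the union of all
  row sets; this union is the set of coordinates that is split off in the decoupling.
\<close>

definition many_nondegenerate :: "nat \<Rightarrow> real \<Rightarrow> nat \<Rightarrow> nat \<Rightarrow> (nat \<Rightarrow> nat \<Rightarrow> real) \<Rightarrow> bool" where
  "many_nondegenerate r \<eta> G n R \<longleftrightarrow> (\<exists>g h.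
    (\<forall>a<G. g a \<subseteq> {..<n} \<and> card (g a) = r) \<and> disjoint_family_on g {..<G} \<and>
    (\<forall>a<G. disjoint_family_on (h a) {..<G}) \<and>
    (\<forall>a<G. \<forall>b<G. h a b \<subseteq> {..<n} - (\<Union>a<G. g a) \<and> card (h a b) = r \<and> nondegenerate \<eta> R (g a) (h a b)))"

text \<open>
  The Fejer kernel is used with the order \<open>W \<approx> 1 / (4 d)\<close>, the largest one that \<open>exp_sin_le_fejer\<close> permits.  With it the bound becomes a power of \<open>(\<theta> + d) (1 + d / \<theta>)\<close>, that is,
  of \<open>(\<theta> + d)\<^sup>2 / \<theta>\<close>.
\<close>

lemma characteristic_function_decay:
  fixes R :: "nat \<Rightarrow> nat \<Rightarrow> real" and n r G :: nat and \<theta> \<eta> K d :: real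
  assumes sym: "\<And>i j. R i j = R j i" and R: "\<And>i j. i < n \<Longrightarrow> j < n \<Longrightarrow> \<bar>R i j\<bar> \<le> K"
    and G: "G > 0" and nd: "many_nondegenerate r \<eta> G n R"
    and pos: "\<eta> > 0" "\<theta> > 0" "K \<ge> 0" and d: "0 < d" "d \<le> 1/8"
  shows "(norm (\<Sum>x\<in>signs {..<n}. cis (\<theta> * quadratic_value n R l c x)) / 2 ^ n)\<^sup>2
    \<le> 4 ^ r * (2 * ((4 * r * K + 24) * (3 + 1 / \<eta>)) * (\<theta> + d\<^sup>2 / \<theta>)) ^ r + (4 ^ r + 1) * exp (- (G * d\<^sup>2 / 2))"
proof -
  let ?C = "(4 * r * K + 24) * (3 + 1 / \<eta>)"
  obtain g h where gh: "\<forall>a<G. g a \<subseteq> {..<n} \<and> card (g a) = r" "disjoint_family_on g {..<G}"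
    "\<forall>a<G. disjoint_family_on (h a) {..<G}"
    "\<forall>a<G. \<forall>b<G. h a b \<subseteq> {..<n} - (\<Union>a<G. g a) \<and> card (h a b) = r \<and> nondegenerate \<eta> R (g a) (h a b)"
    using nd unfolding many_nondegenerate_def by (elim exE conjE)
  have g: "\<And>a. a < G \<Longrightarrow> g a \<subseteq> {..<n}" "\<And>a. a < G \<Longrightarrow> card (g a) = r" "disjoint_family_on g {..<G}"
    and h: "\<And>a b. a < G \<Longrightarrow> b < G \<Longrightarrow> h a b \<subseteq> {..<n} - (\<Union>a<G. g a)"
      "\<And>a b. a < G \<Longrightarrow> b < G \<Longrightarrow> card (h a b) = r" "\<And>a. a < G \<Longrightarrow> disjoint_family_on (h a) {..<G}"
    and nd': "\<And>a b. a < G \<Longrightarrow> b < G \<Longrightarrow> nondegenerate \<eta> R (g a) (h a b)"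
    using gh by blast+
  define W where "W = nat \<lfloor>1 / (4 * d)\<rfloor>"
  have "1 / (4 * d) \<ge> 2" using d by (simp add: field_simps)
  then have W: "real W \<le> 1 / (4 * d)" "real W \<ge> 1 / (4 * d) - 1"
    unfolding W_def by linarith+
  have W8: "real W \<ge> 1 / (8 * d)"
  proof -
    have "1 / (4 * d) = 2 * (1 / (8 * d))" by simp
    moreover have "1 / (8 * d) \<ge> 1" using d by (simp add: field_simps)
    ultimately show ?thesis using W(2) by linarith
  qed
  then have W0: "W > 0" using d by (intro gr0I) (auto simp: field_simps)
  have Wd: "4 * real W * d \<le> 1" using W(1) d by (simp add: field_simps)
  have Winv: "1 / real W \<le> 8 * d" using W8 W0 d by (simp add: field_simps)
  have "(4 * \<theta> * r * K * W + 3) * (d / (\<theta> * \<eta>) + 3) / W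
      = (4 * r * K * \<theta> + 3 * (1 / W)) * (d / \<theta> * (1 / \<eta>) + 3)"
    using W0 by (simp add: field_simps)
  also have "\<dots> \<le> ((4 * r * K + 24) * (\<theta> + d)) * ((3 + 1 / \<eta>) * (1 + d / \<theta>))"
  proof (intro mult_mono)
    have "4 * r * K * \<theta> + 3 * (1 / W) \<le> 4 * r * K * \<theta> + 24 * d" using Winv by simp
    also have "\<dots> \<le> (4 * r * K + 24) * (\<theta> + d)" using pos d by (simp add: algebra_simps)
    finally show "4 * r * K * \<theta> + 3 * (1 / W) \<le> (4 * r * K + 24) * (\<theta> + d)" .
    show "d / \<theta> * (1 / \<eta>) + 3 \<le> (3 + 1 / \<eta>) * (1 + d / \<theta>)"
      using pos d by (simp add: algebra_simps)
  qed (use pos d in \<open>auto intro!: add_nonneg_nonneg mult_nonneg_nonneg\<close>)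
  also have "\<dots> = (4 * r * K + 24) * (3 + 1 / \<eta>) * ((\<theta> + d) * (1 + d / \<theta>))" by (simp only: mult_ac)
  also have "\<dots> \<le> (4 * r * K + 24) * (3 + 1 / \<eta>) * (2 * (\<theta> + d\<^sup>2 / \<theta>))"
  proof (intro mult_left_mono)
    have "(\<theta> + d) * (1 + d / \<theta>) = (\<theta> + d)\<^sup>2 / \<theta>" using pos by (simp add: field_simps power2_eq_square)
    also have "\<dots> \<le> (2 * (\<theta>\<^sup>2 + d\<^sup>2)) / \<theta>"
      using pos sum_squares_ge_zero[of "\<theta> - d" 0]
      by (intro divide_right_mono) (auto simp: power2_eq_square algebra_simps)
    also have "\<dots> = 2 * (\<theta> + d\<^sup>2 / \<theta>)" using pos by (simp add: field_simps power2_eq_square)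
    finally show "(\<theta> + d) * (1 + d / \<theta>) \<le> 2 * (\<theta> + d\<^sup>2 / \<theta>)" .
  qed (use pos in auto)
  finally have X: "(4 * \<theta> * r * K * W + 3) * (d / (\<theta> * \<eta>) + 3) / W
      \<le> 2 * ?C * (\<theta> + d\<^sup>2 / \<theta>)" by (simp only: mult_ac)
  have "(norm (\<Sum>x\<in>signs {..<n}. cis (\<theta> * quadratic_value n R l c x)) / 2 ^ n)\<^sup>2
    \<le> 4 ^ r * (((4 * \<theta> * r * K * W + 3) * (d / (\<theta> * \<eta>) + 3) / W) ^ r + exp (- (G * d\<^sup>2)))
      + exp (- (G * d\<^sup>2 / 2))"
    by (rule characteristic_function_bound[where g = g and h = h])
      (use sym R G g h nd' pos d W0 Wd in auto)
  also have "\<dots> \<le> 4 ^ r * ((2 * ?C * (\<theta> + d\<^sup>2 / \<theta>)) ^ r + exp (- (G * d\<^sup>2 / 2)))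
      + exp (- (G * d\<^sup>2 / 2))"
    by (intro add_mono mult_left_mono power_mono X)
      (use pos d in \<open>auto intro!: divide_nonneg_nonneg mult_nonneg_nonneg add_nonneg_nonneg\<close>)
  finally show ?thesis by (simp add: algebra_simps)
qed

lemma sqrt_power_eq_powr:
  fixes r :: nat
  assumes "r > 0" "x \<ge> 0"
  shows "sqrt (x ^ r) = x powr (r / 2)"
proof (cases "x = 0")
  case False
  with assms have "x > 0" by simp
  then show ?thesis by (simp add: powr_half_sqrt[symmetric] powr_realpow[symmetric] powr_powr)
qed (use assms in auto)

text \<open>
  The threshold is \<open>d\<^sup>2 = 4 ln n / G\<close>, which makes the error term of the decay bound equal to a constant
  times \<open>n\<^sup>-\<^sup>2\<close>.  The characteristic function is sampled at \<open>\<theta> = k / n\<close> for \<open>1 \<le> k < N\<close>, where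
  \<open>\<theta> + d\<^sup>2 / \<theta>\<close> is at most of order \<open>N / n + ln n / k\<close>.  Summing over \<open>k\<close> uses the convergence of the
  sum of \<open>k powr (-3/2)\<close>, and \<open>N \<approx> n powr \<beta>\<close> balances the resulting terms because \<open>(\<beta> - 1) r / 2 = - \<beta>\<close>.
\<close>

lemma anticoncentration:
  fixes r :: nat and K \<eta> \<gamma> :: real
  assumes r: "r \<ge> 3" and pos: "K \<ge> 0" "\<eta> > 0" "\<gamma> > 0"
  shows "\<exists>C n0. \<forall>n\<ge>n0. \<forall>R l c G v.
    (\<forall>i j. R i j = R j i) \<and> (\<forall>i<n. \<forall>j<n. \<bar>R i j\<bar> \<le> K) \<and> real G \<ge> \<gamma> * n \<and> many_nondegenerate r \<eta> G n R
    \<longrightarrow> real (card {x\<in>signs {..<n}. quadratic_value n R l c x = v}) / 2 ^ n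
      \<le> C * (ln n powr (r / 2) / n powr (1 - 2 / (r + 2)))"
proof -
  define \<beta> where "\<beta> = 1 - 2 / (real r + 2)"
  define q where "q = real r / 2"
  have q: "q \<ge> 3/2" using r by (simp add: q_def)
  have \<beta>: "\<beta> > 0" "\<beta> \<le> 1" "(\<beta> - 1) * q = - \<beta>"
    unfolding \<beta>_def q_def using r by (auto simp: field_simps)
  define u where "u = 2 * ((4 * r * K + 24) * (3 + 1 / \<eta>))"
  have u: "u > 0" unfolding u_def using pos by (auto intro!: mult_pos_pos add_pos_pos add_nonneg_pos)
  define Z where "Z = suminf (\<lambda>k. real k powr (- 3/2))"
  have summ: "summable (\<lambda>k. real k powr (- 3/2))" by (simp add: summable_real_powr_iff)
  define B where "B = 2 ^ r * (2 * u) powr q"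
  define C1 where "C1 = 1 + 2 * B * 2 powr q + 2 * (2 ^ r + 1)"
  define C2 where "C2 = 2 * B * (4 / \<gamma>) powr q * Z"
  define C where "C = C1 / ln 2 powr q + C2"
  have B: "B \<ge> 0" unfolding B_def by simp
  have Z: "Z \<ge> 0" unfolding Z_def by (intro suminf_nonneg summ) auto
  have C12: "C1 \<ge> 0" "C2 \<ge> 0" unfolding C1_def C2_def using B Z by (auto intro!: add_nonneg_nonneg mult_nonneg_nonneg)
  have "(\<lambda>n. ln (real n) / real n) \<longlonglongrightarrow> 0" by (rule lim_ln_over_n)
  then have "eventually (\<lambda>n. ln (real n) / real n < \<gamma> / 256) sequentially"
    using pos by (intro order_tendstoD) auto
  then obtain n1 where n1: "\<And>n. n \<ge> n1 \<Longrightarrow> ln (real n) / real n < \<gamma> / 256"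
    by (auto simp: eventually_sequentially)
  define n0 where "n0 = max n1 2"
  have "real (card {x\<in>signs {..<n}. quadratic_value n R l c x = v}) / 2 ^ n
      \<le> C * (ln n powr (r / 2) / n powr (1 - 2 / (r + 2)))"
    if n: "n \<ge> n0" and sym: "\<forall>i j. R i j = R j i" and R: "\<forall>i<n. \<forall>j<n. \<bar>R i j\<bar> \<le> K"
      and G: "real G \<ge> \<gamma> * n" and nd: "many_nondegenerate r \<eta> G n R" for n R l c G v
  proof -
    have n2: "n \<ge> 2" "n \<ge> n1" using n by (auto simp: n0_def)
    then have ln: "ln (real n) > 0" "ln (real n) \<ge> ln 2" by auto
    have "\<gamma> * n > 0" using pos n2 by simp
    with G have G0: "G > 0" by (intro gr0I) auto
    define d where "d = sqrt (4 * ln n / G)"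
    have d0: "d > 0" unfolding d_def using ln G0 by simp
    have d2: "d\<^sup>2 = 4 * ln n / G" unfolding d_def using ln G0 by simp
    have d2n: "d\<^sup>2 * n \<le> 4 / \<gamma> * ln n"
    proof -
      have "d\<^sup>2 * n = 4 * ln n * (n / G)" unfolding d2 by simp
      also have "n / G \<le> 1 / \<gamma>" using G G0 pos by (simp add: field_simps)
      then have "4 * ln n * (n / G) \<le> 4 * ln n * (1 / \<gamma>)" using ln by (intro mult_left_mono) auto
      finally show ?thesis by (simp add: mult_ac)
    qed
    \<comment> \<open>This is where \<open>n\<close> has to be large.\<close>
    have d8: "d \<le> 1/8"
    proof (rule power2_le_imp_le)
      have "256 * (ln n / n) < \<gamma>" using n1[OF n2(2)] by (simp add: mult.commute)
      then have "256 * ln n < \<gamma> * n" using n2 by (simp add: field_simps)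
      then have "256 * ln n \<le> G" using G by linarith
      then show "d\<^sup>2 \<le> (1/8)\<^sup>2" unfolding d2 using G0 by (simp add: field_simps power2_eq_square)
    qed simp
    define S where "S = signs {..<n}"
    have cardS: "real (card S) = 2 ^ n" unfolding S_def by (simp add: card_signs)
    have S: "finite S" "S \<noteq> {}" unfolding S_def using cardS S_def by auto
    define \<phi> where "\<phi> \<theta> = norm (\<Sum>x\<in>S. cis (\<theta> * quadratic_value n R l c x)) / card S" for \<theta>
    define N where "N = nat \<lceil>n powr \<beta>\<rceil>"
    have nb: "real n powr \<beta> \<ge> 1" using n2 \<beta> by (intro ge_one_powr_ge_zero) auto
    have N: "real N \<ge> n powr \<beta>" "real N \<le> 2 * n powr \<beta>" "N > 0"
      unfolding N_def using nb by linarith+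
    have phi: "\<phi> (k * (1 / n)) \<le> B * (N / n) powr q + B * (4 / \<gamma>) powr q * ln n powr q * k powr (-3/2) + (2 ^ r + 1) / n"
      if k: "k \<ge> 1" "k < N" for k
    proof -
      let ?\<theta> = "k * (1 / real n)"
      have th: "?\<theta> > 0" using k n2 by simp
      have e: "exp (- (G * d\<^sup>2 / 2)) = (1 / n)\<^sup>2"
      proof -
        have "- (G * d\<^sup>2 / 2) = - (2 * ln n)" unfolding d2 using G0 by simp
        also have "exp \<dots> = inverse (exp (ln n) ^ 2)" by (simp add: exp_minus exp_double)
        finally show ?thesis using n2 by (simp add: power_divide field_simps)
      qed
      have "(\<phi> ?\<theta>)\<^sup>2 \<le> 4 ^ r * (u * (?\<theta> + d\<^sup>2 / ?\<theta>)) ^ r + (4 ^ r + 1) * (1 / n)\<^sup>2"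
        unfolding \<phi>_def cardS u_def e[symmetric] unfolding S_def
        by (rule characteristic_function_decay) (use sym R G0 nd pos th d0 d8 in auto)
      then have "\<phi> ?\<theta> \<le> sqrt (4 ^ r * (u * (?\<theta> + d\<^sup>2 / ?\<theta>)) ^ r + (4 ^ r + 1) * (1 / n)\<^sup>2)"
        by (rule real_le_rsqrt)
      also have "\<dots> \<le> sqrt (4 ^ r * (u * (?\<theta> + d\<^sup>2 / ?\<theta>)) ^ r) + sqrt ((4 ^ r + 1) * (1 / n)\<^sup>2)"
        by (rule sqrt_add_le_add_sqrt) (use u th in auto)
      also have "sqrt ((4 ^ r + 1) * (1 / n)\<^sup>2) \<le> (2 ^ r + 1) / n"
      proof -
        have "sqrt (4 ^ r + 1) \<le> sqrt (4 ^ r) + sqrt 1" by (rule sqrt_add_le_add_sqrt) auto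
        also have "sqrt (4 ^ r) = (2::real) ^ r" by (simp add: real_sqrt_power)
        finally show ?thesis by (simp add: real_sqrt_mult real_sqrt_divide divide_right_mono)
      qed
      also have "sqrt (4 ^ r * (u * (?\<theta> + d\<^sup>2 / ?\<theta>)) ^ r) = 2 ^ r * (u * (?\<theta> + d\<^sup>2 / ?\<theta>)) powr q"
        using sqrt_power_eq_powr[of r "u * (?\<theta> + d\<^sup>2 / ?\<theta>)"] r u th
        by (simp add: real_sqrt_mult real_sqrt_power q_def)
      also have "\<dots> \<le> 2 ^ r * ((2 * u) powr q * ((N / n) powr q + (4 / \<gamma> * ln n / k) powr q))"
      proof (intro mult_left_mono)
        let ?x = "N / real n" and ?y = "4 / \<gamma> * ln n / k"
        have "d\<^sup>2 / ?\<theta> = d\<^sup>2 * n / k" using k n2 by (simp add: field_simps)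
        also have "\<dots> \<le> ?y" using d2n by (intro divide_right_mono) auto
        finally have y: "d\<^sup>2 / ?\<theta> \<le> ?y" .
        have x: "?\<theta> \<le> ?x" using k n2 by (simp add: divide_right_mono)
        have "u * (?\<theta> + d\<^sup>2 / ?\<theta>) \<le> u * (2 * max ?x ?y)"
          using x y u by (intro mult_left_mono) auto
        then have "(u * (?\<theta> + d\<^sup>2 / ?\<theta>)) powr q \<le> (u * (2 * max ?x ?y)) powr q"
          using u th q by (intro powr_mono2) auto
        also have "\<dots> = (2 * u) powr q * (max ?x ?y) powr q"
          using u by (simp add: powr_mult[symmetric] mult_ac max_def)
        also have "(max ?x ?y) powr q \<le> ?x powr q + ?y powr q" by (simp add: max_def)
        finally show "(u * (?\<theta> + d\<^sup>2 / ?\<theta>)) powr q \<le> (2 * u) powr q * (?x powr q + ?y powr q)"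
          by (simp add: mult_left_mono)
      qed simp
      also have "\<dots> = B * (N / n) powr q + B * (4 / \<gamma> * ln n / k) powr q"
        unfolding B_def by (simp add: algebra_simps)
      also have "(4 / \<gamma> * ln n / k) powr q \<le> (4 / \<gamma>) powr q * ln n powr q * k powr (-3/2)"
      proof -
        have "(4 / \<gamma> * ln n / k) powr q = (4 / \<gamma> * ln n) powr q * k powr (- q)"
          unfolding powr_minus_divide using pos ln by (subst powr_divide) auto
        also have "(4 / \<gamma> * ln n) powr q = (4 / \<gamma>) powr q * ln n powr q"
          by (rule powr_mult)
        also have "real k powr (- q) \<le> k powr (-3/2)"
          using k q by (intro powr_mono) auto
        finally show ?thesis by (simp add: mult_left_mono)
      qed
      finally show ?thesis using B by (simp add: mult_left_mono mult.assoc)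
    qed
    have "real (card {x\<in>S. quadratic_value n R l c x = v}) / card S
        \<le> (1 + 2 * (\<Sum>k=1..<N. \<phi> (k * (1 / n)))) / N"
      unfolding \<phi>_def by (rule point_probability_le[OF S N(3)])
    also have "(\<Sum>k=1..<N. \<phi> (k * (1 / n)))
        \<le> (\<Sum>k=1..<N. B * (N / n) powr q + B * (4 / \<gamma>) powr q * ln n powr q * k powr (-3/2) + (2 ^ r + 1) / n)"
      by (intro sum_mono phi) auto
    also have "\<dots> = (N - 1) * (B * (N / n) powr q + (2 ^ r + 1) / n)
        + B * (4 / \<gamma>) powr q * ln n powr q * (\<Sum>k=1..<N. k powr (-3/2))"
      by (simp add: sum.distrib sum_distrib_left algebra_simps)
    also have "\<dots> \<le> N * (B * (N / n) powr q + (2 ^ r + 1) / n) + B * (4 / \<gamma>) powr q * ln n powr q * Z"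
    proof (intro add_mono mult_mono mult_left_mono)
      show "(\<Sum>k=1..<N. k powr (-3/2)) \<le> Z"
        unfolding Z_def by (rule sum_le_suminf[OF summ]) auto
    qed (use B in \<open>auto intro: sum_nonneg\<close>)
    finally have p: "real (card {x\<in>S. quadratic_value n R l c x = v}) / card S
        \<le> (1 + 2 * (N * (B * (N / n) powr q + (2 ^ r + 1) / n) + B * (4 / \<gamma>) powr q * ln n powr q * Z)) / N"
      by (simp add: divide_right_mono)
    also have "\<dots> = (1 + C2 * ln n powr q) * (1 / N) + 2 * B * (N / n) powr q + 2 * (2 ^ r + 1) * (1 / n)"
      unfolding C2_def using N(3) by (simp add: field_simps)
    also have "\<dots> \<le> (1 + C2 * ln n powr q) * n powr (- \<beta>) + 2 * B * (2 powr q * n powr (- \<beta>)) + 2 * (2 ^ r + 1) * n powr (- \<beta>)"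
    proof (intro add_mono mult_left_mono)
      show "1 / real N \<le> n powr (- \<beta>)"
        using N nb n2 unfolding powr_minus_divide by (intro divide_left_mono mult_pos_pos) auto
      have "(N / n) powr q \<le> (2 * n powr (\<beta> - 1)) powr q"
      proof (rule powr_mono2)
        have "N / n \<le> 2 * n powr \<beta> / n" using N by (intro divide_right_mono) auto
        also have "\<dots> = 2 * n powr (\<beta> - 1)" using n2 by (simp add: powr_diff)
        finally show "N / n \<le> 2 * n powr (\<beta> - 1)" .
      qed (use q in auto)
      also have "\<dots> = 2 powr q * n powr (- \<beta>)" by (simp add: powr_mult powr_powr \<beta>(3))
      finally show "(N / n) powr q \<le> 2 powr q * n powr (- \<beta>)" .
      have "1 / real n = n powr (- 1)" using n2 by (simp add: powr_minus_divide)
      also have "\<dots> \<le> n powr (- \<beta>)" using n2 \<beta> by (intro powr_mono) auto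
      finally show "1 / real n \<le> n powr (- \<beta>)" .
    qed (use B C12 in auto)
    also have "\<dots> = (C1 + C2 * ln n powr q) * n powr (- \<beta>)" unfolding C1_def by (simp add: algebra_simps)
    also have "\<dots> \<le> (C * ln n powr q) * n powr (- \<beta>)"
    proof (rule mult_right_mono)
      have "ln 2 powr q \<le> ln n powr q" using ln q by (intro powr_mono2) auto
      then have "C1 * 1 \<le> C1 * (ln n powr q / ln 2 powr q)"
        using C12 by (intro mult_left_mono) auto
      then show "C1 + C2 * ln n powr q \<le> C * ln n powr q" unfolding C_def by (simp add: algebra_simps)
    qed simp
    also have "\<dots> = C * (ln n powr (r / 2) / n powr (1 - 2 / (r + 2)))"
      unfolding q_def \<beta>_def powr_minus_divide by (simp add: add_ac)
    finally show ?thesis unfolding cardS unfolding S_def .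
  qed
  note main = this
  show ?thesis
    by (intro exI[of _ C] exI[of _ n0] allI impI, elim conjE) (rule main; assumption)
qed


section \<open>Minors over a subfield of the complex numbers\<close>

text \<open>
  One argument serves all three fields: the absolute value is the one induced by an embedding into the
  complex numbers.
\<close>

locale subfield_embedding = field_hom emb for emb :: "'a::field_char_0 \<Rightarrow> complex"
begin

definition mag :: "'a \<Rightarrow> real" where "mag a = cmod (emb a)"

lemma mag_simps [simp]: "mag 0 = 0" "mag 1 = 1" "mag (- a) = mag a" "mag (a * b) = mag a * mag b"
  by (simp_all add: mag_def hom_distribs norm_mult)

lemma mag_nonneg [simp]: "mag a \<ge> 0" by (simp add: mag_def)

lemma mag_add: "mag (a + b) \<le> mag a + mag b" by (simp add: mag_def hom_distribs norm_triangle_ineq)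

lemma mag_diff: "mag (a - b) \<le> mag a + mag b" by (simp add: mag_def hom_distribs norm_triangle_ineq4)

lemma mag_divide: "mag (a / b) = mag a / mag b" by (simp add: mag_def hom_distribs norm_divide)

lemma mag_sum: "mag (sum f A) \<le> (\<Sum>x\<in>A. mag (f x))"
  unfolding mag_def hom_sum by (rule norm_sum)

lemma mag_prod: "mag (prod f A) = (\<Prod>x\<in>A. mag (f x))"
  unfolding mag_def hom_prod by (rule prod_norm[symmetric])

lemma mag_two [simp]: "mag 2 = 2"
proof -
  have "emb 2 = 2" unfolding one_add_one[symmetric] by (simp only: hom_add hom_one)
  then show ?thesis by (simp add: mag_def)
qed

lemma mag_det_le:
  assumes A: "A \<in> carrier_mat k k" and le: "\<And>i j. i < k \<Longrightarrow> j < k \<Longrightarrow> mag (A $$ (i, j)) \<le> 1"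
  shows "mag (det A) \<le> fact k"
proof -
  have "mag (det A) \<le> (\<Sum>p | p permutes {0..<k}. mag (signof p * (\<Prod>i = 0..<k. A $$ (i, p i))))"
    unfolding det_def'[OF A] by (rule mag_sum)
  also have "\<dots> \<le> (\<Sum>p | p permutes {0..<k}. 1)"
  proof (rule sum_mono)
    fix p assume p: "p \<in> {p. p permutes {0..<k}}"
    have "(\<Prod>i = 0..<k. mag (A $$ (i, p i))) \<le> (\<Prod>i = 0..<k. 1)"
      by (intro prod_mono) (use le p permutes_in_image in force)
    moreover have "mag (signof p) = 1" by (cases p rule: sign_cases) (simp_all)
    ultimately show "mag (signof p * (\<Prod>i = 0..<k. A $$ (i, p i))) \<le> 1"
      by (simp add: mag_prod)
  qed
  also have "\<dots> = fact k" by (simp add: card_permutations)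
  finally show ?thesis .
qed

end

text \<open>
  Index tuples are functions, and repeated indices are permitted; they give determinant 0.
\<close>

definition minor_mat :: "(nat \<Rightarrow> nat \<Rightarrow> 'a) \<Rightarrow> nat \<Rightarrow> (nat \<Rightarrow> nat) \<Rightarrow> (nat \<Rightarrow> nat) \<Rightarrow> 'a mat" where
  "minor_mat Q k J I = mat k k (\<lambda>(a, b). Q (J a) (I b))"

text \<open>
  If \<open>B\<close> is the inverse of the minor with rows \<open>J\<close> and columns \<open>I\<close>, the subtracted term predicts
  \<open>Q i j\<close> from these rows and columns, exactly so if \<open>Q\<close> has rank \<open>k\<close>; the difference is an entry of the
  Schur complement.
\<close>

definition cross_residual :: "(nat \<Rightarrow> nat \<Rightarrow> 'a::comm_ring_1) \<Rightarrow> nat \<Rightarrow> (nat \<Rightarrow> nat) \<Rightarrow> (nat \<Rightarrow> nat)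
    \<Rightarrow> (nat \<Rightarrow> nat \<Rightarrow> 'a) \<Rightarrow> nat \<Rightarrow> nat \<Rightarrow> 'a" where
  "cross_residual Q k J I B i j = Q i j - (\<Sum>b<k. Q i (I b) * (\<Sum>a<k. B b a * Q (J a) j))"

text \<open>
  The bordered minor is the product of the block lower triangular matrix with diagonal blocks \<open>A\<close> and
  the residual, and a block upper unitriangular matrix.
\<close>

lemma det_bordered:
  fixes Q :: "nat \<Rightarrow> nat \<Rightarrow> 'a::field"
  assumes inv: "\<And>a c. a < k \<Longrightarrow> c < k \<Longrightarrow> (\<Sum>b<k. Q (J a) (I b) * B b c) = (if a = c then 1 else 0)"
  shows "det (minor_mat Q (Suc k) (J(k := i)) (I(k := j)))
    = det (minor_mat Q k J I) * cross_residual Q k J I B i j"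
proof -
  define A where "A = minor_mat Q k J I"
  have A: "A \<in> carrier_mat k k" by (simp add: A_def minor_mat_def)
  define m where "m b = (\<Sum>a<k. B b a * Q (J a) j)" for b
  define p where "p = mat 1 k (\<lambda>(x, b). Q i (I b))"
  define \<rho> where "\<rho> = mat 1 1 (\<lambda>(x::nat, y::nat). cross_residual Q k J I B i j)"
  define M where "M = mat k 1 (\<lambda>(b, y::nat). m b)"
  have c: "p \<in> carrier_mat 1 k" "\<rho> \<in> carrier_mat 1 1" "M \<in> carrier_mat k 1"
    by (simp_all add: p_def \<rho>_def M_def)
  let ?L = "four_block_mat A (0\<^sub>m k 1) p \<rho>" and ?U = "four_block_mat (1\<^sub>m k) M (0\<^sub>m 1 k) (1\<^sub>m 1)"
  have Am: "(\<Sum>b<k. Q (J a) (I b) * m b) = Q (J a) j" if "a < k" for a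
  proof -
    have "(\<Sum>b<k. Q (J a) (I b) * m b) = (\<Sum>b<k. \<Sum>c<k. Q (J a) (I b) * B b c * Q (J c) j)"
      unfolding m_def by (simp add: sum_distrib_left mult.assoc)
    also have "\<dots> = (\<Sum>c<k. (\<Sum>b<k. Q (J a) (I b) * B b c) * Q (J c) j)"
      by (subst sum.swap) (simp add: sum_distrib_right)
    also have "\<dots> = (\<Sum>c<k. if a = c then Q (J c) j else 0)"
      by (intro sum.cong refl) (use inv[OF that] in auto)
    finally show ?thesis using that by simp
  qed
  \<comment> \<open>The column \<open>M\<close> is the inverse of \<open>A\<close> applied to the new column, so \<open>A * M\<close> restores that column.\<close>
  have "?L * ?U = four_block_mat A (A * M) p (p * M + \<rho>)"
    by (subst mult_four_block_mat[OF A _ c(1,2) _ c(3)])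
      (use A c in auto)
  also have "\<dots> = minor_mat Q (Suc k) (J(k := i)) (I(k := j))"
  proof (rule eq_matI)
    fix x y assume "x < dim_row (minor_mat Q (Suc k) (J(k := i)) (I(k := j)))"
      "y < dim_col (minor_mat Q (Suc k) (J(k := i)) (I(k := j)))"
    then have xy: "x < Suc k" "y < Suc k" by (auto simp: minor_mat_def)
    have AM: "(A * M) $$ (x, 0) = Q (J x) j" if "x < k"
      using Am[OF that] that by (simp add: A_def minor_mat_def M_def scalar_prod_def atLeast0LessThan)
    have pM: "(p * M) $$ (0, 0) + \<rho> $$ (0, 0) = Q i j"
      by (simp add: p_def \<rho>_def M_def m_def scalar_prod_def cross_residual_def atLeast0LessThan)
    show "four_block_mat A (A * M) p (p * M + \<rho>) $$ (x, y)
        = minor_mat Q (Suc k) (J(k := i)) (I(k := j)) $$ (x, y)"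
      using xy A c AM pM by (auto simp: less_Suc_eq minor_mat_def A_def p_def)
  qed (use A c in \<open>auto simp: minor_mat_def\<close>)
  finally have "det (minor_mat Q (Suc k) (J(k := i)) (I(k := j))) = det ?L * det ?U"
    using A c by (subst det_mult[symmetric, of _ "Suc k"]) auto
  also have "det ?L = det A * det \<rho>"
    by (rule det_four_block_mat_upper_right_zero[OF A refl c(1,2)])
  also have "det \<rho> = cross_residual Q k J I B i j"
    by (subst det_single[OF c(2)]) (simp add: \<rho>_def)
  also have "det ?U = det (1\<^sub>m k) * det (1\<^sub>m 1)"
    by (rule det_four_block_mat_lower_left_zero[OF _ c(3) refl]) auto
  finally show ?thesis by (simp only: det_one mult_1_right A_def)
qed


section \<open>Large minors or closeness to low rank\<close>

definition tuples :: "nat \<Rightarrow> nat \<Rightarrow> (nat \<Rightarrow> nat) set" where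
  "tuples k n = {..<k} \<rightarrow>\<^sub>E {..<n}"

lemma finite_tuples [simp]: "finite (tuples k n)" by (auto simp: tuples_def intro!: finite_PiE)

lemma card_tuples: "card (tuples k n) = n ^ k" by (simp add: tuples_def card_PiE)

text \<open>
  Both sides are multiplied by \<open>n\<close> so that no truncated exponent \<open>k - 1\<close> appears.
\<close>

lemma card_tuples_hitting:
  assumes Z: "Z \<subseteq> {..<n}"
  shows "card {J \<in> tuples k n. \<exists>a<k. J a \<in> Z} * n \<le> k * card Z * n ^ k"
proof -
  have finZ: "finite Z" using Z finite_subset by blast
  have one: "card {J \<in> tuples k n. J a \<in> Z} * n \<le> card Z * n ^ k" if a: "a < k" for a
  proof -
    have "{J \<in> tuples k n. J a \<in> Z} \<subseteq> (\<Pi>\<^sub>E b\<in>{..<k}. if b = a then Z else {..<n})"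
      by (auto simp: tuples_def PiE_iff extensional_def)
    then have "card {J \<in> tuples k n. J a \<in> Z} \<le> card (\<Pi>\<^sub>E b\<in>{..<k}. if b = a then Z else {..<n})"
      using finZ by (intro card_mono finite_PiE) auto
    also have "\<dots> = (\<Prod>b<k. card (if b = a then Z else {..<n}))" by (simp add: card_PiE)
    also have "\<dots> = card Z * (\<Prod>b\<in>{..<k} - {a}. card (if b = a then Z else {..<n}))"
      using a by (subst prod.remove[of _ a]) auto
    also have "(\<Prod>b\<in>{..<k} - {a}. card (if b = a then Z else {..<n})) = (\<Prod>b\<in>{..<k} - {a}. n)"
      by (intro prod.cong) auto
    also have "\<dots> = n ^ (k - 1)" using a by simp
    finally have "card {J \<in> tuples k n. J a \<in> Z} * n \<le> card Z * n ^ (k - 1) * n" by (rule mult_right_mono) simp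
    also have "\<dots> = card Z * n ^ k" using a by (cases k) auto
    finally show ?thesis .
  qed
  have "{J \<in> tuples k n. \<exists>a<k. J a \<in> Z} = (\<Union>a<k. {J \<in> tuples k n. J a \<in> Z})" by auto
  then have "card {J \<in> tuples k n. \<exists>a<k. J a \<in> Z} \<le> (\<Sum>a<k. card {J \<in> tuples k n. J a \<in> Z})"
    using card_UN_le[of "{..<k}" "\<lambda>a. {J \<in> tuples k n. J a \<in> Z}"] by simp
  then have "card {J \<in> tuples k n. \<exists>a<k. J a \<in> Z} * n \<le> (\<Sum>a<k. card {J \<in> tuples k n. J a \<in> Z} * n)"
    by (simp add: sum_distrib_right[symmetric])
  also have "\<dots> \<le> (\<Sum>a<k. card Z * n ^ k)" by (intro sum_mono one) auto
  finally show ?thesis by simp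
qed

context subfield_embedding
begin

definition large_minors :: "(nat \<Rightarrow> nat \<Rightarrow> 'a) \<Rightarrow> nat \<Rightarrow> nat \<Rightarrow> real \<Rightarrow> ((nat \<Rightarrow> nat) \<times> (nat \<Rightarrow> nat)) set" where
  "large_minors Q n k \<delta> = {(J, I) \<in> tuples k n \<times> tuples k n. mag (det (minor_mat Q k J I)) \<ge> \<delta>}"

text \<open>
  Closeness in the entrywise 1-norm to a symmetric matrix of rank at most \<open>k\<close>, which is given in the
  factorised form \<open>U N U\<^sup>T\<close> with an inner \<open>k \<times> k\<close> matrix \<open>N\<close>.
\<close>

definition near_low_rank :: "(nat \<Rightarrow> nat \<Rightarrow> 'a) \<Rightarrow> nat \<Rightarrow> nat \<Rightarrow> real \<Rightarrow> bool" where
  "near_low_rank Q n k \<epsilon> \<longleftrightarrow> (\<exists>U N. (\<forall>b c. N b c = N c b) \<and>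
    (\<Sum>i<n. \<Sum>j<n. mag (Q i j - (\<Sum>b<k. \<Sum>c<k. U i b * N b c * U j c))) \<le> \<epsilon> * n ^ 2)"

lemma finite_large_minors [simp]: "finite (large_minors Q n k \<delta>)"
  unfolding large_minors_def by (rule finite_subset[of _ "tuples k n \<times> tuples k n"]) auto

text \<open>
  Cramer's rule: the entries of the adjugate are minors of a matrix with entries of absolute value at
  most 1.
\<close>

lemma minor_inverse:
  fixes Q :: "nat \<Rightarrow> nat \<Rightarrow> 'a"
  assumes Q: "\<And>a b. a < k \<Longrightarrow> b < k \<Longrightarrow> mag (Q (J a) (I b)) \<le> 1"
    and det: "mag (det (minor_mat Q k J I)) \<ge> \<delta>" and \<delta>: "\<delta> > 0"
  shows "\<exists>B. (\<forall>b<k. \<forall>c<k. mag (B b c) \<le> fact k / \<delta>) \<and>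
    (\<forall>a<k. \<forall>c<k. (\<Sum>b<k. Q (J a) (I b) * B b c) = (if a = c then 1 else 0))"
proof -
  define A where "A = minor_mat Q k J I"
  have A: "A \<in> carrier_mat k k" by (simp add: A_def minor_mat_def)
  have D: "mag (det A) \<ge> \<delta>" using det by (simp add: A_def)
  then have D0: "det A \<noteq> 0" using \<delta> by auto
  define B where "B b c = adj_mat A $$ (b, c) / det A" for b c
  have "mag (B b c) \<le> fact k / \<delta>" if bc: "b < k" "c < k" for b c
  proof -
    have "mag (adj_mat A $$ (b, c)) = mag (det (mat_delete A c b))"
    proof -
      have "mag ((- 1) ^ m) = 1" for m by (induction m) auto
      then show ?thesis using A bc by (simp add: adj_mat_def cofactor_def)
    qed
    also have "\<dots> \<le> fact (k - 1)"
      by (rule mag_det_le)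
        (use A bc Q in \<open>auto simp: mat_delete_def A_def minor_mat_def\<close>)
    also have "\<dots> \<le> fact k" by (intro fact_mono) auto
    finally show ?thesis unfolding B_def mag_divide using D \<delta> by (intro frac_le) auto
  qed
  moreover have "(\<Sum>b<k. Q (J a) (I b) * B b c) = (if a = c then 1 else 0)" if ac: "a < k" "c < k" for a c
  proof -
    have adj: "adj_mat A \<in> carrier_mat k k" by (rule adj_mat(1)[OF A])
    have "(\<Sum>b<k. Q (J a) (I b) * adj_mat A $$ (b, c)) = (A * adj_mat A) $$ (a, c)"
      using A adj ac by (simp add: scalar_prod_def atLeast0LessThan A_def minor_mat_def)
    also have "\<dots> = (if a = c then det A else 0)"
      unfolding adj_mat(2)[OF A] using ac by simp
    finally show ?thesis using D0
      unfolding B_def by (simp add: sum_divide_distrib[symmetric] split: if_splits)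
  qed
  ultimately show ?thesis by blast
qed

lemma mag_cross_residual_le:
  assumes Q: "\<And>i j. i < n \<Longrightarrow> j < n \<Longrightarrow> mag (Q i j) \<le> 1" and JI: "J \<in> tuples k n" "I \<in> tuples k n"
    and B: "\<And>b c. b < k \<Longrightarrow> c < k \<Longrightarrow> mag (B b c) \<le> \<beta>" and ij: "i < n" "j < n"
  shows "mag (cross_residual Q k J I B i j) \<le> 1 + real k ^ 2 * \<beta>"
proof -
  have mem: "J a < n" "I a < n" if "a < k" for a using JI that by (auto simp: tuples_def PiE_iff)
  have "mag (\<Sum>b<k. Q i (I b) * (\<Sum>a<k. B b a * Q (J a) j)) \<le> (\<Sum>b<k. \<Sum>a<k. \<beta>)"
  proof (rule order.trans[OF mag_sum], rule sum_mono)
    fix b assume b: "b \<in> {..<k}"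
    have "mag (\<Sum>a<k. B b a * Q (J a) j) \<le> (\<Sum>a<k. \<beta>)"
    proof (rule order.trans[OF mag_sum], rule sum_mono)
      fix a assume a: "a \<in> {..<k}"
      have "mag (B b a) * mag (Q (J a) j) \<le> \<beta> * 1"
        using a b mem ij by (intro mult_mono B Q) (auto intro: order.trans[OF mag_nonneg B])
      then show "mag (B b a * Q (J a) j) \<le> \<beta>" by simp
    qed
    moreover have "mag (Q i (I b)) \<le> 1" using b mem ij by (intro Q) auto
    ultimately have "mag (Q i (I b)) * mag (\<Sum>a<k. B b a * Q (J a) j) \<le> 1 * (\<Sum>a<k. \<beta>)"
      by (intro mult_mono) auto
    then show "mag (Q i (I b) * (\<Sum>a<k. B b a * Q (J a) j)) \<le> (\<Sum>a<k. \<beta>)" by simp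
  qed
  moreover have "mag (Q i j) \<le> 1" using Q ij by auto
  ultimately have "mag (cross_residual Q k J I B i j) \<le> 1 + (\<Sum>b<k. \<Sum>a<k. \<beta>)"
    unfolding cross_residual_def by (intro order.trans[OF mag_diff] add_mono)
  then show ?thesis by (simp add: power2_eq_square mult.assoc)
qed

text \<open>
  Let \<open>U\<close> consist of the columns \<open>I\<close> of \<open>Q\<close>.  The first prediction writes \<open>Q\<close> approximately as
  \<open>U B' Q\<^sub>J\<^sub>'\<close>, where \<open>Q\<^sub>J\<^sub>'\<close> are the rows \<open>J'\<close>.  By symmetry these rows are columns of \<open>Q\<close>, and the
  second prediction, which uses the same columns \<open>I\<close>, writes them approximately as combinations of the columns
  of \<open>U\<close>.  Together \<open>Q\<close> is approximately \<open>U N\<^sub>0 U\<^sup>T\<close>, and averaging \<open>N\<^sub>0\<close> with its transpose does not increase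
  the error, as \<open>Q\<close> is symmetric.  The second prediction has to be good only on the columns \<open>J'\<close>, but there
  on each of them.
\<close>

lemma near_low_rank_if_two_crosses:
  assumes sym: "\<And>i j. Q i j = Q j i" and Q: "\<And>i j. i < n \<Longrightarrow> j < n \<Longrightarrow> mag (Q i j) \<le> 1"
    and T: "J' \<in> tuples k n" "I \<in> tuples k n"
    and B': "\<And>b c. b < k \<Longrightarrow> c < k \<Longrightarrow> mag (B' b c) \<le> \<beta>"
    and small': "(\<Sum>i<n. \<Sum>j<n. mag (cross_residual Q k J' I B' i j)) \<le> \<epsilon>1 * n ^ 2"
    and cols: "\<And>a. a < k \<Longrightarrow> (\<Sum>i<n. mag (cross_residual Q k J I B i (J' a))) \<le> \<epsilon>2 * n"
  shows "near_low_rank Q n k (\<epsilon>1 + real k ^ 2 * \<beta> * \<epsilon>2)"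
proof -
  let ?\<rho> = "cross_residual Q k J I B" and ?\<rho>' = "cross_residual Q k J' I B'"
  have mem: "J' a < n" "I a < n" if "a < k" for a using T that by (auto simp: tuples_def PiE_iff)
  define U where "U i b = Q i (I b)" for i b
  define M where "M c y = (\<Sum>a<k. B c a * Q (J a) y)" for c y
  define N0 where "N0 b c = (\<Sum>a<k. B' b a * M c (J' a))" for b c
  define H where "H i j = (\<Sum>b<k. \<Sum>c<k. U i b * N0 b c * U j c)" for i j
  let ?F = "\<Sum>j<n. \<Sum>b<k. \<Sum>a<k. \<beta> * mag (?\<rho> j (J' a))"
  let ?E = "\<Sum>i<n. \<Sum>j<n. mag (Q i j - H i j)"
  have res: "Q i j - H i j = ?\<rho>' i j + (\<Sum>b<k. \<Sum>a<k. U i b * B' b a * ?\<rho> j (J' a))" for i j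
  proof -
    have "(\<Sum>b<k. \<Sum>a<k. U i b * B' b a * ?\<rho> j (J' a))
        = (\<Sum>b<k. \<Sum>a<k. U i b * B' b a * Q (J' a) j - (\<Sum>c<k. U i b * (B' b a * M c (J' a)) * U j c))"
      unfolding cross_residual_def U_def M_def
      by (intro sum.cong refl) (simp add: sum_distrib_left algebra_simps sym[of j])
    also have "\<dots> = (\<Sum>b<k. \<Sum>a<k. U i b * B' b a * Q (J' a) j)
        - (\<Sum>b<k. \<Sum>a<k. \<Sum>c<k. U i b * (B' b a * M c (J' a)) * U j c)"
      by (simp add: sum_subtractf)
    also have "(\<Sum>b<k. \<Sum>a<k. \<Sum>c<k. U i b * (B' b a * M c (J' a)) * U j c) = H i j"
      unfolding H_def N0_def sum_distrib_left sum_distrib_right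
      by (rule sum.cong[OF refl], rule sum.swap)
    finally show ?thesis unfolding cross_residual_def U_def by (simp add: sum_distrib_left mult.assoc)
  qed
  have Hbound: "?E \<le> (\<epsilon>1 + real k ^ 2 * \<beta> * \<epsilon>2) * n ^ 2"
  proof -
    have "?F
        = (\<Sum>b<k. \<Sum>a<k. \<beta> * (\<Sum>j<n. mag (?\<rho> j (J' a))))"
    proof -
      have "?F = (\<Sum>b<k. \<Sum>j<n. \<Sum>a<k. \<beta> * mag (?\<rho> j (J' a)))"
        by (rule sum.swap)
      also have "\<dots> = (\<Sum>b<k. \<Sum>a<k. \<Sum>j<n. \<beta> * mag (?\<rho> j (J' a)))"
        by (rule sum.cong[OF refl], rule sum.swap)
      finally show ?thesis by (simp only: sum_distrib_left)
    qed
    also have "\<dots> \<le> (\<Sum>b<k. \<Sum>a<k. \<beta> * (\<epsilon>2 * n))"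
    proof (intro sum_mono mult_left_mono)
      fix a b assume ab: "a \<in> {..<k}" "b \<in> {..<k}"
      then show "(\<Sum>j<n. mag (?\<rho> j (J' a))) \<le> \<epsilon>2 * n" using cols by auto
      show "0 \<le> \<beta>" using ab order.trans[OF mag_nonneg B'[of a b]] by auto
    qed
    also have "(\<Sum>b<k. \<Sum>a<k. \<beta> * (\<epsilon>2 * n)) = real k ^ 2 * \<beta> * \<epsilon>2 * n"
      by (simp add: power2_eq_square)
    finally have S: "?F \<le> real k ^ 2 * \<beta> * \<epsilon>2 * n" .
    have "?E
        \<le> (\<Sum>i<n. \<Sum>j<n. mag (?\<rho>' i j) + (\<Sum>b<k. \<Sum>a<k. \<beta> * mag (?\<rho> j (J' a))))"
    proof (intro sum_mono)
      fix i j assume ij: "i \<in> {..<n}" "j \<in> {..<n}"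
      have "mag (\<Sum>b<k. \<Sum>a<k. U i b * B' b a * ?\<rho> j (J' a)) \<le> (\<Sum>b<k. \<Sum>a<k. \<beta> * mag (?\<rho> j (J' a)))"
      proof (rule order.trans[OF mag_sum], rule sum_mono, rule order.trans[OF mag_sum], rule sum_mono)
        fix b a assume ba: "b \<in> {..<k}" "a \<in> {..<k}"
        have "mag (U i b) * mag (B' b a) \<le> 1 * \<beta>"
          unfolding U_def using ba ij mem by (intro mult_mono Q B') auto
        then show "mag (U i b * B' b a * ?\<rho> j (J' a)) \<le> \<beta> * mag (?\<rho> j (J' a))"
          by (simp add: mult_right_mono)
      qed
      then show "mag (Q i j - H i j) \<le> mag (?\<rho>' i j) + (\<Sum>b<k. \<Sum>a<k. \<beta> * mag (?\<rho> j (J' a)))"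
        unfolding res by (intro order.trans[OF mag_add] add_mono) auto
    qed
    also have "\<dots> = (\<Sum>i<n. \<Sum>j<n. mag (?\<rho>' i j))
        + real n * ?F"
      by (simp add: sum.distrib)
    also have "\<dots> \<le> \<epsilon>1 * n ^ 2 + real n * (real k ^ 2 * \<beta> * \<epsilon>2 * n)"
      using small' S by (intro add_mono mult_left_mono) auto
    finally show ?thesis by (simp add: algebra_simps power2_eq_square)
  qed
  define N where "N b c = (N0 b c + N0 c b) / 2" for b c
  have half: "(\<Sum>b<k. \<Sum>c<k. U i b * N b c * U j c) = (H i j + H j i) / 2" for i j
  proof -
    have "H j i = (\<Sum>c<k. \<Sum>b<k. U j c * N0 c b * U i b)" unfolding H_def ..
    also have "\<dots> = (\<Sum>b<k. \<Sum>c<k. U i b * N0 c b * U j c)" by (subst sum.swap) (simp add: mult_ac)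
    finally have "H i j + H j i = (\<Sum>b<k. \<Sum>c<k. U i b * N0 b c * U j c + U i b * N0 c b * U j c)"
      unfolding H_def by (simp add: sum.distrib)
    then show ?thesis unfolding N_def sum_divide_distrib
      by (simp add: sum_divide_distrib algebra_simps add_divide_distrib)
  qed
  have "(\<Sum>i<n. \<Sum>j<n. mag (Q i j - (\<Sum>b<k. \<Sum>c<k. U i b * N b c * U j c)))
      \<le> (\<Sum>i<n. \<Sum>j<n. (mag (Q i j - H i j) + mag (Q j i - H j i)) / 2)"
  proof (intro sum_mono)
    fix i j
    have eq: "Q i j - (H i j + H j i) / 2 = ((Q i j - H i j) + (Q j i - H j i)) / 2"
      using sym[of i j] by (simp add: field_simps)
    show "mag (Q i j - (\<Sum>b<k. \<Sum>c<k. U i b * N b c * U j c)) \<le> (mag (Q i j - H i j) + mag (Q j i - H j i)) / 2"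
      unfolding half eq mag_divide mag_two by (rule divide_right_mono[OF mag_add]) simp
  qed
  also have "\<dots> = (?E + (\<Sum>i<n. \<Sum>j<n. mag (Q j i - H j i))) / 2"
    by (simp only: sum.distrib sum_divide_distrib[symmetric])
  also have "(\<Sum>i<n. \<Sum>j<n. mag (Q j i - H j i)) = ?E"
    by (rule sum.swap)
  finally have "(\<Sum>i<n. \<Sum>j<n. mag (Q i j - (\<Sum>b<k. \<Sum>c<k. U i b * N b c * U j c)))
      \<le> (\<epsilon>1 + real k ^ 2 * \<beta> * \<epsilon>2) * n ^ 2" using Hbound by simp
  moreover have "\<forall>b c. N b c = N c b" by (simp add: N_def add.commute)
  ultimately show ?thesis unfolding near_low_rank_def by blast
qed


lemma near_low_rank_mono: "near_low_rank Q n k \<epsilon> \<Longrightarrow> \<epsilon> \<le> \<epsilon>' \<Longrightarrow> near_low_rank Q n k \<epsilon>'"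
  unfolding near_low_rank_def by (meson mult_right_mono of_nat_0_le_iff order.trans)

text \<open>
  Call a large minor of size \<open>k\<close> good if its residuals have average size below \<open>\<epsilon>1\<close>.  If the large minors
  that are not good number at least half of the assumed lower bound, each of them has a positive
  proportion of large residuals, and bordering gives large minors of size \<open>k + 1\<close>.  Otherwise some column tuple \<open>I\<close> occurs in good minors with a
  positive proportion of all row tuples.  Fix one of them, \<open>J\<close>.  Few columns have a residual of average
  size above \<open>\<epsilon>2\<close> with respect to \<open>J\<close>, because \<open>\<epsilon>1\<close> is much smaller than \<open>\<epsilon>2\<close>, so another row tuple \<open>J'\<close> of a
  good minor avoids all of these columns.
\<close>

lemma extend_large_minors:
  fixes c \<delta> \<epsilon> :: real and k :: nat
  assumes c: "c > 0" and \<delta>: "\<delta> > 0" and \<epsilon>: "\<epsilon> > 0"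
  shows "\<exists>c'>0. \<exists>\<delta>'>0. \<forall>n\<ge>1. \<forall>Q.
    (\<forall>i j. Q i j = Q j i) \<and> (\<forall>i<n. \<forall>j<n. mag (Q i j) \<le> 1) \<and> real (card (large_minors Q n k \<delta>)) \<ge> c * real n ^ (2 * k)
    \<longrightarrow> near_low_rank Q n k \<epsilon> \<or> real (card (large_minors Q n (Suc k) \<delta>')) \<ge> c' * real n ^ (2 * Suc k)"
proof -
  let ?D = "\<lambda>Q J I i j. mag (det (minor_mat Q (Suc k) (J(k := i)) (I(k := j))))"
  define \<beta> where "\<beta> = fact k / \<delta>"
  define P where "P = 1 + real k ^ 2 * \<beta>"
  define \<epsilon>2 where "\<epsilon>2 = \<epsilon> / (2 * P)"
  define \<epsilon>1 where "\<epsilon>1 = min (\<epsilon> / 2) (c * \<epsilon>2 / (2 * (k + 1)))"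
  define c' where "c' = c * \<epsilon>1 / (4 * P)"
  define \<delta>' where "\<delta>' = \<delta> * (\<epsilon>1 / 2)"
  have \<beta>: "\<beta> > 0" unfolding \<beta>_def using \<delta> by simp
  have P: "P > 0" unfolding P_def using \<beta> by (intro add_pos_nonneg) auto
  have \<epsilon>2: "\<epsilon>2 > 0" unfolding \<epsilon>2_def using \<epsilon> P by simp
  have \<epsilon>1: "\<epsilon>1 > 0" unfolding \<epsilon>1_def using \<epsilon> \<epsilon>2 c by simp
  have total: "\<epsilon>1 + real k ^ 2 * \<beta> * \<epsilon>2 \<le> \<epsilon>"
  proof -
    have "real k ^ 2 * \<beta> * \<epsilon>2 \<le> P * \<epsilon>2" unfolding P_def using \<epsilon>2 by (intro mult_right_mono) auto
    also have "\<dots> = \<epsilon> / 2" unfolding \<epsilon>2_def using P by simp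
    finally show ?thesis unfolding \<epsilon>1_def by linarith
  qed
  have "near_low_rank Q n k \<epsilon> \<or> real (card (large_minors Q n (Suc k) \<delta>')) \<ge> c' * real n ^ (2 * Suc k)"
    if n: "n \<ge> 1" and sym: "\<forall>i j. Q i j = Q j i" and Q: "\<forall>i<n. \<forall>j<n. mag (Q i j) \<le> 1"
      and many: "real (card (large_minors Q n k \<delta>)) \<ge> c * real n ^ (2 * k)" for n Q
  proof -
    define G where "G = large_minors Q n k \<delta>"
    have finG: "finite G" by (simp add: G_def)
    define Bf where "Bf J I = (SOME B. (\<forall>b<k. \<forall>c<k. mag (B b c) \<le> \<beta>) \<and>
      (\<forall>a<k. \<forall>c<k. (\<Sum>b<k. Q (J a) (I b) * B b c) = (if a = c then 1 else 0)))" for J I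
    have GT: "J \<in> tuples k n" "I \<in> tuples k n" "mag (det (minor_mat Q k J I)) \<ge> \<delta>" if "(J, I) \<in> G" for J I
      using that by (auto simp: G_def large_minors_def)
    have Bf: "(\<forall>b<k. \<forall>c<k. mag (Bf J I b c) \<le> \<beta>) \<and>
      (\<forall>a<k. \<forall>c<k. (\<Sum>b<k. Q (J a) (I b) * Bf J I b c) = (if a = c then 1 else 0))" if "(J, I) \<in> G" for J I
    proof -
      have "\<exists>B. (\<forall>b<k. \<forall>c<k. mag (B b c) \<le> \<beta>) \<and>
          (\<forall>a<k. \<forall>c<k. (\<Sum>b<k. Q (J a) (I b) * B b c) = (if a = c then 1 else 0))"
        unfolding \<beta>_def
        by (rule minor_inverse) (use GT[OF that] Q \<delta> in \<open>auto simp: tuples_def PiE_iff\<close>)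
      from someI_ex[OF this] show ?thesis unfolding Bf_def .
    qed
    define \<rho> where "\<rho> J I = cross_residual Q k J I (Bf J I)" for J I
    have \<rho>P: "mag (\<rho> J I i j) \<le> P" if "(J, I) \<in> G" "i < n" "j < n" for J I i j
      unfolding \<rho>_def P_def
      by (rule mag_cross_residual_le) (use Q GT[OF that(1)] Bf[OF that(1)] that in auto)
    define Sm where "Sm = {p \<in> G. (\<Sum>i<n. \<Sum>j<n. mag (\<rho> (fst p) (snd p) i j)) < \<epsilon>1 * real n ^ 2}"
    define Lg where "Lg = G - Sm"
    have cardG: "card G = card Sm + card Lg"
      unfolding Lg_def using finG by (subst card_Diff_subset) (auto simp: Sm_def card_mono)
    show ?thesis
    proof (cases "real (card Lg) \<ge> c / 2 * real n ^ (2 * k)")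
      case True
      \<comment> \<open>The entries with large residual, by which the minor \<open>p\<close> is bordered.\<close>
      define E where "E p = {(i, j) \<in> {..<n} \<times> {..<n}. mag (\<rho> (fst p) (snd p) i j) \<ge> \<epsilon>1 / 2}" for p
      have finE: "finite (E p)" for p
        unfolding E_def by (rule finite_subset[of _ "{..<n} \<times> {..<n}"]) auto
      have cardE: "real (card (E p)) \<ge> \<epsilon>1 / (2 * P) * real n ^ 2" if p: "p \<in> Lg" for p
      proof -
        obtain J I where JI: "p = (J, I)" by (cases p)
        with p have JIG: "(J, I) \<in> G" by (auto simp: Lg_def)
        have "\<epsilon>1 * real n ^ 2 \<le> (\<Sum>i<n. \<Sum>j<n. mag (\<rho> J I i j))"
          using p JI by (auto simp: Lg_def Sm_def)
        also have "\<dots> = (\<Sum>x\<in>{..<n} \<times> {..<n}. mag (\<rho> J I (fst x) (snd x)))"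
          by (simp add: sum.cartesian_product case_prod_unfold)
        also have "\<dots> \<le> (\<Sum>x\<in>{..<n} \<times> {..<n}. (if x \<in> E p then P else 0) + \<epsilon>1 / 2)"
        proof (rule sum_mono)
          fix x assume x: "x \<in> {..<n} \<times> {..<n}"
          show "mag (\<rho> J I (fst x) (snd x)) \<le> (if x \<in> E p then P else 0) + \<epsilon>1 / 2"
          proof (cases "x \<in> E p")
            case True
            then show ?thesis using \<rho>P[OF JIG, of "fst x" "snd x"] x \<epsilon>1 by auto
          next
            case False
            then show ?thesis using x unfolding E_def JI by (auto simp: case_prod_unfold)
          qed
        qed
        also have "\<dots> = card (E p) * P + real n ^ 2 * (\<epsilon>1 / 2)"
        proof -
          have "({..<n} \<times> {..<n}) \<inter> E p = E p" by (auto simp: E_def)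
          then show ?thesis by (simp add: sum.distrib sum.If_cases power2_eq_square)
        qed
        finally have "\<epsilon>1 / 2 * real n ^ 2 \<le> card (E p) * P" by (simp add: field_simps)
        then show ?thesis using P by (simp add: field_simps)
      qed
      define f where "f = (\<lambda>(p, x). ((fst p)(k := fst x), (snd p)(k := snd x)) :: (nat \<Rightarrow> nat) \<times> (nat \<Rightarrow> nat))"
      \<comment> \<open>Tuples are undefined at index \<open>k\<close>, so the bordered tuple determines the old one.\<close>
      have upd_inj: "J = J' \<and> i = i'" if "J(k := i) = J'(k := i')" "J \<in> tuples k n" "J' \<in> tuples k n"
        for J J' :: "nat \<Rightarrow> nat" and i i'
      proof -
        have "J x = J' x" for x
        proof (cases "x = k")
          case True
          then show ?thesis using that(2,3) by (auto simp: tuples_def PiE_iff extensional_def)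
        next
          case False
          then show ?thesis using fun_cong[OF that(1), of x] by simp
        qed
        moreover have "i = i'" using fun_cong[OF that(1), of k] by simp
        ultimately show ?thesis by auto
      qed
      have inj: "inj_on f (Sigma Lg E)"
      proof (rule inj_onI)
        fix q q' assume q: "q \<in> Sigma Lg E" "q' \<in> Sigma Lg E" and eq: "f q = f q'"
        obtain J I x J' I' x' where [simp]: "q = ((J, I), x)" "q' = ((J', I'), x')"
          by (metis surj_pair)
        have "(J, I) \<in> G" "(J', I') \<in> G" using q by (auto simp: Lg_def)
        note T = GT[OF this(1)] GT[OF this(2)]
        have e: "J(k := fst x) = J'(k := fst x')" "I(k := snd x) = I'(k := snd x')"
          using eq by (auto simp: f_def)
        show "q = q'"
          using upd_inj[OF e(1)] upd_inj[OF e(2)] T by (auto intro: prod_eqI)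
      qed
      have img: "f ` Sigma Lg E \<subseteq> large_minors Q n (Suc k) \<delta>'"
      proof (rule image_subsetI)
        fix q assume q: "q \<in> Sigma Lg E"
        obtain J I i j where [simp]: "q = ((J, I), (i, j))" by (metis surj_pair)
        have JI: "(J, I) \<in> G" using q by (auto simp: Lg_def)
        have ij: "i < n" "j < n" "mag (\<rho> J I i j) \<ge> \<epsilon>1 / 2" using q by (auto simp: E_def)
        have "?D Q J I i j = mag (det (minor_mat Q k J I)) * mag (\<rho> J I i j)"
          unfolding \<rho>_def using det_bordered[of k Q J I "Bf J I" i j] Bf[OF JI] by simp
        also have "\<dots> \<ge> \<delta>'"
          unfolding \<delta>'_def using GT(3)[OF JI] ij \<delta> \<epsilon>1 by (intro mult_mono) auto
        finally have "\<delta>' \<le> ?D Q J I i j" .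
        moreover have "J(k := i) \<in> tuples (Suc k) n" "I(k := j) \<in> tuples (Suc k) n"
          using GT[OF JI] ij by (auto simp: tuples_def PiE_iff extensional_def)
        ultimately show "f q \<in> large_minors Q n (Suc k) \<delta>'"
          by (auto simp: f_def large_minors_def)
      qed
      have "c' * real n ^ (2 * Suc k) = c / 2 * real n ^ (2 * k) * (\<epsilon>1 / (2 * P) * real n ^ 2)"
        unfolding c'_def by (simp add: power2_eq_square)
      also have "\<dots> \<le> real (card Lg) * (\<epsilon>1 / (2 * P) * real n ^ 2)"
        using True \<epsilon>1 P by (intro mult_right_mono) auto
      also have "\<dots> = (\<Sum>p\<in>Lg. \<epsilon>1 / (2 * P) * real n ^ 2)" by simp
      also have "\<dots> \<le> (\<Sum>p\<in>Lg. real (card (E p)))" by (rule sum_mono) (rule cardE)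
      also have "\<dots> = real (card (Sigma Lg E))"
        using finG finE by (subst card_SigmaI) (auto simp: Lg_def)
      also have "\<dots> \<le> real (card (large_minors Q n (Suc k) \<delta>'))"
        using card_inj_on_le[OF inj img] by simp
      finally show ?thesis by blast
    next
      case False
      then have cardSm: "real (card Sm) \<ge> c / 2 * real n ^ (2 * k)"
        using many cardG unfolding G_def[symmetric] by (simp add: field_simps)
      define JJ where "JJ I = {J \<in> tuples k n. (J, I) \<in> Sm}" for I
      have finJJ: "finite (JJ I)" for I by (simp add: JJ_def)
      have SmG: "Sm \<subseteq> G" by (auto simp: Sm_def)
      have "Sm \<subseteq> (\<lambda>(I, J). (J, I)) ` Sigma (tuples k n) JJ"
      proof
        fix p assume p: "p \<in> Sm"
        then have "(snd p, fst p) \<in> Sigma (tuples k n) JJ"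
          using SmG GT[of "fst p" "snd p"] by (auto simp: JJ_def)
        then show "p \<in> (\<lambda>(I, J). (J, I)) ` Sigma (tuples k n) JJ" by (force simp: image_iff)
      qed
      then have "card Sm \<le> card (Sigma (tuples k n) JJ)"
        by (meson card_image_le card_mono finJJ finite_SigmaI finite_imageI finite_tuples order.trans)
      also have "\<dots> = (\<Sum>I\<in>tuples k n. card (JJ I))" by (rule card_SigmaI) (auto simp: finJJ)
      finally have Smsum: "real (card Sm) \<le> (\<Sum>I\<in>tuples k n. real (card (JJ I)))"
        unfolding of_nat_sum[symmetric] by (simp only: of_nat_le_iff)
      have nk: "real n ^ k > 0" using n by simp
      have "\<exists>I\<in>tuples k n. real (card (JJ I)) \<ge> c / 2 * real n ^ k"
      proof (rule ccontr)
        assume "\<not> ?thesis"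
        then have less: "real (card (JJ I)) < c / 2 * real n ^ k" if "I \<in> tuples k n" for I
          using that by force
        have "card (tuples k n) \<noteq> 0" unfolding card_tuples using n by simp
        then have "tuples k n \<noteq> {}" by auto
        then have "(\<Sum>I\<in>tuples k n. real (card (JJ I))) < (\<Sum>I\<in>tuples k n. c / 2 * real n ^ k)"
          by (intro sum_strict_mono less) auto
        also have "\<dots> = c / 2 * real n ^ (2 * k)" by (simp add: card_tuples mult_2 power_add)
        finally show False using Smsum cardSm by simp
      qed
      then obtain I where I: "I \<in> tuples k n" "real (card (JJ I)) \<ge> c / 2 * real n ^ k" by blast
      have "c / 2 * real n ^ k > 0" using nk c by simp
      then have "card (JJ I) \<noteq> 0" using I(2) by linarith
      then obtain J where J: "J \<in> JJ I" by fastforce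
      then have JI: "(J, I) \<in> Sm" by (simp add: JJ_def)
      define Rc where "Rc j = (\<Sum>i<n. mag (\<rho> J I i j))" for j
      define Bad where "Bad = {j\<in>{..<n}. Rc j > \<epsilon>2 * n}"
      have "card Bad * (\<epsilon>2 * n) = (\<Sum>j\<in>Bad. \<epsilon>2 * n)" by simp
      also have "\<dots> \<le> (\<Sum>j\<in>Bad. Rc j)" by (rule sum_mono) (simp add: Bad_def)
      also have "\<dots> \<le> (\<Sum>j<n. Rc j)"
        by (rule sum_mono2) (auto simp: Bad_def Rc_def intro: sum_nonneg)
      also have "\<dots> = (\<Sum>i<n. \<Sum>j<n. mag (\<rho> J I i j))" unfolding Rc_def by (rule sum.swap)
      also have "\<dots> \<le> \<epsilon>1 * real n ^ 2" using JI by (simp add: Sm_def)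
      finally have "card Bad * \<epsilon>2 * real n \<le> \<epsilon>1 * n * real n" by (simp add: power2_eq_square mult_ac)
      then have Bad: "card Bad * \<epsilon>2 \<le> \<epsilon>1 * n" using n by simp
      have "\<exists>J'\<in>JJ I. \<forall>a<k. J' a \<notin> Bad"
      proof (rule ccontr)
        assume "\<not> ?thesis"
        then have "JJ I \<subseteq> {J \<in> tuples k n. \<exists>a<k. J a \<in> Bad}" by (auto simp: JJ_def)
        then have "card (JJ I) \<le> card {J \<in> tuples k n. \<exists>a<k. J a \<in> Bad}" by (intro card_mono) auto
        then have "card (JJ I) * n \<le> card {J \<in> tuples k n. \<exists>a<k. J a \<in> Bad} * n" by (rule mult_le_mono1)
        also have "\<dots> \<le> k * card Bad * n ^ k" by (rule card_tuples_hitting) (auto simp: Bad_def)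
        finally have "real (card (JJ I) * n) \<le> real (k * card Bad * n ^ k)" by (simp only: of_nat_le_iff)
        then have *: "real (card (JJ I)) * n \<le> k * real (card Bad) * real n ^ k"
          by (simp only: of_nat_mult of_nat_power)
        let ?x = "\<epsilon>2 * (c / 2 * real n ^ k * n)"
        have "?x \<le> \<epsilon>2 * (real (card (JJ I)) * n)"
          using I(2) \<epsilon>2 by (intro mult_left_mono mult_right_mono) auto
        also have "\<dots> \<le> \<epsilon>2 * (k * real (card Bad) * real n ^ k)" using * \<epsilon>2 by (intro mult_left_mono) auto
        also have "\<dots> = k * real n ^ k * (card Bad * \<epsilon>2)" by simp
        also have "\<dots> \<le> k * real n ^ k * (\<epsilon>1 * n)" using Bad by (intro mult_left_mono) auto
        also have "\<dots> \<le> k * real n ^ k * (c * \<epsilon>2 / (2 * (k + 1)) * n)"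
          by (intro mult_left_mono mult_right_mono) (auto simp: \<epsilon>1_def)
        also have "\<dots> = ?x * (k / (k + 1))" by (simp add: field_simps)
        finally have "?x * 1 \<le> ?x * (k / (k + 1))" by simp
        moreover have "?x > 0" using \<epsilon>2 c nk n by simp
        ultimately have "1 \<le> real k / (k + 1)" by (simp only: mult_le_cancel_left_pos)
        then show False by (simp add: field_simps)
      qed
      then obtain J' where J': "(J', I) \<in> Sm" "\<And>a. a < k \<Longrightarrow> J' a \<notin> Bad" by (auto simp: JJ_def)
      have J'G: "(J', I) \<in> G" using J' SmG by auto
      have "near_low_rank Q n k (\<epsilon>1 + real k ^ 2 * \<beta> * \<epsilon>2)"
      proof (rule near_low_rank_if_two_crosses[where J' = J' and I = I and B' = "Bf J' I" and J = J and B = "Bf J I"])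
        show "J' \<in> tuples k n" by (rule GT[OF J'G])
        show "(\<Sum>i<n. \<Sum>j<n. mag (cross_residual Q k J' I (Bf J' I) i j)) \<le> \<epsilon>1 * real n ^ 2"
          using J'(1) by (simp add: Sm_def \<rho>_def)
        show "mag (Bf J' I b c) \<le> \<beta>" if "b < k" "c < k" for b c using Bf[OF J'G] that by blast
        fix a assume a: "a < k"
        then have "J' a < n" using GT(1)[OF J'G] by (auto simp: tuples_def PiE_iff)
        then have "Rc (J' a) \<le> \<epsilon>2 * n" using J'(2)[OF a] by (auto simp: Bad_def)
        then show "(\<Sum>i<n. mag (cross_residual Q k J I (Bf J I) i (J' a))) \<le> \<epsilon>2 * n"
          by (simp add: Rc_def \<rho>_def)
      qed (use sym Q I in auto)
      then show ?thesis using near_low_rank_mono[OF _ total] by blast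
    qed
  qed
  note main = this
  have pos: "c' > 0" "\<delta>' > 0" unfolding c'_def \<delta>'_def using c \<delta> \<epsilon>1 P by auto
  show ?thesis
    by (rule exI[of _ c'], rule conjI[OF pos(1)], rule exI[of _ \<delta>'], rule conjI[OF pos(2)],
        intro allI impI, elim conjE) (rule main; assumption)
qed

lemma near_low_rank_or_large_minors:
  assumes \<epsilon>: "\<epsilon> > 0"
  shows "\<exists>c>0. \<exists>\<delta>>0. \<forall>n\<ge>1. \<forall>Q.
    (\<forall>i j. Q i j = Q j i) \<and> (\<forall>i<n. \<forall>j<n. mag (Q i j) \<le> 1)
    \<longrightarrow> (\<exists>k<r. near_low_rank Q n k \<epsilon>) \<or> real (card (large_minors Q n r \<delta>)) \<ge> c * real n ^ (2 * r)"
proof (induction r)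
  case 0
  have "large_minors Q n 0 1 = {(\<lambda>_. undefined, \<lambda>_. undefined)}" for Q n
  proof -
    have "det (minor_mat Q 0 J I) = 1" for J I by (simp add: minor_mat_def)
    then show ?thesis by (auto simp: large_minors_def tuples_def)
  qed
  then show ?case
    by (intro exI[where x = "1 :: real"] conjI allI impI disjI2) simp_all
next
  case (Suc r)
  let ?H = "\<lambda>n Q. (\<forall>i j. Q i j = Q j i) \<and> (\<forall>i<n. \<forall>j<n. mag (Q i j) \<le> 1)"
  from Suc obtain c \<delta> where c: "c > 0" "\<delta> > 0" and IH: "\<forall>n\<ge>1. \<forall>Q. ?H n Q \<longrightarrow>
      (\<exists>k<r. near_low_rank Q n k \<epsilon>) \<or> real (card (large_minors Q n r \<delta>)) \<ge> c * real n ^ (2 * r)"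
    by (elim exE conjE) (rule that)
  from extend_large_minors[OF c \<epsilon>, of r] obtain c' \<delta>' where c': "c' > 0" "\<delta>' > 0"
    and step: "\<forall>n\<ge>1. \<forall>Q. (\<forall>i j. Q i j = Q j i) \<and> (\<forall>i<n. \<forall>j<n. mag (Q i j) \<le> 1) \<and>
      real (card (large_minors Q n r \<delta>)) \<ge> c * real n ^ (2 * r) \<longrightarrow>
      near_low_rank Q n r \<epsilon> \<or> real (card (large_minors Q n (Suc r) \<delta>')) \<ge> c' * real n ^ (2 * Suc r)"
    by (elim exE conjE) (rule that)
  have "(\<exists>k<Suc r. near_low_rank Q n k \<epsilon>) \<or> real (card (large_minors Q n (Suc r) \<delta>')) \<ge> c' * real n ^ (2 * Suc r)"
    if n: "n \<ge> 1" and H: "?H n Q" for n Q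
  proof -
    from IH n H have "(\<exists>k<r. near_low_rank Q n k \<epsilon>) \<or> real (card (large_minors Q n r \<delta>)) \<ge> c * real n ^ (2 * r)"
      by simp
    then show ?thesis
    proof
      assume "\<exists>k<r. near_low_rank Q n k \<epsilon>"
      then show ?thesis using less_Suc_eq by blast
    next
      assume "real (card (large_minors Q n r \<delta>)) \<ge> c * real n ^ (2 * r)"
      with step n H have "near_low_rank Q n r \<epsilon> \<or> real (card (large_minors Q n (Suc r) \<delta>')) \<ge> c' * real n ^ (2 * Suc r)"
        by simp
      then show ?thesis by auto
    qed
  qed
  note main = this
  show ?case
    by (rule exI[where x = c'], rule conjI[OF c'(1)], rule exI[where x = \<delta>'],
        rule conjI[OF c'(2)], intro allI impI) (rule main; assumption)
qed

end


section \<open>Disjoint nondegenerate blocks\<close>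

text \<open>
  Greedy choice: the indices used so far and those in \<open>Z\<close> number at most \<open>card Z + r * H\<close>, and the tuples that
  meet them are too few to exhaust \<open>\<T>\<close>.
\<close>

lemma exists_disjoint_tuples:
  assumes T: "\<T> \<subseteq> tuples r n" and Z: "Z \<subseteq> {..<n}"
    and large: "r * (card Z + r * H) * n ^ r < card \<T> * n"
  shows "\<exists>f. (\<forall>b<H. f b \<in> \<T> \<and> f b ` {..<r} \<inter> Z = {}) \<and> disjoint_family_on (\<lambda>b. f b ` {..<r}) {..<H}"
  using large
proof (induction H)
  case 0
  then show ?case by (auto simp: disjoint_family_on_def)
next
  case (Suc H)
  have "r * (card Z + r * H) * n ^ r \<le> r * (card Z + r * Suc H) * n ^ r" by (intro mult_le_mono) auto
  with Suc.prems have "r * (card Z + r * H) * n ^ r < card \<T> * n" by linarith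
  from Suc.IH[OF this] obtain f where f: "\<forall>b<H. f b \<in> \<T> \<and> f b ` {..<r} \<inter> Z = {}"
    and disj: "disjoint_family_on (\<lambda>b. f b ` {..<r}) {..<H}" by blast
  define Z' where "Z' = Z \<union> (\<Union>b<H. f b ` {..<r})"
  have Z'n: "Z' \<subseteq> {..<n}" unfolding Z'_def using Z f T by (fastforce simp: tuples_def PiE_iff)
  have "card (\<Union>b<H. f b ` {..<r}) \<le> (\<Sum>b<H. card (f b ` {..<r}))" by (rule card_UN_le) simp
  also have "\<dots> \<le> (\<Sum>b<H. r)" by (intro sum_mono) (metis card_image_le card_lessThan finite_lessThan)
  finally have "card (\<Union>b<H. f b ` {..<r}) \<le> r * H" by (simp add: mult.commute)
  then have cZ': "card Z' \<le> card Z + r * H"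
    unfolding Z'_def using card_Un_le[of Z "\<Union>b<H. f b ` {..<r}"] by linarith
  have "\<exists>J\<in>\<T>. \<forall>a<r. J a \<notin> Z'"
  proof (rule ccontr)
    assume "\<not> ?thesis"
    then have "\<T> \<subseteq> {J \<in> tuples r n. \<exists>a<r. J a \<in> Z'}" using T by blast
    then have "card \<T> \<le> card {J \<in> tuples r n. \<exists>a<r. J a \<in> Z'}" by (rule card_mono[rotated]) simp
    then have "card \<T> * n \<le> card {J \<in> tuples r n. \<exists>a<r. J a \<in> Z'} * n" by (rule mult_le_mono1)
    also have "\<dots> \<le> r * card Z' * n ^ r" by (rule card_tuples_hitting[OF Z'n])
    also have "\<dots> \<le> r * (card Z + r * Suc H) * n ^ r" using cZ' by (intro mult_le_mono) auto
    finally show False using Suc.prems by linarith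
  qed
  then obtain J where J: "J \<in> \<T>" "\<forall>a<r. J a \<notin> Z'" by blast
  have "disjoint_family_on (\<lambda>b. (f(H := J)) b ` {..<r}) {..<Suc H}"
    unfolding disjoint_family_on_def
  proof (intro ballI impI)
    fix x y assume xy: "x \<in> {..<Suc H}" "y \<in> {..<Suc H}" "x \<noteq> y"
    have new: "J ` {..<r} \<inter> f b ` {..<r} = {}" if "b < H" for b
      using J(2) that by (auto simp: Z'_def)
    show "(f(H := J)) x ` {..<r} \<inter> (f(H := J)) y ` {..<r} = {}"
    proof (cases "x = H \<or> y = H")
      case True
      then show ?thesis using xy new[of x] new[of y] by (auto simp: less_Suc_eq)
    next
      case False
      then have "x \<in> {..<H}" "y \<in> {..<H}" using xy by auto
      then show ?thesis using disj xy False unfolding disjoint_family_on_def by auto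
    qed
  qed
  moreover have "\<forall>b<Suc H. (f(H := J)) b \<in> \<T> \<and> (f(H := J)) b ` {..<r} \<inter> Z = {}"
    using f J by (auto simp: less_Suc_eq Z'_def)
  ultimately show ?case by blast
qed

text \<open>
  A quantitative form of the fact that a polynomial of degree at most \<open>d\<close> with \<open>d + 1\<close> zeros vanishes.
  Splitting off one node lowers the degree of the polynomial, and the differences of the values are divided by
  distances of integers, hence by at least 1.
\<close>

lemma poly_bound_from_nodes:
  fixes p :: "complex poly" and r :: nat and e :: real
  assumes "finite S" "S \<subseteq> {..r}" "card S = Suc d" "degree p \<le> d" "e \<ge> 0"
    "\<And>s. s \<in> S \<Longrightarrow> cmod (poly p (of_nat s)) \<le> e"
  shows "cmod (poly p \<i>) \<le> (2 * r + 3) ^ d * e"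
  using assms
proof (induction d arbitrary: S p e)
  case 0
  then obtain s where s: "s \<in> S" by (metis all_not_in_conv card.empty nat.distinct(1))
  obtain a where "p = [:a:]" using 0 by (metis degree_eq_zeroE le_zero_eq)
  then show ?case using 0(6)[OF s] by simp
next
  case (Suc d)
  then obtain a where a: "a \<in> S" by (metis all_not_in_conv card.empty nat.distinct(1))
  define q where "q = synthetic_div p (of_nat a)"
  have p: "p = [:- of_nat a, 1:] * q + [:poly p (of_nat a):]"
    unfolding q_def by (rule synthetic_div_correct'[symmetric])
  have ev: "poly p z = (z - of_nat a) * poly q z + poly p (of_nat a)" for z
    by (subst p) (simp add: algebra_simps)
  have "cmod (poly q (of_nat s)) \<le> 2 * e" if s: "s \<in> S - {a}" for s
  proof -
    have "1 \<le> cmod (of_nat s - of_nat a)"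
    proof -
      have "cmod (of_nat s - of_nat a) = \<bar>real s - real a\<bar>"
        by (metis norm_of_real of_real_diff of_real_of_nat_eq)
      moreover have "real s \<noteq> real a" using s by simp
      ultimately show ?thesis using s by (cases "s < a") (auto simp: of_nat_diff)
    qed
    from mult_right_mono[OF this, of "cmod (poly q (of_nat s))"]
    have "cmod (poly q (of_nat s)) \<le> cmod (of_nat s - of_nat a) * cmod (poly q (of_nat s))" by simp
    also have "\<dots> = cmod (poly p (of_nat s) - poly p (of_nat a))"
      unfolding ev[of "of_nat s"] by (simp add: norm_mult)
    also have "\<dots> \<le> e + e" using Suc.prems(6) s a by (intro order.trans[OF norm_triangle_ineq4] add_mono) auto
    finally show ?thesis by simp
  qed
  moreover have "degree q \<le> d" unfolding q_def using Suc.prems by (simp add: degree_synthetic_div)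
  moreover have "card (S - {a}) = Suc d" using Suc.prems a by simp
  ultimately have q: "cmod (poly q \<i>) \<le> (2 * r + 3) ^ d * (2 * e)"
    using Suc.prems by (intro Suc.IH[of "S - {a}"]) auto
  have "cmod (\<i> - of_nat a) \<le> 1 + r"
    using Suc.prems(2) a by (intro order.trans[OF norm_triangle_ineq4]) auto
  then have "cmod ((\<i> - of_nat a) * poly q \<i>) \<le> (1 + r) * ((2 * r + 3) ^ d * (2 * e))"
    unfolding norm_mult using q by (intro mult_mono) auto
  moreover have "cmod (poly p (of_nat a)) \<le> e" using Suc.prems a by simp
  ultimately have "cmod (poly p \<i>) \<le> (1 + r) * ((2 * r + 3) ^ d * (2 * e)) + e"
    unfolding ev[of \<i>] by (intro order.trans[OF norm_triangle_ineq] add_mono)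
  also have "e \<le> (2 * r + 3) ^ d * e"
    using Suc.prems(5) by (intro mult_le_cancel_right1[THEN iffD2]) (auto simp: one_le_power)
  then have "(1 + r) * ((2 * r + 3) ^ d * (2 * e)) + e \<le> (1 + r) * ((2 * r + 3) ^ d * (2 * e)) + (2 * r + 3) ^ d * e"
    by simp
  also have "\<dots> = (2 * r + 3) ^ Suc d * e" by (simp add: algebra_simps)
  finally show ?case .
qed

text \<open>
  With \<open>A\<close> and \<open>B\<close> the real and imaginary parts of the minor, \<open>det (A + z B)\<close> is a polynomial of degree
  at most \<open>r\<close> in \<open>z\<close>.  Since it is large at \<open>z = \<i>\<close>, it cannot be small at all of the \<open>r + 1\<close> real points
  \<open>0, \<dots>, r\<close>.
\<close>

lemma large_real_minor:
  fixes Q :: "nat \<Rightarrow> nat \<Rightarrow> complex"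
  assumes det: "cmod (det (minor_mat Q r J I)) \<ge> \<delta>" and \<delta>: "\<delta> > 0"
  shows "\<exists>t\<le>r. \<bar>det (minor_mat (\<lambda>i j. Re (Q i j) + real t * Im (Q i j)) r J I)\<bar> \<ge> \<delta> / (2 * (2 * real r + 3) ^ r)"
proof (rule ccontr)
  let ?D = "\<lambda>t::nat. det (minor_mat (\<lambda>i j. Re (Q i j) + real t * Im (Q i j)) r J I)"
  define C where "C = (2 * real r + 3) ^ r"
  have C: "C > 0" unfolding C_def by (intro zero_less_power) auto
  assume "\<not> ?thesis"
  then have small: "\<bar>?D t\<bar> \<le> \<delta> / (2 * C)"
    if "t \<le> r" for t using that unfolding C_def by (meson linear)
  define M where "M = mat r r (\<lambda>(a, b). [:complex_of_real (Re (Q (J a) (I b))), complex_of_real (Im (Q (J a) (I b))):])"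
  have M: "M \<in> carrier_mat r r" by (simp add: M_def)
  have ev: "poly (det M) z = det (map_mat (\<lambda>p. poly p z) M)" for z
  proof -
    interpret comm_ring_hom "\<lambda>p. poly p z" by unfold_locales simp_all
    show ?thesis by (rule hom_det[symmetric])
  qed
  have "degree (det M) \<le> 1 * r"
    by (rule degree_det_le[OF _ M]) (auto simp: M_def)
  moreover have "cmod (poly (det M) (of_nat t)) \<le> \<delta> / (2 * C)" if "t \<in> {..r}" for t
  proof -
    have "map_mat (\<lambda>p. poly p (of_nat t)) M
        = map_mat complex_of_real (minor_mat (\<lambda>i j. Re (Q i j) + real t * Im (Q i j)) r J I)"
      by (rule eq_matI) (auto simp: M_def minor_mat_def)
    then have "poly (det M) (of_nat t) = complex_of_real (?D t)"
      unfolding ev by (simp only: of_real_hom.hom_det)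
    then show ?thesis using small[of t] that by simp
  qed
  ultimately have "cmod (poly (det M) \<i>) \<le> (2 * r + 3) ^ r * (\<delta> / (2 * C))"
    using \<delta> C by (intro poly_bound_from_nodes[of "{..r}"]) auto
  also have "\<dots> = \<delta> / 2" using C unfolding C_def by (simp add: add.commute)
  also have "map_mat (\<lambda>p. poly p \<i>) M = minor_mat Q r J I"
    by (rule eq_matI) (auto simp: M_def minor_mat_def complex_eq_iff)
  then have "poly (det M) \<i> = det (minor_mat Q r J I)" unfolding ev by simp
  finally show False using det \<delta> by simp
qed

interpretation real_embedding: subfield_embedding complex_of_real
  by unfold_locales simp_all

text \<open>
  The vector \<open>s\<close> is recovered from its image by the inverse of the minor, whose entries are at most
  \<open>fact r / \<delta>\<close>.  The constant leaves room for the strict inequality \<open>r / (r + 1) < 1\<close>.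
\<close>

lemma nondegenerate_if_large_minor:
  fixes R :: "nat \<Rightarrow> nat \<Rightarrow> real"
  assumes sym: "\<And>i j. R i j = R j i" and R: "\<And>i j. i < n \<Longrightarrow> j < n \<Longrightarrow> \<bar>R i j\<bar> \<le> 1"
    and T: "J \<in> tuples r n" "I \<in> tuples r n" and det: "\<bar>det (minor_mat R r J I)\<bar> \<ge> \<delta>" and \<delta>: "\<delta> > 0"
  shows "card (J ` {..<r}) = r" "card (I ` {..<r}) = r"
    "nondegenerate (\<delta> / ((real r + 1) * fact r)) R (J ` {..<r}) (I ` {..<r})"
proof -
  have c: "minor_mat R r J I \<in> carrier_mat r r" by (simp add: minor_mat_def)
  have det0: "det (minor_mat R r J I) \<noteq> 0" using det \<delta> by auto
  have injJ: "inj_on J {..<r}"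
  proof (rule inj_onI, rule ccontr)
    fix a b assume ab: "a \<in> {..<r}" "b \<in> {..<r}" "J a = J b" "a \<noteq> b"
    have "det (minor_mat R r J I) = 0"
      by (rule det_identical_rows[OF c, of a b]) (use ab in \<open>auto simp: minor_mat_def\<close>)
    with det0 show False by simp
  qed
  have injI: "inj_on I {..<r}"
  proof (rule inj_onI, rule ccontr)
    fix a b assume ab: "a \<in> {..<r}" "b \<in> {..<r}" "I a = I b" "a \<noteq> b"
    have "det (minor_mat R r J I) = 0"
      by (rule det_identical_columns[OF c, of a b]) (use ab in \<open>auto simp: minor_mat_def\<close>)
    with det0 show False by simp
  qed
  show "card (J ` {..<r}) = r" "card (I ` {..<r}) = r" using injJ injI by (simp_all add: card_image)
  have mag: "real_embedding.mag x = \<bar>x\<bar>" for x by (simp add: real_embedding.mag_def)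
  obtain B where B: "\<And>b c. b < r \<Longrightarrow> c < r \<Longrightarrow> \<bar>B b c\<bar> \<le> fact r / \<delta>"
    and inv: "\<And>a c. a < r \<Longrightarrow> c < r \<Longrightarrow> (\<Sum>b<r. R (J a) (I b) * B b c) = (if a = c then 1 else 0)"
  proof -
    have "\<exists>B. (\<forall>b<r. \<forall>c<r. real_embedding.mag (B b c) \<le> fact r / \<delta>) \<and>
        (\<forall>a<r. \<forall>c<r. (\<Sum>b<r. R (J a) (I b) * B b c) = (if a = c then 1 else 0))"
      by (rule real_embedding.minor_inverse)
        (use T R det \<delta> in \<open>auto simp: mag tuples_def PiE_iff\<close>)
    then show ?thesis using that unfolding mag by blast
  qed
  let ?\<eta> = "\<delta> / ((real r + 1) * fact r)"
  have "\<bar>s j\<bar> < 1" if s: "\<forall>i\<in>I ` {..<r}. \<bar>\<Sum>j\<in>J ` {..<r}. s j * R i j\<bar> < ?\<eta>" and j: "j \<in> J ` {..<r}" for s j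
  proof -
    obtain c where c: "c < r" "j = J c" using j by auto
    define t where "t b = (\<Sum>a<r. s (J a) * R (J a) (I b))" for b
    have t: "\<bar>t b\<bar> \<le> ?\<eta>" if "b < r" for b
    proof -
      have "t b = (\<Sum>j\<in>J ` {..<r}. s j * R (I b) j)"
        unfolding t_def sum.reindex[OF injJ] by (simp add: sym[of "I b"])
      then show ?thesis using s that by (auto intro: less_imp_le)
    qed
    have "(\<Sum>b<r. t b * B b c) = (\<Sum>a<r. s (J a) * (\<Sum>b<r. R (J a) (I b) * B b c))"
      unfolding t_def sum_distrib_left sum_distrib_right by (subst sum.swap) (simp add: mult.assoc)
    also have "\<dots> = (\<Sum>a<r. if a = c then s (J a) else 0)"
      by (intro sum.cong refl) (use inv c in auto)
    also have "\<dots> = s j" using c by simp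
    finally have "\<bar>s j\<bar> \<le> (\<Sum>b<r. \<bar>t b * B b c\<bar>)" by (metis sum_abs)
    also have "\<dots> \<le> (\<Sum>b<r. ?\<eta> * (fact r / \<delta>))"
    proof (rule sum_mono)
      fix b assume b: "b \<in> {..<r}"
      show "\<bar>t b * B b c\<bar> \<le> ?\<eta> * (fact r / \<delta>)"
        unfolding abs_mult using t[of b] B[of b c] b c \<delta> by (intro mult_mono) auto
    qed
    also have "\<dots> = real r * ((\<delta> / \<delta>) * (fact r / fact r) / (real r + 1))" by (simp add: mult_ac)
    also have "\<dots> = real r / (real r + 1)" using \<delta> by simp
    also have "\<dots> < 1" by simp
    finally show ?thesis .
  qed
  then show "nondegenerate ?\<eta> R (J ` {..<r}) (I ` {..<r})" unfolding nondegenerate_def by blast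
qed

text \<open>
  By double counting a positive proportion of the row tuples has a positive proportion of partners.  The
  greedy choice is applied to these row tuples, and then to the partners of each chosen row tuple,
  avoiding all indices of the chosen row tuples.
\<close>

lemma many_nondegenerate_if_many_large_minors:
  fixes r :: nat and c \<delta> :: real
  assumes r: "r \<ge> 1" and c: "c > 0" and \<delta>: "\<delta> > 0"
  shows "\<exists>\<gamma>>0. \<exists>\<eta>>0. \<exists>n0. \<forall>n\<ge>n0. \<forall>R::nat \<Rightarrow> nat \<Rightarrow> real.
    (\<forall>i j. R i j = R j i) \<and> (\<forall>i<n. \<forall>j<n. \<bar>R i j\<bar> \<le> 1) \<and>
    real (card {(J, I) \<in> tuples r n \<times> tuples r n. \<bar>det (minor_mat R r J I)\<bar> \<ge> \<delta>}) \<ge> c * real n ^ (2 * r)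
    \<longrightarrow> (\<exists>G. real G \<ge> \<gamma> * real n \<and> many_nondegenerate r \<eta> G n R)"
proof -
  define \<gamma> where "\<gamma> = c / (16 * real r ^ 2)"
  define \<eta> where "\<eta> = \<delta> / ((real r + 1) * fact r)"
  define n0 where "n0 = nat \<lceil>1 / \<gamma>\<rceil> + 1"
  have \<gamma>: "\<gamma> > 0" unfolding \<gamma>_def using r c by simp
  have \<eta>: "\<eta> > 0" unfolding \<eta>_def using \<delta> by (intro divide_pos_pos mult_pos_pos) auto
  have "\<exists>G. real G \<ge> \<gamma> * n \<and> many_nondegenerate r \<eta> G n R"
    if n: "n \<ge> n0" and sym: "\<forall>i j. R i j = R j i" and R: "\<forall>i<n. \<forall>j<n. \<bar>R i j\<bar> \<le> 1"
      and many: "real (card {(J, I) \<in> tuples r n \<times> tuples r n. \<bar>det (minor_mat R r J I)\<bar> \<ge> \<delta>}) \<ge> c * real n ^ (2 * r)"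
    for n and R :: "nat \<Rightarrow> nat \<Rightarrow> real"
  proof -
    define G where "G = nat \<lfloor>2 * \<gamma> * n\<rfloor>"
    have "1 / \<gamma> \<le> n" using n unfolding n0_def by linarith
    then have "1 \<le> \<gamma> * n" using \<gamma> by (simp add: field_simps)
    then have G: "real G \<ge> \<gamma> * n" "real G \<le> 2 * \<gamma> * n" unfolding G_def by linarith+
    have n1: "n \<ge> 1" using n unfolding n0_def by simp
    \<comment> \<open>Chosen row tuples and chosen partners together block fewer tuples than are available.\<close>
    have rG: "real r * (2 * (real r * real G)) \<le> c / 4 * n"
    proof -
      have "real r * (2 * (real r * real G)) = 2 * real r ^ 2 * real G" by (simp add: power2_eq_square)
      also have "\<dots> \<le> 2 * real r ^ 2 * (2 * \<gamma> * n)" using G by (intro mult_left_mono) auto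
      also have "\<dots> = c / 4 * n" unfolding \<gamma>_def using r by (simp add: field_simps)
      finally show ?thesis .
    qed
    have nr: "real n ^ r > 0" using n1 by simp
    have enough: "r * (z + r * G) * n ^ r < card \<T> * n"
      if "real (card \<T>) \<ge> c / 2 * real n ^ r" "z \<le> r * G" for \<T> :: "(nat \<Rightarrow> nat) set" and z
    proof -
      have "real (r * (z + r * G) * n ^ r) \<le> real r * (2 * (real r * real G)) * real n ^ r"
      proof -
        have "real z \<le> real r * real G" using that(2) by (simp only: of_nat_mult[symmetric] of_nat_le_iff)
        then have "real z + real r * real G \<le> 2 * (real r * real G)" by linarith
        then have "real r * (real z + real r * real G) * real n ^ r \<le> real r * (2 * (real r * real G)) * real n ^ r"
          by (intro mult_right_mono mult_left_mono) auto
        then show ?thesis by simp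
      qed
      also have "\<dots> \<le> c / 4 * n * real n ^ r" using rG by (intro mult_right_mono) auto
      also have "\<dots> < c / 2 * real n ^ r * n" using c nr n1 by (simp add: field_simps)
      also have "\<dots> \<le> real (card \<T>) * n" using that(1) by (intro mult_right_mono) auto
      finally have "real (r * (z + r * G) * n ^ r) < real (card \<T> * n)" by simp
      then show ?thesis by (simp only: of_nat_less_iff)
    qed
    define L where "L J = {I \<in> tuples r n. \<bar>det (minor_mat R r J I)\<bar> \<ge> \<delta>}" for J
    define \<T> where "\<T> = {J \<in> tuples r n. real (card (L J)) \<ge> c / 2 * real n ^ r}"
    have "{(J, I) \<in> tuples r n \<times> tuples r n. \<bar>det (minor_mat R r J I)\<bar> \<ge> \<delta>} = Sigma (tuples r n) L"
      by (auto simp: L_def)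
    then have "c * real n ^ (2 * r) \<le> real (card (Sigma (tuples r n) L))" using many by simp
    also have "card (Sigma (tuples r n) L) = (\<Sum>J\<in>tuples r n. card (L J))"
      by (rule card_SigmaI) (auto simp: L_def)
    also have "real \<dots> = (\<Sum>J\<in>tuples r n. real (card (L J)))" by simp
    also have "\<dots> \<le> (\<Sum>J\<in>tuples r n. (if J \<in> \<T> then real n ^ r else 0) + c / 2 * real n ^ r)"
    proof (rule sum_mono)
      fix J assume J: "J \<in> tuples r n"
      have "card (L J) \<le> card (tuples r n)" by (rule card_mono) (auto simp: L_def)
      then have "real (card (L J)) \<le> real (n ^ r)" unfolding card_tuples by (simp only: of_nat_le_iff)
      then have "real (card (L J)) \<le> real n ^ r" by (simp only: of_nat_power)
      moreover have "0 \<le> c / 2 * real n ^ r" using c by simp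
      moreover have "real (card (L J)) < c / 2 * real n ^ r" if "J \<notin> \<T>" using J that by (simp add: \<T>_def)
      ultimately show "real (card (L J)) \<le> (if J \<in> \<T> then real n ^ r else 0) + c / 2 * real n ^ r"
        by (smt (verit))
    qed
    also have "\<dots> = card \<T> * real n ^ r + c / 2 * real n ^ (2 * r)"
    proof -
      have "tuples r n \<inter> \<T> = \<T>" by (auto simp: \<T>_def)
      then show ?thesis by (simp add: sum.distrib sum.If_cases card_tuples mult_2 power_add)
    qed
    finally have "c / 2 * real n ^ r * real n ^ r \<le> card \<T> * real n ^ r"
      by (simp add: mult_2 power_add)
    then have cardT: "real (card \<T>) \<ge> c / 2 * real n ^ r" using nr by simp
    have "\<exists>f. (\<forall>a<G. f a \<in> \<T> \<and> f a ` {..<r} \<inter> {} = {}) \<and> disjoint_family_on (\<lambda>a. f a ` {..<r}) {..<G}"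
    proof (rule exists_disjoint_tuples)
      show "\<T> \<subseteq> tuples r n" by (auto simp: \<T>_def)
      show "r * (card ({} :: nat set) + r * G) * n ^ r < card \<T> * n" using enough[OF cardT, of 0] by simp
    qed simp
    then obtain f where f: "\<And>a. a < G \<Longrightarrow> f a \<in> \<T>" and fd: "disjoint_family_on (\<lambda>a. f a ` {..<r}) {..<G}"
      by blast
    define Z where "Z = (\<Union>a<G. f a ` {..<r})"
    have Zn: "Z \<subseteq> {..<n}" unfolding Z_def using f by (fastforce simp: \<T>_def tuples_def PiE_iff)
    have "card Z \<le> (\<Sum>a<G. card (f a ` {..<r}))" unfolding Z_def by (rule card_UN_le) simp
    also have "\<dots> \<le> (\<Sum>a<G. r)" by (intro sum_mono) (metis card_image_le card_lessThan finite_lessThan)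
    finally have Zc: "card Z \<le> r * G" by (simp add: mult.commute)
    have "\<exists>h. (\<forall>b<G. h b \<in> L (f a) \<and> h b ` {..<r} \<inter> Z = {}) \<and> disjoint_family_on (\<lambda>b. h b ` {..<r}) {..<G}"
      if a: "a < G" for a
    proof (rule exists_disjoint_tuples[OF _ Zn enough[OF _ Zc]])
      show "L (f a) \<subseteq> tuples r n" by (auto simp: L_def)
      show "real (card (L (f a))) \<ge> c / 2 * real n ^ r" using f[OF a] by (simp add: \<T>_def)
    qed
    then obtain h where h: "\<And>a b. a < G \<Longrightarrow> b < G \<Longrightarrow> h a b \<in> L (f a)"
      "\<And>a b. a < G \<Longrightarrow> b < G \<Longrightarrow> h a b ` {..<r} \<inter> Z = {}"
      "\<And>a. a < G \<Longrightarrow> disjoint_family_on (\<lambda>b. h a b ` {..<r}) {..<G}"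
      by metis
    have ft: "f a \<in> tuples r n" if "a < G" for a using f[OF that] by (simp add: \<T>_def)
    have hd: "h a b \<in> tuples r n" "\<bar>det (minor_mat R r (f a) (h a b))\<bar> \<ge> \<delta>" if "a < G" "b < G" for a b
      using h(1)[OF that] by (auto simp: L_def)
    have nd: "card (f a ` {..<r}) = r" "card (h a b ` {..<r}) = r"
        "nondegenerate \<eta> R (f a ` {..<r}) (h a b ` {..<r})" if "a < G" "b < G" for a b
      using nondegenerate_if_large_minor[of R n "f a" r "h a b" \<delta>] sym R ft hd \<delta> that
      unfolding \<eta>_def by blast+
    have "many_nondegenerate r \<eta> G n R"
      unfolding many_nondegenerate_def
    proof (rule exI[of _ "\<lambda>a. f a ` {..<r}"], rule exI[of _ "\<lambda>a b. h a b ` {..<r}"], intro conjI allI impI)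
      fix a assume a: "a < G"
      show "f a ` {..<r} \<subseteq> {..<n}" using ft[OF a] by (auto simp: tuples_def PiE_iff)
      show "card (f a ` {..<r}) = r" by (rule nd(1)[OF a a])
      show "disjoint_family_on (\<lambda>b. h a b ` {..<r}) {..<G}" by (rule h(3)[OF a])
      fix b assume b: "b < G"
      show "h a b ` {..<r} \<subseteq> {..<n} - (\<Union>a<G. f a ` {..<r})"
        using h(2)[OF a b] hd(1)[OF a b] unfolding Z_def[symmetric] by (auto simp: tuples_def PiE_iff)
      show "card (h a b ` {..<r}) = r" by (rule nd(2)[OF a b])
      show "nondegenerate \<eta> R (f a ` {..<r}) (h a b ` {..<r})"
        by (rule nd(3)[OF a b])
    qed (rule fd)
    with G show ?thesis by blast
  qed
  note main = this
  show ?thesis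
    by (rule exI[where x = \<gamma>], rule conjI[OF \<gamma>], rule exI[where x = \<eta>], rule conjI[OF \<eta>],
        rule exI[where x = n0], intro allI impI, elim conjE) (rule main; assumption)
qed


section \<open>Quadratic polynomials and their coefficient matrices\<close>

abbreviation monom2 :: "nat \<Rightarrow> nat \<Rightarrow> nat \<Rightarrow>\<^sub>0 nat" where
  "monom2 i j \<equiv> Poly_Mapping.single i 1 + Poly_Mapping.single j 1"

definition quadratic_part :: "nat \<Rightarrow> (nat \<Rightarrow> nat \<Rightarrow> 'a::comm_ring_1) \<Rightarrow> 'a mpoly" where
  "quadratic_part n Q = (\<Sum>i<n. \<Sum>j<n. Poly_Mapping.single (monom2 i j) (Q i j))"

lemma quadratic_part_eq_matrix_form:
  "quadratic_part n Q = scalar_prod (vec n X) (map_mat Cst (mat n n (\<lambda>(i, j). Q i j)) *\<^sub>v vec n X)"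
  unfolding quadratic_part_def by (subst matrix_form_eq[of _ n]) auto

lemma monom2_neq_single: "monom2 i j \<noteq> Poly_Mapping.single a 1"
proof
  assume "monom2 i j = Poly_Mapping.single a 1"
  then have "Poly_Mapping.lookup (monom2 i j) k = Poly_Mapping.lookup (Poly_Mapping.single a (1::nat)) k" for k
    by simp
  from this[of i] this[of j] show False
    by (auto simp: lookup_add lookup_single when_def split: if_splits)
qed

lemma monom2_neq_0: "monom2 i j \<noteq> 0"
proof
  assume "monom2 i j = 0"
  then have "Poly_Mapping.lookup (monom2 i j) i = 0" by simp
  then show False by (simp add: lookup_add lookup_single)
qed

lemma keys_monom2: "Poly_Mapping.keys (monom2 i j) = {i, j}"
  by (auto simp: in_keys_iff lookup_add lookup_single when_def split: if_splits)

lemma mdeg_monom2: "mdeg (monom2 i j) = 2"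
  unfolding mdeg_def keys_monom2 by (cases "i = j") (auto simp: lookup_add lookup_single)

lemma mdeg_le_1_cases:
  assumes "mdeg m \<le> 1"
  obtains "m = 0" | a where "a \<in> Poly_Mapping.keys m" "m = Poly_Mapping.single a 1"
proof (cases "Poly_Mapping.keys m = {}")
  case True
  then show ?thesis using that(1) by simp
next
  case False
  then obtain a where a: "a \<in> Poly_Mapping.keys m" by blast
  have pos: "Poly_Mapping.lookup m i \<ge> 1" if "i \<in> Poly_Mapping.keys m" for i
    using that by (simp add: in_keys_iff Suc_le_eq)
  have sum: "mdeg m = Poly_Mapping.lookup m a + (\<Sum>i\<in>Poly_Mapping.keys m - {a}. Poly_Mapping.lookup m i)"
    unfolding mdeg_def using a by (intro sum.remove) auto
  then have 1: "Poly_Mapping.lookup m a = 1" and 0: "(\<Sum>i\<in>Poly_Mapping.keys m - {a}. Poly_Mapping.lookup m i) = 0"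
    using assms pos[OF a] by linarith+
  from 0 have "Poly_Mapping.keys m - {a} = {}" using pos by fastforce
  then have "Poly_Mapping.lookup m i = 0" if "i \<noteq> a" for i
    using that by (metis Diff_iff empty_iff in_keys_iff singletonD)
  then have "m = Poly_Mapping.single a 1"
    using 1 by (intro poly_mapping_eqI) (auto simp: lookup_single when_def)
  with a show ?thesis by (rule that(2))
qed

lemma lookup_quadratic_part_0:
  assumes "\<And>i j. i < n \<Longrightarrow> j < n \<Longrightarrow> m \<noteq> monom2 i j"
  shows "Poly_Mapping.lookup (quadratic_part n Q) m = 0"
  unfolding quadratic_part_def lookup_sum lookup_single
proof (intro sum.neutral ballI)
  fix i j assume "i \<in> {..<n}" "j \<in> {..<n}"
  with assms have "monom2 i j \<noteq> m" by blast
  then show "(Q i j when monom2 i j = m) = 0" unfolding when_def by (rule if_not_P)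
qed

text \<open>
  Off the diagonal the coefficient of a monomial is shared equally between the two entries of the symmetric
  matrix.
\<close>

lemma quadratic_poly_decomposition:
  fixes f :: "'a::field_char_0 mpoly"
  assumes f: "quadratic_poly n f"
  defines "Q \<equiv> \<lambda>i j. Poly_Mapping.lookup f (monom2 i j) / (if i = j then 1 else 2)"
  shows "f = quadratic_part n Q
      + (\<Sum>i<n. Poly_Mapping.single (Poly_Mapping.single i 1) (Poly_Mapping.lookup f (Poly_Mapping.single i 1)))
      + Poly_Mapping.single 0 (Poly_Mapping.lookup f 0)" (is "f = quadratic_part n Q + ?lin + ?const")
proof (rule poly_mapping_eqI)
  fix m
  let ?q = "Poly_Mapping.lookup (quadratic_part n Q) m"
  note quad0 = lookup_quadratic_part_0[of n m Q]
  have lin0: "Poly_Mapping.lookup ?lin m = 0" if "\<And>i. i < n \<Longrightarrow> m \<noteq> Poly_Mapping.single i 1"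
    unfolding lookup_sum lookup_single
    by (intro sum.neutral ballI) (use that in \<open>metis lessThan_iff when_simps(2)\<close>)
  have const0: "Poly_Mapping.lookup ?const m = 0" if "m \<noteq> 0"
    using that by (simp add: lookup_single when_def)
  consider (quad) a b where "a < n" "b < n" "m = monom2 a b" | (lin) a where "a < n" "m = Poly_Mapping.single a 1"
    | (const) "m = 0" | (none) "\<And>i j. i < n \<Longrightarrow> j < n \<Longrightarrow> m \<noteq> monom2 i j"
      "\<And>i. i < n \<Longrightarrow> m \<noteq> Poly_Mapping.single i 1" "m \<noteq> 0" by blast
  then show "Poly_Mapping.lookup f m = Poly_Mapping.lookup (quadratic_part n Q + ?lin + ?const) m"
  proof cases
    case quad
    have "?q = Poly_Mapping.lookup f m"
      unfolding quad(3) quadratic_part_eq_matrix_form using quad(1,2)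
      by (subst lookup_matrix_form[of _ n]) (auto simp: Q_def add.commute)
    moreover have "Poly_Mapping.lookup ?lin m = 0" unfolding quad(3)
      by (rule lin0[unfolded quad(3)]) (rule monom2_neq_single)
    moreover have "Poly_Mapping.lookup ?const m = 0"
      using const0 monom2_neq_0 unfolding quad(3) by blast
    ultimately show ?thesis by (simp add: lookup_add)
  next
    case lin
    have "Poly_Mapping.lookup ?lin m = (\<Sum>i<n. if i = a then Poly_Mapping.lookup f m else 0)"
      unfolding lookup_sum lookup_single lin(2) when_def
      by (intro sum.cong refl) (auto dest: arg_cong[where f = "\<lambda>p. Poly_Mapping.lookup p a"] simp: lookup_single when_def split: if_splits)
    then have "Poly_Mapping.lookup ?lin m = Poly_Mapping.lookup f m" using lin(1) by simp
    moreover have "?q = 0"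
      using quad0 monom2_neq_single unfolding lin(2) by metis
    moreover have "m \<noteq> 0" unfolding lin(2) by (metis lookup_single_eq lookup_zero zero_neq_one)
    ultimately show ?thesis using const0 by (simp add: lookup_add)
  next
    case const
    have "?q = 0" using quad0 monom2_neq_0 unfolding const by metis
    moreover have "Poly_Mapping.lookup ?lin m = 0"
      by (rule lin0) (use const in \<open>metis lookup_single_eq lookup_zero zero_neq_one\<close>)
    ultimately show ?thesis using const by (simp add: lookup_add)
  next
    case none
    have "m \<notin> Poly_Mapping.keys f"
    proof
      assume "m \<in> Poly_Mapping.keys f"
      then have m: "mdeg m \<le> 2" "Poly_Mapping.keys m \<subseteq> {..<n}"
        using f by (auto simp: quadratic_poly_def)
      show False
      proof (cases "mdeg m = 2")
        case True
        then show False using none(1) m(2) by (elim mdeg_2E) blast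
      next
        case False
        then have "mdeg m \<le> 1" using m by simp
        then show False using none(2,3) m(2) by (elim mdeg_le_1_cases) blast+
      qed
    qed
    then have "Poly_Mapping.lookup f m = 0" by (simp add: in_keys_iff)
    then show ?thesis using quad0[OF none(1)] lin0[OF none(2)] const0[OF none(3)] by (simp add: lookup_add)
  qed
qed

lemma peval_superset:
  assumes "finite S" "Poly_Mapping.keys p \<subseteq> S"
  shows "peval p a = (\<Sum>m\<in>S. Poly_Mapping.lookup p m * (\<Prod>i\<in>Poly_Mapping.keys m. a i ^ Poly_Mapping.lookup m i))"
  unfolding peval_def by (rule sum.mono_neutral_left) (use assms in \<open>auto simp: in_keys_iff\<close>)

lemma peval_add: "peval (p + q) a = peval p a + peval q a"
proof -
  let ?S = "Poly_Mapping.keys p \<union> Poly_Mapping.keys q"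
  have "peval (p + q) a = (\<Sum>m\<in>?S. Poly_Mapping.lookup (p + q) m * (\<Prod>i\<in>Poly_Mapping.keys m. a i ^ Poly_Mapping.lookup m i))"
    by (rule peval_superset) (use Poly_Mapping.keys_add[of p q] in auto)
  moreover have "peval p a = (\<Sum>m\<in>?S. Poly_Mapping.lookup p m * (\<Prod>i\<in>Poly_Mapping.keys m. a i ^ Poly_Mapping.lookup m i))"
    "peval q a = (\<Sum>m\<in>?S. Poly_Mapping.lookup q m * (\<Prod>i\<in>Poly_Mapping.keys m. a i ^ Poly_Mapping.lookup m i))"
    by (rule peval_superset; auto)+
  ultimately show ?thesis by (simp add: lookup_add distrib_right sum.distrib)
qed

lemma peval_sum: "peval (\<Sum>x\<in>A. p x) a = (\<Sum>x\<in>A. peval (p x) a)"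
proof (induction A rule: infinite_finite_induct)
  case (insert x A)
  then show ?case by (simp add: peval_add)
qed (simp_all add: peval_def)

lemma peval_single: "peval (Poly_Mapping.single m c) a = c * (\<Prod>i\<in>Poly_Mapping.keys m. a i ^ Poly_Mapping.lookup m i)"
  by (cases "c = 0") (simp_all add: peval_def)

lemma peval_quadratic_part: "peval (quadratic_part n Q) a = (\<Sum>i<n. \<Sum>j<n. Q i j * a i * a j)"
proof -
  have "(\<Prod>k\<in>Poly_Mapping.keys (monom2 i j). a k ^ Poly_Mapping.lookup (monom2 i j) k) = a i * a j" for i j
    unfolding keys_monom2 by (cases "i = j") (auto simp: lookup_add lookup_single power2_eq_square)
  then show ?thesis unfolding quadratic_part_def peval_sum peval_single by (simp add: mult.assoc)
qed

text \<open>
  A sum of \<open>k\<close> matrices of rank at most 1.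
\<close>

lemma rank_sum_le:
  fixes U V :: "nat \<Rightarrow> nat \<Rightarrow> 'a::field"
  shows "vec_space.rank n (mat n n (\<lambda>(i, j). \<Sum>b<k. U i b * V b j)) \<le> k"
proof (induction k)
  case 0
  have eq: "mat n n (\<lambda>(i, j). \<Sum>b<0. U i b * V b j) = 0\<^sub>m n n" by (rule eq_matI) auto
  show ?case unfolding eq vec_space.rank_0I by simp
next
  case (Suc k)
  let ?A = "mat n n (\<lambda>(i, j). \<Sum>b<k. U i b * V b j)" and ?B = "mat n n (\<lambda>(i, j). U i k * V k j)"
  have "mat n n (\<lambda>(i, j). \<Sum>b<Suc k. U i b * V b j) = ?A + ?B" by (rule eq_matI) auto
  then have "vec_space.rank n (mat n n (\<lambda>(i, j). \<Sum>b<Suc k. U i b * V b j))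
      \<le> vec_space.rank n ?A + vec_space.rank n ?B"
    using vec_space.rank_subadditive[of ?A n n ?B] by simp
  moreover have "vec_space.rank n ?B \<le> 1"
    by (rule vec_space.rank_le_1_product_entries[of _ _ n "\<lambda>i. U i k" "\<lambda>j. V k j"]) auto
  ultimately show ?case using Suc by simp
qed

lemma quadratic_form_quadratic_part: "quadratic_form n (quadratic_part n H)"
  unfolding quadratic_form_def
proof
  fix m assume m: "m \<in> Poly_Mapping.keys (quadratic_part n H)"
  have "\<exists>i<n. \<exists>j<n. m = monom2 i j"
  proof (rule ccontr)
    assume "\<not> ?thesis"
    then have "Poly_Mapping.lookup (quadratic_part n H) m = 0"
      by (intro lookup_quadratic_part_0) blast
    with m show False by (simp add: in_keys_iff)
  qed
  then show "Poly_Mapping.keys m \<subseteq> {..<n} \<and> mdeg m = 2" using keys_monom2 mdeg_monom2 by auto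
qed

lemma form_rank_quadratic_part:
  fixes H :: "nat \<Rightarrow> nat \<Rightarrow> 'a::field_char_0"
  assumes "\<And>i j. H i j = H j i"
  shows "form_rank n (quadratic_part n H) = vec_space.rank n (mat n n (\<lambda>(i, j). H i j))"
proof -
  have "represents n (mat n n (\<lambda>(i, j). H i j)) (quadratic_part n H)"
    unfolding represents_def quadratic_part_eq_matrix_form using assms by auto
  then have "(THE Q. represents n Q (quadratic_part n H)) = mat n n (\<lambda>(i, j). H i j)"
    by (rule the1_equality[OF represents_ex1[OF quadratic_form_quadratic_part]])
  then show ?thesis by (simp add: form_rank_def)
qed

lemma point_prob_eq_card:
  fixes f :: "'a::field_char_0 mpoly"
  shows "point_prob n f x = card {\<xi> \<in> PiE_dflt {..<n} 0 (\<lambda>_. {1, -1}). peval f \<xi> = x} / 2 ^ n"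
proof -
  have ne: "(1::'a) \<noteq> -1" by (metis one_neq_neg_one)
  define S where "S = PiE_dflt {..<n} (0::'a) (\<lambda>_. {1, -1})"
  have finS: "finite S" unfolding S_def by (intro finite_PiE_dflt) auto
  have cardS: "card S = 2 ^ n" unfolding S_def using ne by (subst card_PiE_dflt) (auto simp: numeral_2_eq_2)
  have neS: "S \<noteq> {}" using cardS by auto
  have "rademacher_seq n = pmf_of_set S"
    unfolding rademacher_seq_def rademacher_def S_def by (rule Pi_pmf_of_set) auto
  then show ?thesis
    unfolding point_prob_def using finS neS cardS
    by (simp add: measure_pmf_of_set S_def[symmetric] Collect_conj_eq Int_commute)
qed

context subfield_embedding
begin

definition coeff_norm :: "'a mpoly \<Rightarrow> real" where
  "coeff_norm p = (\<Sum>m\<in>Poly_Mapping.keys p. mag (Poly_Mapping.lookup p m))"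

lemma coeff_norm_superset:
  assumes "finite S" "Poly_Mapping.keys p \<subseteq> S"
  shows "coeff_norm p = (\<Sum>m\<in>S. mag (Poly_Mapping.lookup p m))"
  unfolding coeff_norm_def by (rule sum.mono_neutral_left) (use assms in \<open>auto simp: in_keys_iff\<close>)

lemma coeff_norm_add: "coeff_norm (p + q) \<le> coeff_norm p + coeff_norm q"
proof -
  let ?S = "Poly_Mapping.keys p \<union> Poly_Mapping.keys q"
  have "coeff_norm (p + q) = (\<Sum>m\<in>?S. mag (Poly_Mapping.lookup (p + q) m))"
    by (rule coeff_norm_superset) (use Poly_Mapping.keys_add[of p q] in auto)
  also have "\<dots> \<le> (\<Sum>m\<in>?S. mag (Poly_Mapping.lookup p m) + mag (Poly_Mapping.lookup q m))"
    unfolding lookup_add by (rule sum_mono) (rule mag_add)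
  also have "\<dots> = coeff_norm p + coeff_norm q"
    unfolding sum.distrib by (subst (1 2) coeff_norm_superset[of ?S]) auto
  finally show ?thesis .
qed

lemma coeff_norm_sum: "coeff_norm (\<Sum>x\<in>A. p x) \<le> (\<Sum>x\<in>A. coeff_norm (p x))"
proof (induction A rule: infinite_finite_induct)
  case (insert x A)
  then show ?case using coeff_norm_add[of "p x" "sum p A"] by simp
qed (simp_all add: coeff_norm_def)

lemma coeff_norm_single: "coeff_norm (Poly_Mapping.single m c) = mag c"
  by (cases "c = 0") (simp_all add: coeff_norm_def)

text \<open>
  Applying the real-linear functional \<open>z \<mapsto> Re (\<omega> z)\<close> to the values of \<open>f\<close> can only merge values.
  It maps \<open>f\<close> to a real quadratic polynomial in the same signs.
\<close>

lemma point_prob_le_quadratic_value: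
  assumes f: "quadratic_poly n f"
  defines "Q \<equiv> \<lambda>i j. Poly_Mapping.lookup f (monom2 i j) / (if i = j then 1 else 2)"
  shows "\<exists>l c v. point_prob n f x
    \<le> real (card {y \<in> signs {..<n}. quadratic_value n (\<lambda>i j. Re (\<omega> * emb (Q i j))) l c y = v}) / 2 ^ n"
proof -
  define S where "S = PiE_dflt {..<n} (0::'a) (\<lambda>_. {1, -1})"
  define l where "l i = Poly_Mapping.lookup f (Poly_Mapping.single i 1)" for i
  define c where "c = Poly_Mapping.lookup f 0"
  define tr where "tr \<xi> = restrict (\<lambda>i. Re (emb (\<xi> i))) {..<n}" for \<xi> :: "nat \<Rightarrow> 'a"
  let ?R = "\<lambda>i j. Re (\<omega> * emb (Q i j))" and ?l = "\<lambda>i. Re (\<omega> * emb (l i))" and ?c = "Re (\<omega> * emb c)"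
  let ?v = "quadratic_value n ?R ?l ?c"
  have pm: "\<xi> i = 1 \<or> \<xi> i = -1" if "\<xi> \<in> S" "i < n" for \<xi> i
    using that by (auto simp: S_def PiE_dflt_def)
  have tr: "emb (\<xi> i) = of_real (tr \<xi> i)" "tr \<xi> i = 1 \<or> tr \<xi> i = -1" if "\<xi> \<in> S" "i < n" for \<xi> i
    using pm[OF that] that by (auto simp: tr_def hom_distribs)
  have val: "?v (tr \<xi>) = Re (\<omega> * emb (peval f \<xi>))" if \<xi>: "\<xi> \<in> S" for \<xi>
  proof -
    have "peval f \<xi> = (\<Sum>i<n. \<Sum>j<n. Q i j * \<xi> i * \<xi> j) + (\<Sum>i<n. l i * \<xi> i) + c"
      by (subst quadratic_poly_decomposition[OF f])
        (simp add: peval_add peval_sum peval_single peval_quadratic_part Q_def l_def c_def)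
    then have "emb (peval f \<xi>) = (\<Sum>i<n. \<Sum>j<n. emb (Q i j) * emb (\<xi> i) * emb (\<xi> j)) + (\<Sum>i<n. emb (l i) * emb (\<xi> i)) + emb c"
      by (simp add: hom_add hom_sum hom_mult)
    also have "\<dots> = (\<Sum>i<n. \<Sum>j<n. emb (Q i j) * of_real (tr \<xi> i) * of_real (tr \<xi> j)) + (\<Sum>i<n. emb (l i) * of_real (tr \<xi> i)) + emb c"
      using tr(1)[OF \<xi>] by simp
    finally show ?thesis
      unfolding quadratic_value_def
      by (simp only: distrib_left sum_distrib_left plus_complex.sel Re_sum)
        (simp add: mult.assoc[symmetric])
  qed
  have "inj_on tr S"
  proof (rule inj_onI)
    fix \<xi> \<xi>' assume S: "\<xi> \<in> S" "\<xi>' \<in> S" and eq: "tr \<xi> = tr \<xi>'"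
    show "\<xi> = \<xi>'"
    proof
      fix i
      show "\<xi> i = \<xi>' i"
      proof (cases "i < n")
        case True
        have "emb (\<xi> i) = emb (\<xi>' i)" using tr(1)[OF S(1) True] tr(1)[OF S(2) True] eq by simp
        then show ?thesis by simp
      next
        case False
        then show ?thesis using S by (auto simp: S_def PiE_dflt_def)
      qed
    qed
  qed
  then have inj: "inj_on tr {\<xi> \<in> S. peval f \<xi> = x}" by (rule inj_on_subset) auto
  have "tr ` {\<xi> \<in> S. peval f \<xi> = x} \<subseteq> {y \<in> signs {..<n}. ?v y = Re (\<omega> * emb x)}"
  proof (intro image_subsetI CollectI conjI)
    fix \<xi> assume "\<xi> \<in> {\<xi> \<in> S. peval f \<xi> = x}"
    then have \<xi>: "\<xi> \<in> S" "peval f \<xi> = x" by auto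
    show "tr \<xi> \<in> signs {..<n}" unfolding signs_def
      by (rule PiE_I) (use tr(2)[OF \<xi>(1)] in \<open>auto simp: tr_def\<close>)
    show "?v (tr \<xi>) = Re (\<omega> * emb x)" using val[OF \<xi>(1)] \<xi>(2) by simp
  qed
  then have "card {\<xi> \<in> S. peval f \<xi> = x} \<le> card {y \<in> signs {..<n}. ?v y = Re (\<omega> * emb x)}"
    by (rule card_inj_on_le[OF inj]) simp
  then have "point_prob n f x \<le> real (card {y \<in> signs {..<n}. ?v y = Re (\<omega> * emb x)}) / 2 ^ n"
    unfolding point_prob_eq_card S_def by (simp add: divide_right_mono)
  then show ?thesis by blast
qed

text \<open>
  The 1-norm of the coefficients of the quadratic part of \<open>f - h\<close> is at most the entrywise 1-norm of the difference
  of the symmetric matrices, because the two off-diagonal entries add up to the coefficient.  The remaining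
  \<open>n + 1\<close> coefficients of \<open>f\<close> are estimated trivially.
\<close>

lemma close_quadratic_form_if_near_low_rank:
  assumes f: "quadratic_poly n f" and le: "\<And>m. mag (Poly_Mapping.lookup f m) \<le> 1"
  defines "Q \<equiv> \<lambda>i j. Poly_Mapping.lookup f (monom2 i j) / (if i = j then 1 else 2)"
  assumes near: "near_low_rank Q n k \<epsilon>" and k: "k < r"
  shows "\<exists>h. quadratic_form n h \<and> form_rank n h < r \<and> coeff_norm (f - h) \<le> \<epsilon> * real n ^ 2 + n + 1"
proof -
  obtain U N where N: "\<And>b c. N b c = N c b"
    and close: "(\<Sum>i<n. \<Sum>j<n. mag (Q i j - (\<Sum>b<k. \<Sum>c<k. U i b * N b c * U j c))) \<le> \<epsilon> * real n ^ 2"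
    using near unfolding near_low_rank_def by auto
  define H where "H i j = (\<Sum>b<k. \<Sum>c<k. U i b * N b c * U j c)" for i j
  define h where "h = quadratic_part n H"
  have symH: "H i j = H j i" for i j
  proof -
    have "H i j = (\<Sum>c<k. \<Sum>b<k. U i b * N b c * U j c)" unfolding H_def by (rule sum.swap)
    also have "\<dots> = H j i" unfolding H_def by (intro sum.cong refl) (simp add: N[of _ "_::nat"] mult_ac)
    finally show ?thesis .
  qed
  have "H i j = (\<Sum>b<k. U i b * (\<Sum>c<k. N b c * U j c))" for i j
    unfolding H_def by (simp add: sum_distrib_left mult.assoc)
  then have "mat n n (\<lambda>(i, j). H i j) = mat n n (\<lambda>(i, j). \<Sum>b<k. U i b * (\<Sum>c<k. N b c * U j c))" by simp
  then have "form_rank n h \<le> k"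
    unfolding h_def form_rank_quadratic_part[of H, OF symH] using rank_sum_le[where n = n and k = k and U = U and V = "\<lambda>b j. \<Sum>c<k. N b c * U j c"] by simp
  moreover have "coeff_norm (f - h) \<le> \<epsilon> * real n ^ 2 + n + 1"
  proof -
    have "f - h = quadratic_part n (\<lambda>i j. Q i j - H i j)
      + (\<Sum>i<n. Poly_Mapping.single (Poly_Mapping.single i 1) (Poly_Mapping.lookup f (Poly_Mapping.single i 1)))
      + Poly_Mapping.single 0 (Poly_Mapping.lookup f 0)" (is "_ = ?q + ?l + ?c")
    proof -
      have "quadratic_part n (\<lambda>i j. Q i j - H i j) = quadratic_part n Q - h"
        unfolding h_def quadratic_part_def by (simp add: single_diff sum_subtractf)
      moreover have "f - h = quadratic_part n Q + ?l + ?c - h"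
        unfolding Q_def by (rule arg_cong[where f = "\<lambda>p. p - h"], rule quadratic_poly_decomposition[OF f])
      moreover have "p1 + p2 + p3 - p4 = (p1 - p4) + p2 + p3" for p1 p2 p3 p4 :: "'a mpoly" by simp
      ultimately show ?thesis by (simp only:)
    qed
    then have "coeff_norm (f - h) \<le> coeff_norm ?q + coeff_norm ?l + coeff_norm ?c"
      using coeff_norm_add[of "?q + ?l" ?c] coeff_norm_add[of ?q ?l] by simp
    also have "coeff_norm ?q \<le> (\<Sum>i<n. \<Sum>j<n. mag (Q i j - H i j))"
      unfolding quadratic_part_def
      by (rule order.trans[OF coeff_norm_sum], rule sum_mono, rule order.trans[OF coeff_norm_sum])
        (simp add: coeff_norm_single)
    also have "\<dots> \<le> \<epsilon> * real n ^ 2" using close unfolding H_def .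
    also have "coeff_norm ?l \<le> (\<Sum>i<n. 1)"
      by (rule order.trans[OF coeff_norm_sum], rule sum_mono) (simp add: coeff_norm_single le)
    also have "coeff_norm ?c \<le> 1" by (simp add: coeff_norm_single le)
    finally show ?thesis by simp
  qed
  ultimately show ?thesis using k quadratic_form_quadratic_part unfolding h_def by (meson le_less_trans)
qed



section \<open>The inverse theorem\<close>

text \<open>
  The factor \<open>1 - \<i> t\<close> turns a complex matrix \<open>A + \<i> B\<close> into one with real part \<open>A + t B\<close>; dividing by \<open>r + 1\<close>
  keeps entries of absolute value at most 1 below that bound.  Every large minor of \<open>Q\<close> stays large for at least one of
  the \<open>r + 1\<close> values of \<open>t\<close>, so one value works for a fraction \<open>1 / (r + 1)\<close> of them.
\<close>

lemma exists_real_direction: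
  fixes Q :: "nat \<Rightarrow> nat \<Rightarrow> 'a" and r :: nat and c \<delta> :: real
  assumes \<delta>: "\<delta> > 0" and many: "real (card (large_minors Q n r \<delta>)) \<ge> c"
  defines "\<omega> \<equiv> \<lambda>t::nat. Complex 1 (- real t) / of_real (real r + 1)"
  defines "\<delta>' \<equiv> \<delta> / (2 * (2 * real r + 3) ^ r) / (real r + 1) ^ r"
  shows "\<exists>t\<le>r. real (card {(J, I) \<in> tuples r n \<times> tuples r n.
      \<bar>det (minor_mat (\<lambda>i j. Re (\<omega> t * emb (Q i j))) r J I)\<bar> \<ge> \<delta>'}) \<ge> c / (real r + 1)"
proof (rule ccontr)
  let ?D = "\<lambda>t J I. det (minor_mat (\<lambda>i j. Re (\<omega> t * emb (Q i j))) r J I)"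
  define P where "P t = {(J, I) \<in> tuples r n \<times> tuples r n.
      \<bar>?D t J I\<bar> \<ge> \<delta>'}" for t
  assume "\<not> ?thesis"
  then have few: "real (card (P t)) < c / (real r + 1)" if "t \<le> r" for t
    using that unfolding P_def by (meson not_le)
  have finP: "finite (P t)" for t
    unfolding P_def by (rule finite_subset[of _ "tuples r n \<times> tuples r n"]) auto
  have "large_minors Q n r \<delta> \<subseteq> (\<Union>t\<le>r. P t)"
  proof (rule subsetI)
    fix p assume p: "p \<in> large_minors Q n r \<delta>"
    obtain J I where [simp]: "p = (J, I)" by (cases p)
    have JI: "J \<in> tuples r n" "I \<in> tuples r n" "mag (det (minor_mat Q r J I)) \<ge> \<delta>"
      using p by (auto simp: large_minors_def)
    have "map_mat emb (minor_mat Q r J I) = minor_mat (\<lambda>i j. emb (Q i j)) r J I"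
      by (rule eq_matI) (auto simp: minor_mat_def)
    then have "mag (det (minor_mat Q r J I)) = cmod (det (minor_mat (\<lambda>i j. emb (Q i j)) r J I))"
      unfolding mag_def hom_det[symmetric] by simp
    with JI have "cmod (det (minor_mat (\<lambda>i j. emb (Q i j)) r J I)) \<ge> \<delta>" by simp
    from large_real_minor[OF this \<delta>] obtain t where t: "t \<le> r"
      "\<bar>det (minor_mat (\<lambda>i j. Re (emb (Q i j)) + real t * Im (emb (Q i j))) r J I)\<bar> \<ge> \<delta> / (2 * (2 * real r + 3) ^ r)"
      by blast
    have "minor_mat (\<lambda>i j. Re (emb (Q i j)) + real t * Im (emb (Q i j))) r J I
        = (real r + 1) \<cdot>\<^sub>m minor_mat (\<lambda>i j. Re (\<omega> t * emb (Q i j))) r J I"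
    proof -
      have "Re (emb z) + real t * Im (emb z) = (real r + 1) * Re (\<omega> t * emb z)" for z
      proof -
        have "of_real (real r + 1) * (\<omega> t * emb z) = Complex 1 (- real t) * emb z"
          unfolding \<omega>_def by (simp add: of_nat_neq_0 add.commute flip: of_nat_Suc)
        from arg_cong[OF this, of Re]
        have "Re (of_real (real r + 1) * (\<omega> t * emb z)) = Re (Complex 1 (- real t) * emb z)" .
        also have "\<dots> = Re (emb z) + real t * Im (emb z)" by simp
        finally have "Re (of_real (real r + 1) * (\<omega> t * emb z)) = Re (emb z) + real t * Im (emb z)" .
        moreover have "Re (of_real (real r + 1) * (\<omega> t * emb z)) = (real r + 1) * Re (\<omega> t * emb z)"
          unfolding times_complex.sel(1)[of "of_real _"] by simp
        ultimately show ?thesis by simp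
      qed
      then show ?thesis by (intro eq_matI) (auto simp: minor_mat_def)
    qed
    then have "\<bar>det (minor_mat (\<lambda>i j. Re (emb (Q i j)) + real t * Im (emb (Q i j))) r J I)\<bar>
        = (real r + 1) ^ r * \<bar>?D t J I\<bar>"
      by (simp add: det_smult abs_mult minor_mat_def)
    with t(2) have "\<bar>?D t J I\<bar> * (real r + 1) ^ r
        \<ge> \<delta> / (2 * (2 * real r + 3) ^ r)" by (simp only: mult.commute)
    then have "\<bar>?D t J I\<bar> \<ge> \<delta>'"
      unfolding \<delta>'_def by (subst pos_divide_le_eq) auto
    with JI t show "p \<in> (\<Union>t\<le>r. P t)" by (auto simp: P_def)
  qed
  then have "card (large_minors Q n r \<delta>) \<le> card (\<Union>t\<le>r. P t)" by (intro card_mono) (auto simp: finP)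
  also have "\<dots> \<le> (\<Sum>t\<le>r. card (P t))" by (rule card_UN_le) simp
  finally have "real (card (large_minors Q n r \<delta>)) \<le> real (\<Sum>t\<le>r. card (P t))" by (simp only: of_nat_le_iff)
  also have "\<dots> = (\<Sum>t\<le>r. real (card (P t)))" by simp
  also have "\<dots> < (\<Sum>t\<le>r. c / (real r + 1))" by (rule sum_strict_mono) (use few in auto)
  also have "\<dots> = c" by (simp add: add.commute add_nonneg_eq_0_iff)
  finally show False using many by simp
qed

lemma point_prob_bound_or_close_form:
  fixes r :: nat and \<epsilon> :: real
  assumes r: "r \<ge> 3" and \<epsilon>: "\<epsilon> > 0"
  shows "\<exists>C n0. \<forall>n\<ge>n0. \<forall>f. quadratic_poly n f \<and> (\<forall>m. mag (Poly_Mapping.lookup f m) \<le> 1) \<longrightarrow>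
    (\<forall>x. point_prob n f x \<le> C * (ln n powr (r / 2) / n powr (1 - 2 / (r + 2)))) \<or>
    (\<exists>h. quadratic_form n h \<and> form_rank n h < r \<and> coeff_norm (f - h) \<le> \<epsilon> * real n ^ 2)"
proof -
  let ?b = "\<lambda>n::nat. ln n powr (r / 2) / n powr (1 - 2 / (r + 2))"
  from near_low_rank_or_large_minors[of "\<epsilon> / 2" r] \<epsilon> obtain c \<delta> where c: "c > 0" "\<delta> > 0"
    and dich: "\<forall>n\<ge>1. \<forall>Q. (\<forall>i j. Q i j = Q j i) \<and> (\<forall>i<n. \<forall>j<n. mag (Q i j) \<le> 1)
      \<longrightarrow> (\<exists>k<r. near_low_rank Q n k (\<epsilon> / 2)) \<or> real (card (large_minors Q n r \<delta>)) \<ge> c * real n ^ (2 * r)"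
    by auto
  define \<omega> where "\<omega> t = Complex 1 (- real t) / of_real (real r + 1)" for t :: nat
  define \<delta>' where "\<delta>' = \<delta> / (2 * (2 * real r + 3) ^ r) / (real r + 1) ^ r"
  define c' where "c' = c / (real r + 1)"
  have c': "c' > 0" "\<delta>' > 0"
    unfolding c'_def \<delta>'_def using c by (auto intro!: divide_pos_pos mult_pos_pos zero_less_power add_nonneg_pos)
  from many_nondegenerate_if_many_large_minors[of r, OF _ c'] r obtain \<gamma> \<eta> n1 where pos: "\<gamma> > 0" "\<eta> > 0"
    and nondeg: "\<forall>n\<ge>n1. \<forall>R::nat \<Rightarrow> nat \<Rightarrow> real.
      (\<forall>i j. R i j = R j i) \<and> (\<forall>i<n. \<forall>j<n. \<bar>R i j\<bar> \<le> 1) \<and>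
      real (card {(J, I) \<in> tuples r n \<times> tuples r n. \<bar>det (minor_mat R r J I)\<bar> \<ge> \<delta>'}) \<ge> c' * real n ^ (2 * r)
      \<longrightarrow> (\<exists>G. real G \<ge> \<gamma> * real n \<and> many_nondegenerate r \<eta> G n R)"
    by auto
  from anticoncentration[OF r, of 1 \<eta> \<gamma>] pos obtain C n2 where anti: "\<forall>n\<ge>n2. \<forall>R l c G v.
    (\<forall>i j. R i j = R j i) \<and> (\<forall>i<n. \<forall>j<n. \<bar>R i j\<bar> \<le> 1) \<and> real G \<ge> \<gamma> * real n \<and> many_nondegenerate r \<eta> G n R
    \<longrightarrow> real (card {x\<in>signs {..<n}. quadratic_value n R l c x = v}) / 2 ^ n
      \<le> C * ?b n"
    by auto
  define n3 where "n3 = nat \<lceil>4 / \<epsilon>\<rceil> + 1"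
  have "(\<forall>x. point_prob n f x \<le> C * ?b n) \<or>
    (\<exists>h. quadratic_form n h \<and> form_rank n h < r \<and> coeff_norm (f - h) \<le> \<epsilon> * real n ^ 2)"
    if n: "n \<ge> max n1 (max n2 n3)" and f: "quadratic_poly n f" and le: "\<forall>m. mag (Poly_Mapping.lookup f m) \<le> 1" for n f
  proof -
    have n': "n \<ge> n1" "n \<ge> n2" "n \<ge> n3" "n \<ge> 1" using n by (auto simp: n3_def)
    have "4 / \<epsilon> \<le> n" using n'(3) unfolding n3_def by linarith
    then have "4 \<le> \<epsilon> * n" using \<epsilon> by (simp add: field_simps)
    then have "4 * real n \<le> \<epsilon> * n * n" by (intro mult_right_mono) auto
    moreover have "\<epsilon> / 2 * real n ^ 2 = \<epsilon> * n * n / 2" by (simp add: power2_eq_square)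
    ultimately have small: "real n + 1 \<le> \<epsilon> / 2 * real n ^ 2" using n'(4) by linarith
    define Q where "Q i j = Poly_Mapping.lookup f (monom2 i j) / (if i = j then 1 else 2)" for i j
    have Qsym: "\<forall>i j. Q i j = Q j i" by (simp add: Q_def add.commute)
    have Qle: "mag (Q i j) \<le> 1" for i j
      using le[rule_format, of "monom2 i j"] by (auto simp: Q_def mag_divide intro: order.trans[rotated])
    from dich n' Qsym Qle have "(\<exists>k<r. near_low_rank Q n k (\<epsilon> / 2)) \<or> real (card (large_minors Q n r \<delta>)) \<ge> c * real n ^ (2 * r)"
      by blast
    then show ?thesis
    proof
      assume "\<exists>k<r. near_low_rank Q n k (\<epsilon> / 2)"
      then obtain k where k: "k < r" "near_low_rank Q n k (\<epsilon> / 2)" by blast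
      from close_quadratic_form_if_near_low_rank[OF f _ _ k(1), of "\<epsilon> / 2"] k(2) le
      obtain h where "quadratic_form n h" "form_rank n h < r" "coeff_norm (f - h) \<le> \<epsilon> / 2 * real n ^ 2 + n + 1"
        unfolding Q_def by auto
      moreover have "\<epsilon> / 2 * real n ^ 2 + n + 1 \<le> \<epsilon> * real n ^ 2" using small by simp
      ultimately show ?thesis by (meson order.trans)
    next
      assume "real (card (large_minors Q n r \<delta>)) \<ge> c * real n ^ (2 * r)"
      from exists_real_direction[OF c(2) this] obtain t where t: "t \<le> r"
        "real (card {(J, I) \<in> tuples r n \<times> tuples r n.
          \<bar>det (minor_mat (\<lambda>i j. Re (\<omega> t * emb (Q i j))) r J I)\<bar> \<ge> \<delta>'}) \<ge> c' * real n ^ (2 * r)"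
        unfolding \<omega>_def \<delta>'_def c'_def by auto
      define R where "R i j = Re (\<omega> t * emb (Q i j))" for i j
      have Rsym: "\<forall>i j. R i j = R j i" using Qsym by (simp add: R_def)
      have Rle: "\<bar>R i j\<bar> \<le> 1" for i j
      proof -
        have "cmod (Complex 1 (- real t)) \<le> \<bar>1\<bar> + \<bar>- real t\<bar>"
          using cmod_le[of "Complex 1 (- real t)"] by simp
        also have "\<dots> \<le> real r + 1" using t(1) by simp
        finally have "cmod (\<omega> t) \<le> 1"
          unfolding \<omega>_def norm_divide norm_of_real by simp
        then have "cmod (\<omega> t) * cmod (emb (Q i j)) \<le> 1 * 1"
          using Qle[of i j] unfolding mag_def by (intro mult_mono) auto
        then show ?thesis unfolding R_def using abs_Re_le_cmod[of "\<omega> t * emb (Q i j)"]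
          by (simp add: norm_mult)
      qed
      from nondeg n' Rsym Rle t(2) obtain G where G: "real G \<ge> \<gamma> * real n" "many_nondegenerate r \<eta> G n R"
        unfolding R_def[symmetric] by blast
      have "point_prob n f x \<le> C * ?b n" for x
      proof -
        obtain l b v where "point_prob n f x
            \<le> real (card {y \<in> signs {..<n}. quadratic_value n R l b y = v}) / 2 ^ n"
          using point_prob_le_quadratic_value[OF f, of x "\<omega> t"] unfolding R_def Q_def by blast
        also have "\<dots> \<le> C * ?b n"
          using anti n' Rsym Rle G by blast
        finally show ?thesis .
      qed
      then show ?thesis by blast
    qed
  qed
  then show ?thesis by (intro exI[of _ C] exI[of _ "max n1 (max n2 n3)"]) blast
qed

text \<open>
  For the finitely many \<open>n\<close> below the threshold \<open>n0\<close>, a large constant makes the required probability exceed 1, so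
  that no polynomial satisfies the hypothesis.  The statement for all larger constants \<open>C\<close> permits one constant for several
  fields.
\<close>

lemma inverse_theorem:
  fixes r :: nat and \<epsilon> :: real
  assumes r: "r \<ge> 3" and \<epsilon>: "\<epsilon> > 0"
  shows "\<exists>C0::real. \<forall>C\<ge>C0. \<forall>n\<ge>2. \<forall>f. quadratic_poly n f \<and> (\<forall>m. mag (Poly_Mapping.lookup f m) \<le> 1) \<and>
    (SUP x. point_prob n f x) \<ge> C * (ln n powr (r / 2) / n powr (1 - 2 / (r + 2))) \<longrightarrow>
    (\<exists>h. quadratic_form n h \<and> form_rank n h < r \<and> coeff_norm (f - h) \<le> \<epsilon> * real n ^ 2)"
proof -
  define b where "b n = ln (real n) powr (r / 2) / n powr (1 - 2 / (r + 2))" for n :: nat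
  have b: "b n > 0" if "n \<ge> 2" for n using that by (simp add: b_def)
  from point_prob_bound_or_close_form[OF r \<epsilon>] obtain C1 n0 where main: "\<And>n f. n \<ge> n0 \<Longrightarrow>
    quadratic_poly n f \<Longrightarrow> \<forall>m. mag (Poly_Mapping.lookup f m) \<le> 1 \<Longrightarrow>
    (\<forall>x. point_prob n f x \<le> C1 * b n) \<or>
    (\<exists>h. quadratic_form n h \<and> form_rank n h < r \<and> coeff_norm (f - h) \<le> \<epsilon> * real n ^ 2)"
    unfolding b_def by blast
  define C0 where "C0 = max C1 0 + 1 + (\<Sum>n=2..<n0. 2 / b n)"
  have S0: "(\<Sum>n=2..<n0. 2 / b n) \<ge> 0" by (intro sum_nonneg divide_nonneg_nonneg) (use b less_imp_le in auto)
  have "\<exists>h. quadratic_form n h \<and> form_rank n h < r \<and> coeff_norm (f - h) \<le> \<epsilon> * real n ^ 2"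
    if C: "C \<ge> C0" and n: "n \<ge> 2" and f: "quadratic_poly n f" and le: "\<forall>m. mag (Poly_Mapping.lookup f m) \<le> 1"
      and sup: "(SUP x. point_prob n f x) \<ge> C * b n" for C n f
  proof (cases "n \<ge> n0")
    case True
    have "\<not> (\<forall>x. point_prob n f x \<le> C1 * b n)"
    proof
      assume "\<forall>x. point_prob n f x \<le> C1 * b n"
      then have "(SUP x. point_prob n f x) \<le> C1 * b n" by (intro cSUP_least) auto
      also have "\<dots> < C * b n" using C S0 b[OF n] by (intro mult_strict_right_mono) (auto simp: C0_def)
      finally show False using sup by simp
    qed
    with main[OF True f le] show ?thesis by blast
  next
    case False
    have "(SUP x. point_prob n f x) \<le> 1" by (intro cSUP_least) (auto simp: point_prob_def)
    also have "1 < 2 / b n * b n" using b[OF n] by simp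
    also have "\<dots> \<le> C * b n"
    proof (rule mult_right_mono)
      have "2 / b n \<le> (\<Sum>n=2..<n0. 2 / b n)"
        by (rule member_le_sum) (use False n b less_imp_le in auto)
      then show "2 / b n \<le> C" using C by (simp add: C0_def)
    qed (use b[OF n] in simp)
    finally show ?thesis using sup by simp
  qed
  then show ?thesis unfolding b_def by blast
qed

end

theorem theorem1p1:
  fixes r :: nat and \<epsilon> :: real
  assumes "r \<ge> 3" and "0 < \<epsilon>" and "\<epsilon> \<le> 1"
  shows "\<exists>C::real. \<forall>n\<ge>2.
    (\<forall>f :: complex mpoly.
       quadratic_poly n f \<and> (\<forall>m. norm (Poly_Mapping.lookup f m) \<le> 1) \<and>
       (SUP x. point_prob n f x) \<ge> C * (ln n powr (r / 2) / n powr (1 - 2 / (r + 2)))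
       \<longrightarrow> (\<exists>h. quadratic_form n h \<and> form_rank n h < r \<and>
             (\<Sum>m\<in>Poly_Mapping.keys (f - h). norm (Poly_Mapping.lookup (f - h) m)) \<le> \<epsilon> * n ^ 2)) \<and>
    (\<forall>f :: real mpoly.
       quadratic_poly n f \<and> (\<forall>m. \<bar>Poly_Mapping.lookup f m\<bar> \<le> 1) \<and>
       (SUP x. point_prob n f x) \<ge> C * (ln n powr (r / 2) / n powr (1 - 2 / (r + 2)))
       \<longrightarrow> (\<exists>h. quadratic_form n h \<and> form_rank n h < r \<and>
             (\<Sum>m\<in>Poly_Mapping.keys (f - h). \<bar>Poly_Mapping.lookup (f - h) m\<bar>) \<le> \<epsilon> * n ^ 2)) \<and>
    (\<forall>f :: rat mpoly.
       quadratic_poly n f \<and> (\<forall>m. \<bar>Poly_Mapping.lookup f m\<bar> \<le> 1) \<and>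
       (SUP x. point_prob n f x) \<ge> C * (ln n powr (r / 2) / n powr (1 - 2 / (r + 2)))
       \<longrightarrow> (\<exists>h. quadratic_form n h \<and> form_rank n h < r \<and>
             real_of_rat (\<Sum>m\<in>Poly_Mapping.keys (f - h). \<bar>Poly_Mapping.lookup (f - h) m\<bar>) \<le> \<epsilon> * n ^ 2))"
proof -
  \<comment> \<open>The real case is covered by \<open>real_embedding\<close>.\<close>
  interpret C: subfield_embedding "id :: complex \<Rightarrow> complex" by unfold_locales simp_all
  interpret Q: subfield_embedding "of_rat :: rat \<Rightarrow> complex"
    by unfold_locales (simp_all add: of_rat_add of_rat_mult)
  have mag: "C.mag z = norm z" "real_embedding.mag x = \<bar>x\<bar>" "Q.mag q = real_of_rat \<bar>q\<bar>" for z x q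
  proof -
    have "complex_of_real (real_of_rat q) = of_rat q"
      by (cases q) (simp add: of_rat_rat)
    then have "cmod (of_rat q) = \<bar>real_of_rat q\<bar>" by (metis norm_of_real)
    then show "Q.mag q = real_of_rat \<bar>q\<bar>" by (simp add: Q.mag_def)
  qed (simp_all add: C.mag_def real_embedding.mag_def)
  have Qle: "Q.mag q \<le> 1 \<longleftrightarrow> \<bar>q\<bar> \<le> 1" for q unfolding mag by simp
  have Qnorm: "Q.coeff_norm p = real_of_rat (\<Sum>m\<in>Poly_Mapping.keys p. \<bar>Poly_Mapping.lookup p m\<bar>)" for p
    unfolding Q.coeff_norm_def mag by (simp add: of_rat_sum)
  obtain C1 where C1: "\<And>C n f. C \<ge> C1 \<Longrightarrow> n \<ge> 2 \<Longrightarrow> quadratic_poly n f \<and> (\<forall>m. norm (Poly_Mapping.lookup f m) \<le> 1) \<and>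
    (SUP x. point_prob n f x) \<ge> C * (ln n powr (r / 2) / n powr (1 - 2 / (r + 2))) \<Longrightarrow>
    (\<exists>h. quadratic_form n h \<and> form_rank n h < r \<and>
      (\<Sum>m\<in>Poly_Mapping.keys (f - h). norm (Poly_Mapping.lookup (f - h) m :: complex)) \<le> \<epsilon> * real n ^ 2)"
    using C.inverse_theorem[OF assms(1,2)] unfolding mag C.coeff_norm_def by blast
  obtain C2 where C2: "\<And>C n f. C \<ge> C2 \<Longrightarrow> n \<ge> 2 \<Longrightarrow> quadratic_poly n f \<and> (\<forall>m. \<bar>Poly_Mapping.lookup f m\<bar> \<le> 1) \<and>
    (SUP x. point_prob n f x) \<ge> C * (ln n powr (r / 2) / n powr (1 - 2 / (r + 2))) \<Longrightarrow>
    (\<exists>h. quadratic_form n h \<and> form_rank n h < r \<and>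
      (\<Sum>m\<in>Poly_Mapping.keys (f - h). \<bar>Poly_Mapping.lookup (f - h) m :: real\<bar>) \<le> \<epsilon> * real n ^ 2)"
    using real_embedding.inverse_theorem[OF assms(1,2)] unfolding mag real_embedding.coeff_norm_def by blast
  obtain C3 where C3: "\<And>C n f. C \<ge> C3 \<Longrightarrow> n \<ge> 2 \<Longrightarrow> quadratic_poly n f \<and> (\<forall>m. \<bar>Poly_Mapping.lookup f m\<bar> \<le> 1) \<and>
    (SUP x. point_prob n f x) \<ge> C * (ln n powr (r / 2) / n powr (1 - 2 / (r + 2))) \<Longrightarrow>
    (\<exists>h. quadratic_form n h \<and> form_rank n h < r \<and>
      real_of_rat (\<Sum>m\<in>Poly_Mapping.keys (f - h). \<bar>Poly_Mapping.lookup (f - h) m :: rat\<bar>) \<le> \<epsilon> * real n ^ 2)"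
    using Q.inverse_theorem[OF assms(1,2)] unfolding Qle Qnorm by blast
  define C where "C = max C1 (max C2 C3)"
  have C: "C \<ge> C1" "C \<ge> C2" "C \<ge> C3" by (auto simp: C_def)
  show ?thesis
    unfolding of_nat_power
    by (rule exI[of _ C], intro allI impI conjI) (rule C1[OF C(1)] C2[OF C(2)] C3[OF C(3)]; assumption)+
qed

end
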